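(* Let $k\ge2$, let $S$ be a singular surface in $\mathbb{R}^3$ parameterized by a smooth map-germ $f\colon(\mathbb{R}^2,\mathbf{0})\to(\mathbb{R}^3,\mathbf{0})$ that is $\mathcal{A}$-equivalent to $H_k$, and suppose that the singular point $f(\mathbf{0})$ of $S$ is not an inflection point. Let $\gamma(t)$ and $\hat\gamma(t)$ be parameterizations, respectively, of the regular and the singular branch of the parabolic set on $S$, with $\gamma(0)$ and $\hat\gamma(0)$ being the singular point. Let $\mathbf{b}(t)$ and $\hat{\mathbf{b}}(t)$ be the unit binormal vectors of $\gamma$ and $\hat\gamma$, respectively. Then the height function on $S$ along $\pm\mathbf{b}(0)$ has an $A_1$-singularity at the singular point of $S$, and the height function on $S$ along $\pm\lim_{t\to0^+}\hat{\mathbf{b}}(t)$ has an $A_2$-singularity at the singular point of $S$.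
   Context: **$\mathcal{A}$-equivalence and $H_k$.** Smooth map-germs $f,g\colon(\mathbb{R}^2,\mathbf{0})\to(\mathbb{R}^3,\mathbf{0})$ are $\mathcal{A}$-equivalent if $g=\Phi\circ f\circ\phi^{-1}$ for diffeomorphism germs $\phi$ of $(\mathbb{R}^2,\mathbf{0})$ and $\Phi$ of $(\mathbb{R}^3,\mathbf{0})$. For $k\ge2$, $H_k$ denotes the class of the germ $(x,y)\mapsto(x,\,xy+y^{3k-1},\,y^3)$. Such germs have corank 1 at $\mathbf{0}$. **Inflection point.** The tangent line of $S$ at $f(\mathbf{0})$ is the image of $df_{\mathbf{0}}$, and the normal plane is the plane through $f(\mathbf{0})$ perpendicular to it. Write the orthogonal projection of $f$ onto the normal plane as $(u,v)\mapsto(p(u,v),q(u,v))$. The group $\mathrm{GL}(2,\mathbb{R})\times\mathrm{GL}(2,\mathbb{R})$ acts on the pair of quadratic forms $(j^2p,j^2q)$ by linear changes in source and target. The singular point is called hyperbolic, elliptic, parabolic, inflection, degenerate inflection if the orbit of $(j^2p,j^2q)$ is that of $(x^2,y^2)$; $(xy,x^2-y^2)$; $(x^2,xy)$; $(x^2\pm y^2,0)$; $(x^2,0)$ or $(0,0)$, respectively. **Parabolic set.** The parabolic set of $S$ in the source is the zero set of $$P(u,v)=\langle f_u\times f_v,f_{uu}\rangle\langle f_u\times f_v,f_{vv}\rangle-\langle f_u\times f_v,f_{uv}\rangle^2 .$$ When $f$ is $\mathcal{A}$-equivalent to $H_k$ and $f(\mathbf{0})$ is not an inflection point, $P$ has a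 $D_5$-singularity at $(0,0)$, so its zero set consists of exactly two local branches: a regular curve and a $(2,3)$-cusp. The regular (resp. singular) branch of the parabolic set on $S$ is the image under $f$ of the regular curve (resp. of the $(2,3)$-cusp). Thus $\gamma=f\circ\alpha$ and $\hat\gamma=f\circ\hat\alpha$, where $\alpha$ is a regular parameterization of the regular curve with $\alpha(0)=\mathbf{0}$ and $\hat\alpha$ is a parameterization of the $(2,3)$-cusp with $\hat\alpha(0)=\mathbf{0}$ of $(2,3)$-cusp type (i.e. $\hat\alpha'(0)=\mathbf{0}$ and $\hat\alpha''(0),\hat\alpha'''(0)$ linearly independent). The unit binormal vector of a space curve $c$ is $c'\times c''/|c'\times c''|$; for $\hat\gamma$ it is considered for small $t\ne0$. **Height functions.** The height function on $S$ along a unit vector $\mathbf{w}\in S^2\subset\mathbb{R}^3$ is $h_{\mathbf{w}}(u,v)=\langle f(u,v),\mathbf{w}\rangle$, and "at the singular point" means at $(0,0)$. **Singularity types.** Function-germs $f,g\colon(\mathbb{R}^2,\mathbf{0})\to(\mathbb{R},0)$ are $\mathcal{K}$-equivalent if $g=\lambda\cdot(f\circ\phi^{-1})$ with $\phi$ a diffeomorphism germ of $(\mathbb{R}^2,\mathbf{0})$ and $\lambda$ a smooth function-germ with $\lambda(\mathbf{0})\neq0$. A germ has an $A_k$-singularity if it is $\mathcal{K}$-equivalent to $x^2\pm y^{k+1}$, and a $D_k$-singularity ($k\ge4$) if it is $\mathcal{K}$-equivalent to $x^2y\pm y^{k-1}$. *)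

theory Defs
  imports "HOL-Analysis.Analysis"
begin

section \<open>Smooth germs at the origin\<close>

text \<open>Germs at the origin are represented by total functions; only their values near 0 matter.
  The set argument of \<open>Ck_on\<close> and \<open>smooth_on\<close> is meant to be open.\<close>

primrec Ck_on ::
  "nat \<Rightarrow> 'a::real_normed_vector set \<Rightarrow> ('a \<Rightarrow> 'b::real_normed_vector) \<Rightarrow> bool" where
  "Ck_on 0 U f \<longleftrightarrow> continuous_on U f"
| "Ck_on (Suc n) U f \<longleftrightarrow> (\<forall>x\<in>U. f differentiable (at x)) \<and>
     (\<forall>v. Ck_on n U (\<lambda>x. frechet_derivative f (at x) v))"

definition smooth_on :: "'a::real_normed_vector set \<Rightarrow> ('a \<Rightarrow> 'b::real_normed_vector) \<Rightarrow> bool" where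
  "smooth_on U f \<longleftrightarrow> (\<forall>n. Ck_on n U f)"

definition smooth_germ :: "('a::real_normed_vector \<Rightarrow> 'b::real_normed_vector) \<Rightarrow> bool" where
  "smooth_germ f \<longleftrightarrow> (\<exists>U. open U \<and> 0 \<in> U \<and> smooth_on U f)"

text \<open>\<open>\<phi>\<close> is a diffeomorphism germ fixing the origin and \<open>\<phi>i\<close> represents its inverse germ.\<close>

definition diffeo_germ :: "('a::real_normed_vector \<Rightarrow> 'a) \<Rightarrow> ('a \<Rightarrow> 'a) \<Rightarrow> bool" where
  "diffeo_germ \<phi> \<phi>i \<longleftrightarrow> \<phi> 0 = 0 \<and>
     (\<exists>U V. open U \<and> 0 \<in> U \<and> open V \<and> homeomorphism U V \<phi> \<phi>i \<and> smooth_on U \<phi> \<and> smooth_on V \<phi>i)"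

definition A_equivalent :: "(real^2 \<Rightarrow> real^3) \<Rightarrow> (real^2 \<Rightarrow> real^3) \<Rightarrow> bool" where
  "A_equivalent f g \<longleftrightarrow> (\<exists>\<phi> \<phi>i \<Phi> \<Phi>i. diffeo_germ \<phi> \<phi>i \<and> diffeo_germ \<Phi> \<Phi>i \<and>
     (\<forall>\<^sub>F x in nhds 0. g x = \<Phi> (f (\<phi>i x))))"

definition K_equivalent :: "(real^2 \<Rightarrow> real) \<Rightarrow> (real^2 \<Rightarrow> real) \<Rightarrow> bool" where
  "K_equivalent f g \<longleftrightarrow> (\<exists>\<phi> \<phi>i l. diffeo_germ \<phi> \<phi>i \<and> smooth_germ l \<and> l 0 \<noteq> 0 \<and>
     (\<forall>\<^sub>F x in nhds 0. g x = l x * f (\<phi>i x)))"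

definition H_germ :: "nat \<Rightarrow> real^2 \<Rightarrow> real^3" where
  "H_germ k p = vector [p$1, p$1 * p$2 + (p$2) ^ (3 * k - 1), (p$2) ^ 3]"

definition A_singularity :: "nat \<Rightarrow> (real^2 \<Rightarrow> real) \<Rightarrow> bool" where
  "A_singularity k h \<longleftrightarrow>
     (\<exists>s\<in>{1, -1}. K_equivalent h (\<lambda>p. (p$1)\<^sup>2 + s * (p$2) ^ (k + 1)))"

definition height :: "(real^2 \<Rightarrow> real^3) \<Rightarrow> real^3 \<Rightarrow> real^2 \<Rightarrow> real" where
  "height f w p = f p \<bullet> w"


section \<open>Inflection points\<close>

definition partial_deriv :: "2 \<Rightarrow> (real^2 \<Rightarrow> 'b::real_normed_vector) \<Rightarrow> real^2 \<Rightarrow> 'b" where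
  "partial_deriv i f p = frechet_derivative f (at p) (axis i 1)"

text \<open>The degree 2 part of the Taylor polynomial at the origin. It is the whole 2-jet
  of \<open>g\<close> if \<open>g\<close> and its first derivative vanish there.\<close>

definition quadratic_jet :: "(real^2 \<Rightarrow> 'b::real_normed_vector) \<Rightarrow> real^2 \<Rightarrow> 'b" where
  "quadratic_jet g x = (1/2) *\<^sub>R
     (\<Sum>i\<in>UNIV. \<Sum>j\<in>UNIV. (x$i * x$j) *\<^sub>R partial_deriv i (partial_deriv j g) 0)"

text \<open>A pair of quadratic forms is regarded as a map from the plane to itself.\<close>

definition GL2_equivalent :: "(real^2 \<Rightarrow> real^2) \<Rightarrow> (real^2 \<Rightarrow> real^2) \<Rightarrow> bool" where
  "GL2_equivalent Q R \<longleftrightarrow> (\<exists>(A::real^2^2) (B::real^2^2). invertible A \<and> invertible B \<and>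
     (\<forall>x. R x = B *v Q (A *v x)))"

definition tangent_line :: "(real^2 \<Rightarrow> real^3) \<Rightarrow> (real^3) set" where
  "tangent_line f = range (frechet_derivative f (at 0))"

text \<open>For \<open>f 0 = 0\<close> of corank 1 at 0. The vectors \<open>e1, e2\<close> are an orthonormal basis of the
  normal plane; changing it is a linear change in the target of the pair of forms,
  hence the notion does not depend on this choice.\<close>

definition inflection_point :: "(real^2 \<Rightarrow> real^3) \<Rightarrow> bool" where
  "inflection_point f \<longleftrightarrow> (\<exists>e1 e2. norm e1 = 1 \<and> norm e2 = 1 \<and> e1 \<bullet> e2 = 0 \<and>
     span {e1, e2} = orthogonal_comp (tangent_line f) \<and>
     (\<exists>s\<in>{1, -1}. GL2_equivalent
        (quadratic_jet (\<lambda>x. vector [f x \<bullet> e1, f x \<bullet> e2] :: real^2))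
        (\<lambda>x. vector [(x$1)\<^sup>2 + s * (x$2)\<^sup>2, 0])))"


section \<open>The parabolic set and its branches\<close>

definition parabolic_fun :: "(real^2 \<Rightarrow> real^3) \<Rightarrow> real^2 \<Rightarrow> real" where
  "parabolic_fun f p =
     (let n = cross3 (partial_deriv 1 f p) (partial_deriv 2 f p)
      in (n \<bullet> partial_deriv 1 (partial_deriv 1 f) p) * (n \<bullet> partial_deriv 2 (partial_deriv 2 f) p)
         - (n \<bullet> partial_deriv 2 (partial_deriv 1 f) p)\<^sup>2)"

definition curve_deriv :: "nat \<Rightarrow> (real \<Rightarrow> 'a::real_normed_vector) \<Rightarrow> real \<Rightarrow> 'a" where
  "curve_deriv n c = ((\<lambda>g t. vector_derivative g (at t)) ^^ n) c"

definition regular_curve_germ :: "(real \<Rightarrow> real^2) \<Rightarrow> bool" where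
  "regular_curve_germ c \<longleftrightarrow> smooth_germ c \<and> c 0 = 0 \<and> curve_deriv 1 c 0 \<noteq> 0"

definition cusp_curve_germ :: "(real \<Rightarrow> real^2) \<Rightarrow> bool" where
  "cusp_curve_germ c \<longleftrightarrow> smooth_germ c \<and> c 0 = 0 \<and> curve_deriv 1 c 0 = 0 \<and>
     curve_deriv 2 c 0 \<noteq> curve_deriv 3 c 0 \<and>
     independent {curve_deriv 2 c 0, curve_deriv 3 c 0}"

text \<open>When \<open>parabolic_fun f\<close> has a \<open>D\<^sub>5\<close>-singularity at the origin, its zero set is locally the
  union of a regular curve and a (2,3)-cusp with different tangent lines at the origin.
  A regular curve germ contained in this set therefore parameterizes the regular branch,
  and a curve germ of (2,3)-cusp type contained in it parameterizes the singular branch, so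
  it suffices to require containment.\<close>

definition regular_parabolic_branch :: "(real^2 \<Rightarrow> real^3) \<Rightarrow> (real \<Rightarrow> real^3) \<Rightarrow> bool" where
  "regular_parabolic_branch f \<gamma> \<longleftrightarrow> (\<exists>\<alpha>. regular_curve_germ \<alpha> \<and>
     (\<forall>\<^sub>F t in nhds 0. parabolic_fun f (\<alpha> t) = 0) \<and> (\<forall>\<^sub>F t in nhds 0. \<gamma> t = f (\<alpha> t)))"

definition singular_parabolic_branch :: "(real^2 \<Rightarrow> real^3) \<Rightarrow> (real \<Rightarrow> real^3) \<Rightarrow> bool" where
  "singular_parabolic_branch f \<gamma> \<longleftrightarrow> (\<exists>\<alpha>. cusp_curve_germ \<alpha> \<and>
     (\<forall>\<^sub>F t in nhds 0. parabolic_fun f (\<alpha> t) = 0) \<and> (\<forall>\<^sub>F t in nhds 0. \<gamma> t = f (\<alpha> t)))"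

definition unit_binormal :: "(real \<Rightarrow> real^3) \<Rightarrow> real \<Rightarrow> real^3" where
  "unit_binormal c t = sgn (cross3 (curve_deriv 1 c t) (curve_deriv 2 c t))"

end

theory Submission
  imports Defs
begin

text \<open>
  By \<open>\<A>\<close>-equivalence, \<open>f = \<Psi> \<circ> H\<^sub>k \<circ> \<phi>\<close> near the origin for diffeomorphism germs \<open>\<phi>\<close> and \<open>\<Psi>\<close>.
  A change of the source multiplies the parabolic function by the fourth power of the Jacobian and
  preserves the type of a function germ. Everything can therefore be read off \<open>F = \<Psi> \<circ> H\<^sub>k\<close>, and in
  fact off the derivatives \<open>\<Psi>\<^sub>i\<close>, \<open>\<Psi>\<^sub>i\<^sub>j\<close> of \<open>\<Psi>\<close> at 0. Here \<open>(x, y)\<close> are the source coordinates of \<open>H\<^sub>k\<close>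
  and \<open>\<Delta> = det(\<Psi>\<^sub>1, \<Psi>\<^sub>2, \<Psi>\<^sub>3) \<noteq> 0\<close>.

  Modulo the tangent line, which is spanned by \<open>\<Psi>\<^sub>1\<close>, the quadratic part of \<open>F\<close> is
  \<open>x y \<Psi>\<^sub>2 + (x\<^sup>2/2) \<Psi>\<^sub>1\<^sub>1\<close>. If \<open>d = det(\<Psi>\<^sub>1, \<Psi>\<^sub>2, \<Psi>\<^sub>1\<^sub>1)\<close> were 0, this would be a single form
  \<open>x (y + c x)\<close> times a vector, and the singular point would be an inflection point. Hence
  \<open>d \<noteq> 0\<close> (lemma \<open>inflection_point_if_inflection_det_0\<close>).

  Let \<open>s\<close> be the derivative of \<open>x y + y^(3k-1)\<close> in \<open>y\<close>. The coefficients of the second fundamental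
  form have the leading terms \<open>d s\<close>, \<open>- 3 \<Delta> y\<^sup>2\<close> and \<open>6 \<Delta> y s\<close>. For the weights 3 of \<open>s\<close> and 2 of
  \<open>y\<close> the parabolic function has the principal part \<open>3 \<Delta> y (2 d s\<^sup>2 - 3 \<Delta> y\<^sup>3)\<close>, whose zero set
  consists of a regular curve tangent to the x-axis and a cusp with \<open>x ~ t\<^sup>3\<close>, \<open>y ~ t\<^sup>2\<close>. The orders of
  \<open>x\<close> and \<open>y\<close> along the branches are all that is used. They are obtained by showing that the
  parabolic function does not vanish along a curve with other orders, because one of the monomials
  \<open>y s\<^sup>2\<close> and \<open>y\<^sup>4\<close> then dominates (\<open>parabolic_fun_off_branches\<close>, \<open>parabolic_fun_tangent_to_axis\<close>).

  On the regular branch \<open>x ~ t\<close> and \<open>y = O(t\<^sup>2)\<close>, so the osculating plane of the image is spanned by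
  \<open>\<Psi>\<^sub>1\<close> and \<open>\<Psi>\<^sub>1\<^sub>1\<close>. A normal vector \<open>w\<close> of it is not orthogonal to \<open>\<Psi>\<^sub>2\<close>, and the height function
  begins with a multiple of \<open>x y\<close>: a Morse saddle. On the cusp \<open>H\<^sub>k\<close> has components of orders 3, 5
  and 6 in \<open>t\<close>, so velocity and acceleration of the image have a cross product asymptotic to a
  multiple of \<open>t\<^sup>5 \<Psi>\<^sub>1 \<times> \<Psi>\<^sub>2\<close>. The limiting binormal \<open>w\<close> is orthogonal to \<open>\<Psi>\<^sub>1\<close> and \<open>\<Psi>\<^sub>2\<close> but to neither
  \<open>\<Psi>\<^sub>1\<^sub>1\<close> (as \<open>d \<noteq> 0\<close>) nor \<open>\<Psi>\<^sub>3\<close>, so the height function is \<open>a x\<^sup>2 + b y\<^sup>3\<close> up to terms of higher weight: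
  an \<open>A\<^sub>2\<close>-singularity. Hadamard's lemma turns these leading terms into exact identities with smooth
  coefficients, completing the square gives the normal form, and the inverse function theorem makes
  the new coordinates a diffeomorphism germ.
\<close>

section \<open>Calculus of smooth maps\<close>

text \<open>Introduction rule for one more order of differentiability: a derivative may be supplied in any form
  instead of as the chosen value of \<open>frechet_derivative\<close>. The inner statement is the invariance of
  \<open>Ck_on\<close> under changes off the open set \<open>U\<close>, without which the two derivatives cannot be exchanged.\<close>

lemma Ck_on_SucI:
  assumes "\<And>x. x \<in> U \<Longrightarrow> (f has_derivative f' x) (at x)"
    and "\<And>v. Ck_on n U (\<lambda>x. f' x v)" and "open U"
  shows "Ck_on (Suc n) U f"
proof -
  have eq: "frechet_derivative f (at x) = f' x" if "x \<in> U" for x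
    using frechet_derivative_at[OF assms(1)[OF that]] by simp
  have cong: "Ck_on n U g \<Longrightarrow> (\<And>x. x \<in> U \<Longrightarrow> g x = h x) \<Longrightarrow> Ck_on n U h" for n and g h :: "'a \<Rightarrow> 'b"
  proof (induction n arbitrary: g h)
    case 0 then show ?case by (simp cong: continuous_on_cong)
  next
    case (Suc n)
    have d: "g differentiable (at x)" if "x \<in> U" for x using Suc.prems(1) that by simp
    have "h differentiable (at x)" if "x \<in> U" for x
      using d[OF that] \<open>open U\<close> that Suc.prems(2)
      by (meson differentiable_def has_derivative_transform_within_open)
    moreover have "Ck_on n U (\<lambda>x. frechet_derivative h (at x) v)" for v
    proof (rule Suc.IH)
      show "Ck_on n U (\<lambda>x. frechet_derivative g (at x) v)" using Suc.prems(1) by simp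
      show "frechet_derivative g (at x) v = frechet_derivative h (at x) v" if "x \<in> U" for x
        using frechet_derivative_transform_within_open[OF d[OF that] \<open>open U\<close> that Suc.prems(2)] by simp
    qed
    ultimately show ?case by simp
  qed
  have "f differentiable (at x)" if "x \<in> U" for x using assms(1)[OF that] by (auto simp: differentiable_def)
  moreover have "Ck_on n U (\<lambda>x. frechet_derivative f (at x) v)" for v
    by (rule cong[OF assms(2)[of v]]) (simp add: eq)
  ultimately show ?thesis by simp
qed

lemma Ck_on_SucD:
  assumes "Ck_on (Suc n) U f" "x \<in> U"
  shows "(f has_derivative frechet_derivative f (at x)) (at x)"
  using assms frechet_derivative_works by auto

lemma Ck_on_cong:
  assumes "Ck_on n U f" "open U" "\<And>x. x \<in> U \<Longrightarrow> f x = g x"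
  shows "Ck_on n U g"
proof (cases n)
  case 0 with assms show ?thesis by (simp cong: continuous_on_cong)
next
  case (Suc m)
  show ?thesis unfolding Suc
  proof (rule Ck_on_SucI)
    show "(g has_derivative frechet_derivative f (at x)) (at x)" if "x \<in> U" for x
      using Ck_on_SucD assms Suc that by (metis has_derivative_transform_within_open)
    show "Ck_on m U (\<lambda>x. frechet_derivative f (at x) v)" for v using assms Suc by simp
  qed fact
qed

lemma Ck_on_subset: "Ck_on n U f \<Longrightarrow> V \<subseteq> U \<Longrightarrow> Ck_on n V f"
  by (induction n arbitrary: f) (auto intro: continuous_on_subset)

lemma Ck_on_Suc_imp: "Ck_on (Suc n) U f \<Longrightarrow> Ck_on n U f"
proof (induction n arbitrary: f)
  case 0
  then show ?case
    by (auto intro!: continuous_at_imp_continuous_on differentiable_imp_continuous_within)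
qed auto

lemma Ck_on_const: "open U \<Longrightarrow> Ck_on n U (\<lambda>x. c)"
proof (induction n arbitrary: c)
  case (Suc n)
  show ?case by (rule Ck_on_SucI[where f' = "\<lambda>x v. 0"]) (auto intro: Suc)
qed simp

lemma Ck_on_ident: "open U \<Longrightarrow> Ck_on n U (\<lambda>x. x)"
  by (cases n) (auto intro!: Ck_on_SucI[where f' = "\<lambda>x v. v"] Ck_on_const)

lemma Ck_on_bounded_linear:
  "Ck_on n U f \<Longrightarrow> bounded_linear L \<Longrightarrow> open U \<Longrightarrow> Ck_on n U (\<lambda>x. L (f x))"
proof (induction n arbitrary: f)
  case 0
  then show ?case by (simp add: bounded_linear.continuous_on)
next
  case (Suc n)
  show ?case
  proof (rule Ck_on_SucI)
    show "((\<lambda>x. L (f x)) has_derivative (\<lambda>v. L (frechet_derivative f (at x) v))) (at x)"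
      if "x \<in> U" for x
      using Ck_on_SucD[OF Suc.prems(1) that] Suc.prems(2)
      by (rule bounded_linear.has_derivative[rotated])
    show "Ck_on n U (\<lambda>x. L (frechet_derivative f (at x) v))" for v
      using Suc by simp
  qed fact
qed

lemma Ck_on_add: "Ck_on n U f \<Longrightarrow> Ck_on n U g \<Longrightarrow> open U \<Longrightarrow> Ck_on n U (\<lambda>x. f x + g x)"
proof (induction n arbitrary: f g)
  case 0
  then show ?case by (simp add: continuous_on_add)
next
  case (Suc n)
  show ?case
    by (rule Ck_on_SucI[OF has_derivative_add[OF Ck_on_SucD[OF Suc.prems(1)] Ck_on_SucD[OF Suc.prems(2)]]])
      (use Suc in auto)
qed

lemma Ck_on_sum:
  "(\<And>i. i \<in> I \<Longrightarrow> Ck_on n U (f i)) \<Longrightarrow> open U \<Longrightarrow> Ck_on n U (\<lambda>x. \<Sum>i\<in>I. f i x)"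
  by (induction I rule: infinite_finite_induct) (auto intro: Ck_on_const Ck_on_add)

lemma Ck_on_bilinear:
  assumes "bounded_bilinear B" "open U"
  shows "Ck_on n U f \<Longrightarrow> Ck_on n U g \<Longrightarrow> Ck_on n U (\<lambda>x. B (f x) (g x))"
proof (induction n arbitrary: f g)
  case 0
  then show ?case using assms bounded_bilinear.continuous_on by auto
next
  case (Suc n)
  show ?case
    by (rule Ck_on_SucI[OF bounded_bilinear.FDERIV[OF assms(1) Ck_on_SucD[OF Suc.prems(1)] Ck_on_SucD[OF Suc.prems(2)]]])
      (use Suc assms in \<open>auto intro!: Ck_on_add Suc.IH Ck_on_Suc_imp[OF Suc.prems(1)] Ck_on_Suc_imp[OF Suc.prems(2)]\<close>)
qed

lemmas Ck_on_scaleR = Ck_on_bilinear[OF bounded_bilinear_scaleR]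
lemmas Ck_on_mult = Ck_on_bilinear[OF bounded_bilinear_mult]

text \<open>The domain of \<open>g\<close> is Euclidean because the derivative of the composition is expanded in a basis:
  only then is it built from maps \<open>x \<mapsto> Dg(f x) b\<close> with a fixed direction \<open>b\<close>, to which the induction
  hypothesis applies.\<close>

lemma Ck_on_compose:
  fixes g :: "'b::euclidean_space \<Rightarrow> 'c::real_normed_vector"
  assumes "open U" "open V"
  shows "Ck_on n V g \<Longrightarrow> Ck_on n U f \<Longrightarrow> f ` U \<subseteq> V \<Longrightarrow> Ck_on n U (\<lambda>x. g (f x))"
proof (induction n arbitrary: g)
  case 0
  then show ?case by (auto intro: continuous_on_compose2)
next
  case (Suc n)
  show ?case
  proof (rule Ck_on_SucI)
    fix x assume x: "x \<in> U"
    then have "f x \<in> V" using Suc.prems by auto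
    from has_derivative_compose[OF Ck_on_SucD[OF Suc.prems(2) x] Ck_on_SucD[OF Suc.prems(1) this]]
    have *: "((\<lambda>x. g (f x)) has_derivative
      (\<lambda>v. frechet_derivative g (at (f x)) (frechet_derivative f (at x) v))) (at x)" .
    have lin: "linear (frechet_derivative g (at (f x)))"
      using Suc.prems(1) \<open>f x \<in> V\<close> linear_frechet_derivative by auto
    have "frechet_derivative g (at (f x)) w = (\<Sum>b\<in>Basis. (w \<bullet> b) *\<^sub>R frechet_derivative g (at (f x)) b)" for w
      using linear_sum[OF lin, of "\<lambda>b. (w \<bullet> b) *\<^sub>R b" Basis] lin
      by (simp add: euclidean_representation linear_scale)
    then have eq: "frechet_derivative g (at (f x)) =
        (\<lambda>w. \<Sum>b\<in>Basis. (w \<bullet> b) *\<^sub>R frechet_derivative g (at (f x)) b)" by blast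
    show "((\<lambda>x. g (f x)) has_derivative
      (\<lambda>v. \<Sum>b\<in>Basis. (frechet_derivative f (at x) v \<bullet> b) *\<^sub>R frechet_derivative g (at (f x)) b)) (at x)"
      by (rule has_derivative_eq_rhs[OF *], subst eq) (rule refl)
  next
    fix v
    show "Ck_on n U (\<lambda>x. \<Sum>b\<in>Basis. (frechet_derivative f (at x) v \<bullet> b) *\<^sub>R frechet_derivative g (at (f x)) b)"
    proof (intro Ck_on_sum Ck_on_scaleR assms(1))
      fix b :: 'b
      show "Ck_on n U (\<lambda>x. frechet_derivative f (at x) v \<bullet> b)"
        using Suc.prems(2) assms(1) by (intro Ck_on_bounded_linear[OF _ bounded_linear_inner_left]) simp_all
      show "Ck_on n U (\<lambda>x. frechet_derivative g (at (f x)) b)"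
        using Suc.prems(1,3) Ck_on_Suc_imp[OF Suc.prems(2)]
        by (intro Suc.IH[of "\<lambda>y. frechet_derivative g (at y) b"]) simp_all
    qed
  qed fact
qed

lemma Ck_on_inverse:
  fixes g :: "'a::real_normed_vector \<Rightarrow> real"
  assumes "open U" "\<And>x. x \<in> U \<Longrightarrow> g x \<noteq> 0"
  shows "Ck_on n U g \<Longrightarrow> Ck_on n U (\<lambda>x. inverse (g x))"
proof (induction n)
  case 0
  then show ?case using assms by (auto intro!: continuous_on_inverse)
next
  case (Suc n)
  have i: "Ck_on n U (\<lambda>x. inverse (g x))" using Suc Ck_on_Suc_imp by blast
  have n: "Ck_on n U (\<lambda>x. - frechet_derivative g (at x) v)" for v
    using Ck_on_bounded_linear[OF _ bounded_linear_minus[OF bounded_linear_ident],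
        of n U "\<lambda>x. frechet_derivative g (at x) v"] assms(1) Suc.prems by simp
  show ?case
  proof (rule Ck_on_SucI)
    show "((\<lambda>x. inverse (g x)) has_derivative
      (\<lambda>v. (- frechet_derivative g (at x) v) * (inverse (g x) * inverse (g x)))) (at x)" if "x \<in> U" for x
      by (rule has_derivative_eq_rhs[OF Deriv.has_derivative_inverse[OF assms(2)[OF that] Ck_on_SucD[OF Suc.prems that]]])
        (simp add: fun_eq_iff)
    show "Ck_on n U (\<lambda>x. (- frechet_derivative g (at x) v) * (inverse (g x) * inverse (g x)))" for v
      by (intro Ck_on_mult assms i n)
  qed fact
qed

lemma Ck_on_sqrt:
  fixes g :: "'a::real_normed_vector \<Rightarrow> real"
  assumes "open U" "\<And>x. x \<in> U \<Longrightarrow> g x > 0"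
  shows "Ck_on n U g \<Longrightarrow> Ck_on n U (\<lambda>x. sqrt (g x))"
proof (induction n)
  case 0
  then show ?case by (auto intro!: continuous_on_real_sqrt)
next
  case (Suc n)
  have nz: "sqrt (g x) \<noteq> 0" if "x \<in> U" for x using assms(2)[OF that] by simp
  have "Ck_on n U (\<lambda>x. sqrt (g x))" using Suc Ck_on_Suc_imp by blast
  then have i: "Ck_on n U (\<lambda>x. inverse (sqrt (g x)))" using Ck_on_inverse[OF assms(1), of "\<lambda>x. sqrt (g x)"] nz by blast
  show ?case
  proof (rule Ck_on_SucI)
    fix x assume x: "x \<in> U"
    have "(sqrt has_derivative (\<lambda>h. h * (inverse (sqrt (g x)) / 2))) (at (g x))"
      by (rule has_derivative_eq_rhs[OF DERIV_real_sqrt[OF assms(2)[OF x], THEN has_field_derivative_imp_has_derivative]])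
        (simp add: fun_eq_iff)
    from has_derivative_compose[OF Ck_on_SucD[OF Suc.prems x] this]
    show "((\<lambda>x. sqrt (g x)) has_derivative
      (\<lambda>v. (frechet_derivative g (at x) v * inverse (sqrt (g x))) * (1/2))) (at x)" by simp
  next
    show "Ck_on n U (\<lambda>x. (frechet_derivative g (at x) v * inverse (sqrt (g x))) * (1/2))" for v
      using Suc.prems by (intro Ck_on_mult assms i Ck_on_const) auto
  qed fact
qed

subsection \<open>Smooth germs\<close>

lemma smooth_germE:
  assumes "smooth_germ f"
  obtains r where "r > 0" "smooth_on (ball 0 r) f"
proof -
  from assms obtain U where U: "open U" "0 \<in> U" "smooth_on U f" by (auto simp: smooth_germ_def)
  then obtain r where "r > 0" "ball 0 r \<subseteq> U" using openE by blast
  moreover have "smooth_on (ball 0 r) f"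
    using U \<open>ball 0 r \<subseteq> U\<close> Ck_on_subset unfolding smooth_on_def by blast
  ultimately show ?thesis using that by blast
qed

lemma smooth_germI: "open U \<Longrightarrow> 0 \<in> U \<Longrightarrow> (\<And>n. Ck_on n U f) \<Longrightarrow> smooth_germ f"
  by (auto simp: smooth_germ_def smooth_on_def)

text \<open>Smoothness and a property that holds near the origin can be had on a common neighbourhood. This is
  how the rules below pass from germs to maps on open sets.\<close>

lemma smooth_germ_nhdE:
  assumes "smooth_germ f" "\<forall>\<^sub>F x in nhds 0. P x"
  obtains U where "open U" "0 \<in> U" "smooth_on U f" "\<And>x. x \<in> U \<Longrightarrow> P x"
proof -
  from assms(1) obtain U where U: "open U" "0 \<in> U" "smooth_on U f" by (auto simp: smooth_germ_def)
  from assms(2) obtain V where V: "open V" "0 \<in> V" "\<And>x. x \<in> V \<Longrightarrow> P x" 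
    by (auto simp: eventually_nhds)
  show ?thesis
    by (rule that[of "U \<inter> V"]) (use U V in \<open>auto simp: smooth_on_def intro: Ck_on_subset\<close>)
qed

lemma smooth_germ_cong:
  assumes "smooth_germ f" "\<forall>\<^sub>F x in nhds 0. f x = g x"
  shows "smooth_germ g"
proof (rule smooth_germ_nhdE[OF assms])
  fix U assume "open U" "0 \<in> U" "smooth_on U f" "\<And>x. x \<in> U \<Longrightarrow> f x = g x"
  then show ?thesis by (auto simp: smooth_on_def intro!: smooth_germI[of U] intro: Ck_on_cong)
qed

lemma smooth_germ_eventually_differentiable:
  assumes "smooth_germ f"
  shows "\<forall>\<^sub>F x in nhds 0. f differentiable (at x)"
proof -
  from assms obtain U where U: "open U" "0 \<in> U" "\<And>n. Ck_on n U f" unfolding smooth_germ_def smooth_on_def by blast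
  from U(1,2) U(3)[of "Suc 0"] show ?thesis by (auto simp: eventually_nhds)
qed

lemma smooth_germ_differentiable: "smooth_germ f \<Longrightarrow> f differentiable (at 0)"
  using smooth_germ_eventually_differentiable eventually_nhds_x_imp_x by blast

lemma smooth_germ_isCont: "smooth_germ f \<Longrightarrow> isCont f 0"
  using smooth_germ_differentiable differentiable_imp_continuous_within by blast

lemma smooth_germ_frechet:
  "smooth_germ f \<Longrightarrow> smooth_germ (\<lambda>x. frechet_derivative f (at x) v)"
  unfolding smooth_germ_def smooth_on_def by (metis Ck_on.simps(2))

lemma smooth_germ_binop:
  assumes "smooth_germ f" "smooth_germ g"
    and "\<And>n U. open U \<Longrightarrow> Ck_on n U f \<Longrightarrow> Ck_on n U g \<Longrightarrow> Ck_on n U h"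
  shows "smooth_germ h"
proof -
  from assms(1) obtain U where U: "open U" "0 \<in> U" "smooth_on U f" by (auto simp: smooth_germ_def)
  from assms(2) obtain V where V: "open V" "0 \<in> V" "smooth_on V g" by (auto simp: smooth_germ_def)
  show ?thesis
    by (rule smooth_germI[of "U \<inter> V"])
      (use U V in \<open>auto simp: smooth_on_def intro!: assms(3) intro: Ck_on_subset\<close>)
qed

lemma smooth_germ_const [simp]: "smooth_germ (\<lambda>x. c)"
  by (rule smooth_germI[of UNIV]) (auto intro: Ck_on_const)

lemma smooth_germ_ident [simp]: "smooth_germ (\<lambda>x. x)"
  by (rule smooth_germI[of UNIV]) (auto intro: Ck_on_ident)

lemma smooth_germ_bounded_linear: "smooth_germ f \<Longrightarrow> bounded_linear L \<Longrightarrow> smooth_germ (\<lambda>x. L (f x))"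
  by (rule smooth_germ_binop[where f = f and g = f]) (auto intro: Ck_on_bounded_linear)

lemma smooth_germ_add: "smooth_germ f \<Longrightarrow> smooth_germ g \<Longrightarrow> smooth_germ (\<lambda>x. f x + g x)"
  by (erule (1) smooth_germ_binop) (rule Ck_on_add)

lemma smooth_germ_scaleR: "smooth_germ f \<Longrightarrow> smooth_germ g \<Longrightarrow> smooth_germ (\<lambda>x. f x *\<^sub>R g x)"
  by (erule (1) smooth_germ_binop) (rule Ck_on_scaleR)

lemma smooth_germ_mult:
  fixes f g :: "'a::real_normed_vector \<Rightarrow> real"
  shows "smooth_germ f \<Longrightarrow> smooth_germ g \<Longrightarrow> smooth_germ (\<lambda>x. f x * g x)"
  by (erule (1) smooth_germ_binop) (rule Ck_on_mult)

lemma smooth_germ_minus: "smooth_germ f \<Longrightarrow> smooth_germ (\<lambda>x. - f x)"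
  using smooth_germ_bounded_linear bounded_linear_minus[OF bounded_linear_ident] by blast

lemma smooth_germ_diff: "smooth_germ f \<Longrightarrow> smooth_germ g \<Longrightarrow> smooth_germ (\<lambda>x. f x - g x)"
  using smooth_germ_add[OF _ smooth_germ_minus, of f g] by simp

lemma smooth_germ_power:
  fixes f :: "'a::real_normed_vector \<Rightarrow> real"
  shows "smooth_germ f \<Longrightarrow> smooth_germ (\<lambda>x. f x ^ n)"
  by (induction n) (auto intro: smooth_germ_mult)

lemma smooth_germ_nth: "smooth_germ f \<Longrightarrow> smooth_germ (\<lambda>x. f x $ i)"
  using smooth_germ_bounded_linear bounded_linear_vec_nth by blast

lemma smooth_germ_inner: "smooth_germ f \<Longrightarrow> smooth_germ (\<lambda>x. f x \<bullet> w)"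
  using smooth_germ_bounded_linear bounded_linear_inner_left by blast

lemma smooth_germ_eventually_pos:
  fixes f :: "'a::real_normed_vector \<Rightarrow> real"
  assumes "smooth_germ f" "f 0 > 0"
  shows "\<forall>\<^sub>F x in nhds 0. f x > 0"
  using smooth_germ_isCont[OF assms(1)] assms(2)
  by (simp add: isCont_def tendsto_at_iff_tendsto_nhds order_tendstoD)

lemma smooth_germ_eventually_nonzero:
  fixes f :: "'a::real_normed_vector \<Rightarrow> 'b::real_normed_vector"
  assumes "smooth_germ f" "f 0 \<noteq> 0"
  shows "\<forall>\<^sub>F x in nhds 0. f x \<noteq> 0"
  using smooth_germ_isCont[OF assms(1)] assms(2)
  by (simp add: isCont_def tendsto_at_iff_tendsto_nhds tendsto_imp_eventually_ne)

lemma smooth_germ_inverse: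
  fixes f :: "'a::real_normed_vector \<Rightarrow> real"
  assumes "smooth_germ f" "f 0 \<noteq> 0"
  shows "smooth_germ (\<lambda>x. inverse (f x))"
proof (rule smooth_germ_nhdE[OF assms(1) smooth_germ_eventually_nonzero[OF assms]])
  fix U assume "open U" "0 \<in> U" "smooth_on U f" "\<And>x. x \<in> U \<Longrightarrow> f x \<noteq> 0"
  then show ?thesis by (auto simp: smooth_on_def intro!: smooth_germI[of U] intro: Ck_on_inverse)
qed

lemma smooth_germ_divide:
  fixes f g :: "'a::real_normed_vector \<Rightarrow> real"
  assumes "smooth_germ f" "smooth_germ g" "g 0 \<noteq> 0"
  shows "smooth_germ (\<lambda>x. f x / g x)"
  using smooth_germ_mult[OF assms(1) smooth_germ_inverse[OF assms(2,3)]] by (simp add: divide_inverse)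

lemma smooth_germ_sqrt:
  fixes f :: "'a::real_normed_vector \<Rightarrow> real"
  assumes "smooth_germ f" "f 0 > 0"
  shows "smooth_germ (\<lambda>x. sqrt (f x))"
proof (rule smooth_germ_nhdE[OF assms(1) smooth_germ_eventually_pos[OF assms]])
  fix U assume "open U" "0 \<in> U" "smooth_on U f" "\<And>x. x \<in> U \<Longrightarrow> f x > 0"
  then show ?thesis by (auto simp: smooth_on_def intro!: smooth_germI[of U] intro: Ck_on_sqrt)
qed

lemma eventually_nhds_0_compose:
  assumes "smooth_germ f" "f 0 = 0" "\<forall>\<^sub>F y in nhds 0. P y"
  shows "\<forall>\<^sub>F x in nhds 0. P (f x)"
proof -
  have "filterlim f (nhds 0) (nhds 0)"
    using smooth_germ_isCont[OF assms(1)] assms(2)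
    unfolding isCont_def tendsto_at_iff_tendsto_nhds by simp
  then show ?thesis using assms(3) by (auto simp: filterlim_iff)
qed

lemma smooth_germ_compose:
  fixes g :: "'b::euclidean_space \<Rightarrow> 'c::real_normed_vector"
  assumes "smooth_germ g" "smooth_germ f" "f 0 = 0"
  shows "smooth_germ (\<lambda>x. g (f x))"
proof -
  from assms(1) obtain V where V: "open V" "0 \<in> V" "smooth_on V g" by (auto simp: smooth_germ_def)
  then have "\<forall>\<^sub>F y in nhds 0. y \<in> V" by (auto simp: eventually_nhds)
  from eventually_nhds_0_compose[OF assms(2,3) this] 
  show ?thesis
  proof (rule smooth_germ_nhdE[OF assms(2)])
    fix U assume "open U" "0 \<in> U" "smooth_on U f" "\<And>x. x \<in> U \<Longrightarrow> f x \<in> V"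
    then have "Ck_on n U (\<lambda>x. g (f x))" for n
      using Ck_on_compose[of U V n g f] V by (simp add: smooth_on_def image_subset_iff)
    with \<open>open U\<close> \<open>0 \<in> U\<close> show ?thesis by (rule smooth_germI)
  qed
qed

lemma vector_2_eq: "(vector [a, b] :: real^2) = a *\<^sub>R axis 1 1 + b *\<^sub>R axis 2 1"
  by (simp add: vec_eq_iff forall_2 axis_def)

lemma vector_3_eq: "(vector [a, b, c] :: real^3) = a *\<^sub>R axis 1 1 + b *\<^sub>R axis 2 1 + c *\<^sub>R axis 3 1"
  by (simp add: vec_eq_iff forall_3 axis_def)

lemma smooth_germ_vector_2:
  "smooth_germ a \<Longrightarrow> smooth_germ b \<Longrightarrow> smooth_germ (\<lambda>x. vector [a x, b x] :: real^2)"
  unfolding vector_2_eq by (intro smooth_germ_add smooth_germ_scaleR) auto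

lemma smooth_germ_vector_3:
  "smooth_germ a \<Longrightarrow> smooth_germ b \<Longrightarrow> smooth_germ c \<Longrightarrow> smooth_germ (\<lambda>x. vector [a x, b x, c x] :: real^3)"
  unfolding vector_3_eq by (intro smooth_germ_add smooth_germ_scaleR) auto

lemmas smooth_germ_intros = smooth_germ_const smooth_germ_ident smooth_germ_add smooth_germ_diff
  smooth_germ_minus smooth_germ_mult smooth_germ_scaleR smooth_germ_power smooth_germ_nth
  smooth_germ_inner smooth_germ_vector_2 smooth_germ_vector_3 smooth_germ_frechet

subsection \<open>Directional derivatives of germs\<close>

text \<open>The same operator serves as partial derivative (for \<open>axis i 1\<close>) and, on the line, as derivative of
  curves (for 1). With the direction as first argument, iterated derivatives are iterated functions.\<close>

definition dir_deriv :: "'a::real_normed_vector \<Rightarrow> ('a \<Rightarrow> 'b::real_normed_vector) \<Rightarrow> 'a \<Rightarrow> 'b" where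
  "dir_deriv v f x = frechet_derivative f (at x) v"

lemma dir_deriv_eqI: "(f has_derivative f') (at x) \<Longrightarrow> dir_deriv v f x = f' v"
  unfolding dir_deriv_def using frechet_derivative_at by metis

lemma smooth_germ_dir_deriv: "smooth_germ f \<Longrightarrow> smooth_germ (dir_deriv v f)"
  unfolding dir_deriv_def by (rule smooth_germ_frechet)

lemma differentiable_has_dir_deriv:
  "f differentiable (at x) \<Longrightarrow> (f has_derivative (\<lambda>v. dir_deriv v f x)) (at x)"
  unfolding dir_deriv_def using frechet_derivative_works by blast

lemma smooth_germ_has_dir_deriv:
  "smooth_germ f \<Longrightarrow> \<forall>\<^sub>F x in nhds 0. (f has_derivative (\<lambda>v. dir_deriv v f x)) (at x)"
  by (rule eventually_mono[OF smooth_germ_eventually_differentiable differentiable_has_dir_deriv])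

lemma smooth_germ_has_dir_deriv_0:
  "smooth_germ f \<Longrightarrow> (f has_derivative (\<lambda>v. dir_deriv v f 0)) (at 0)"
  by (rule differentiable_has_dir_deriv[OF smooth_germ_differentiable])

lemma linear_dir_deriv: "f differentiable (at x) \<Longrightarrow> linear (\<lambda>v. dir_deriv v f x)"
  unfolding dir_deriv_def using linear_frechet_derivative[of f "at x"] by simp

lemma dir_deriv_cong:
  assumes "\<forall>\<^sub>F y in nhds x. f y = g y"
  shows "dir_deriv v f x = dir_deriv v g x"
proof -
  have "(f has_derivative D) (at x) \<longleftrightarrow> (g has_derivative D) (at x)" for D
    using has_derivative_transform_eventually[of f D x UNIV g] has_derivative_transform_eventually[of g D x UNIV f]
      eventually_nhds_x_imp_x[OF assms] eventually_at_filter[of "\<lambda>y. f y = g y" x UNIV]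
      eventually_mono[OF assms, of "\<lambda>y. y \<noteq> x \<longrightarrow> y \<in> UNIV \<longrightarrow> f y = g y"]
    by (auto simp: eq_commute[of "g _"])
  then show ?thesis by (simp add: dir_deriv_def frechet_derivative_def)
qed

lemma eventually_dir_deriv_cong:
  assumes "\<forall>\<^sub>F x in nhds a. f x = g x"
  shows "\<forall>\<^sub>F x in nhds a. dir_deriv v f x = dir_deriv v g x"
proof -
  have "\<forall>\<^sub>F x in nhds a. \<forall>\<^sub>F y in nhds x. f y = g y"
    using assms by (simp add: eventually_eventually)
  then show ?thesis by (rule eventually_mono) (rule dir_deriv_cong)
qed

lemma dir_deriv_expand:
  fixes f :: "'a::euclidean_space \<Rightarrow> 'b::real_normed_vector"
  assumes "f differentiable (at x)"
  shows "dir_deriv v f x = (\<Sum>b\<in>Basis. (v \<bullet> b) *\<^sub>R dir_deriv b f x)"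
  using linear_sum[OF linear_dir_deriv[OF assms], of "\<lambda>b. (v \<bullet> b) *\<^sub>R b" Basis]
  by (simp add: euclidean_representation linear_scale[OF linear_dir_deriv[OF assms]])

subsection \<open>Hadamard's lemma and the symmetry of second derivatives\<close>

text \<open>The coefficients in Hadamard's lemma are integrals of this kind. Differentiation under the integral
  sign raises the power of \<open>t\<close> by one, so the exponent has to be arbitrary for the induction on the
  order of differentiability.\<close>

lemma Ck_on_ray_integral:
  fixes F :: "'a::euclidean_space \<Rightarrow> 'b::euclidean_space"
  assumes "Ck_on n (ball 0 r) F"
  shows "Ck_on n (ball 0 r) (\<lambda>x. integral (cbox 0 1) (\<lambda>t::real. t ^ j *\<^sub>R F (t *\<^sub>R x)))"
  using assms
proof (induction n arbitrary: F j)
  have ray: "(\<lambda>(x, t). t *\<^sub>R x) ` (ball 0 r \<times> cbox 0 1) \<subseteq> ball (0::'a) r" for r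
  proof clarify
    fix x :: 'a and t :: real assume "x \<in> ball 0 r" "t \<in> cbox 0 1"
    then show "t *\<^sub>R x \<in> ball 0 r" using mult_left_le_one_le[of "norm x" t] by simp
  qed
  have cont: "continuous_on (ball 0 r \<times> cbox 0 1) (\<lambda>(x, t). t ^ j *\<^sub>R F (t *\<^sub>R x))"
    if "continuous_on (ball 0 r) F" for F :: "'a \<Rightarrow> 'b" and j r
  proof -
    have "continuous_on (ball 0 r \<times> cbox 0 1) (\<lambda>z::'a \<times> real. F (snd z *\<^sub>R fst z))"
      by (rule continuous_on_compose2[OF that]) (use ray in \<open>auto intro!: continuous_intros simp: case_prod_beta\<close>)
    then show ?thesis by (auto intro!: continuous_intros simp: case_prod_beta)
  qed
  {
    case 0
    then show ?case using integral_continuous_on_param[OF cont[of r F j]] by simp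
  next
    case (Suc n)
    let ?D = "\<lambda>x. frechet_derivative F (at x)"
    define fx where "fx = (\<lambda>x t. t ^ Suc j *\<^sub>R Blinfun (?D (t *\<^sub>R x)))"
    have mem: "t *\<^sub>R x \<in> ball 0 r" if "x \<in> ball 0 r" "t \<in> cbox 0 1" for x :: 'a and t
      using subsetD[OF ray[of r], of "t *\<^sub>R x"] that by force
    have D: "(F has_derivative ?D x) (at x)" if "x \<in> ball 0 r" for x
      using Ck_on_SucD[OF Suc.prems that] .
    have fx_apply: "blinfun_apply (fx x t) v = t ^ Suc j *\<^sub>R ?D (t *\<^sub>R x) v"
      if "x \<in> ball 0 r" "t \<in> cbox 0 1" for x t v
      using has_derivative_bounded_linear[OF D[OF mem[OF that]]]
      by (simp add: fx_def scaleR_blinfun.rep_eq bounded_linear_Blinfun_apply)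
    have contD: "continuous_on (ball 0 r) (\<lambda>x. ?D x v)" for v
    proof -
      have "Ck_on n (ball 0 r) (\<lambda>x. ?D x v)" using Suc.prems by simp
      then have "Ck_on 0 (ball 0 r) (\<lambda>x. ?D x v)" by (induction n) (auto dest: Ck_on_Suc_imp simp del: Ck_on.simps)
      then show ?thesis by simp
    qed
    have contF: "continuous_on (ball 0 r) F"
      using D by (meson continuous_at_imp_continuous_on has_derivative_continuous)
    have cont_fx: "continuous_on (ball 0 r \<times> cbox 0 1) (\<lambda>(x, t). fx x t)"
    proof (rule continuous_on_blinfun_componentwise)
      fix i :: 'a
      show "continuous_on (ball 0 r \<times> cbox 0 1) (\<lambda>z. blinfun_apply (case z of (x, t) \<Rightarrow> fx x t) i)"
        by (rule continuous_on_eq[OF cont[OF contD[of i], of "Suc j"]]) (auto simp: fx_apply)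
    qed
    have der: "((\<lambda>x. integral (cbox 0 1) (\<lambda>t. t ^ j *\<^sub>R F (t *\<^sub>R x))) has_derivative
        blinfun_apply (integral (cbox 0 1) (fx x))) (at x within ball 0 r)" if x: "x \<in> ball 0 r" for x
    proof (rule leibniz_rule[where fx = fx])
      fix y t assume y: "y \<in> ball (0::'a) r" and t: "t \<in> cbox 0 (1::real)"
      have "((\<lambda>x. t *\<^sub>R x) has_derivative (\<lambda>v. t *\<^sub>R v)) (at y)"
        by (auto intro!: derivative_eq_intros)
      from has_derivative_compose[OF this D[OF mem[OF y t]]]
      have "((\<lambda>x. t ^ j *\<^sub>R F (t *\<^sub>R x)) has_derivative (\<lambda>v. t ^ j *\<^sub>R ?D (t *\<^sub>R y) (t *\<^sub>R v))) (at y)"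
        by (rule has_derivative_scaleR_right)
      also have "(\<lambda>v. t ^ j *\<^sub>R ?D (t *\<^sub>R y) (t *\<^sub>R v)) = blinfun_apply (fx y t)"
        using linear_scale[OF has_derivative_linear[OF D[OF mem[OF y t]]]]
        by (auto simp: fx_apply[OF y t] mult.commute)
      finally show "((\<lambda>x. t ^ j *\<^sub>R F (t *\<^sub>R x)) has_derivative blinfun_apply (fx y t)) (at y within ball 0 r)"
        by (rule has_derivative_at_withinI)
    next
      fix y assume y: "y \<in> ball (0::'a) r"
      have "continuous_on (cbox 0 1) (\<lambda>t. F (t *\<^sub>R y))"
        by (rule continuous_on_compose2[OF contF]) (use mem[OF y] in \<open>auto intro!: continuous_intros\<close>)
      then show "(\<lambda>t. t ^ j *\<^sub>R F (t *\<^sub>R y)) integrable_on cbox 0 1"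
        by (intro integrable_continuous continuous_intros)
    qed (use x cont_fx in auto)
    have ifx: "fx x integrable_on cbox 0 1" if "x \<in> ball 0 r" for x
    proof (rule integrable_continuous)
      show "continuous_on (cbox 0 1) (fx x)"
        using continuous_on_compose2[OF cont_fx
            continuous_on_Pair[OF continuous_on_const[of "cbox 0 1" x] continuous_on_id]] that
        by (simp add: image_subset_iff)
    qed
    have eq: "blinfun_apply (integral (cbox 0 1) (fx x)) v =
        integral (cbox 0 1) (\<lambda>t. t ^ Suc j *\<^sub>R ?D (t *\<^sub>R x) v)" if "x \<in> ball 0 r" for x v
      unfolding blinfun_apply_integral[OF ifx[OF that]]
      by (rule integral_cong) (use fx_apply[OF that] in auto)
    show ?case
    proof (rule Ck_on_SucI)
      show "((\<lambda>x. integral (cbox 0 1) (\<lambda>t. t ^ j *\<^sub>R F (t *\<^sub>R x))) has_derivative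
          (\<lambda>v. integral (cbox 0 1) (\<lambda>t. t ^ Suc j *\<^sub>R ?D (t *\<^sub>R x) v))) (at x)" if "x \<in> ball 0 r" for x
        by (rule has_derivative_eq_rhs[OF der[OF that, unfolded at_within_open[OF that open_ball]]])
          (rule ext, rule eq[OF that])
      show "Ck_on n (ball 0 r) (\<lambda>x. integral (cbox 0 1) (\<lambda>t. t ^ Suc j *\<^sub>R ?D (t *\<^sub>R x) v))" for v
        by (rule Suc.IH) (use Suc.prems in simp)
    qed simp
  }
qed

text \<open>Integrate the derivative of \<open>t \<mapsto> g (t x)\<close> from 0 to 1.\<close>

theorem Hadamard_lemma:
  fixes g :: "'a::euclidean_space \<Rightarrow> 'b::euclidean_space"
  assumes "smooth_germ g"
  obtains G where "\<And>b. smooth_germ (G b)"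
    "\<forall>\<^sub>F x in nhds 0. g x = g 0 + (\<Sum>b\<in>Basis. (x \<bullet> b) *\<^sub>R G b x)"
proof -
  obtain r where r: "r > 0" "smooth_on (ball 0 r) g" using smooth_germE[OF assms] .
  then have Ck: "Ck_on n (ball 0 r) g" for n by (simp add: smooth_on_def)
  define G where "G = (\<lambda>b x. integral (cbox 0 1) (\<lambda>t::real. t ^ 0 *\<^sub>R dir_deriv b g (t *\<^sub>R x)))"
  have CkD: "Ck_on n (ball 0 r) (dir_deriv b g)" for n b
    using Ck[of "Suc n"] by (simp add: dir_deriv_def[abs_def])
  have "smooth_germ (G b)" for b
    unfolding G_def using r(1) by (intro smooth_germI[of "ball 0 r"] Ck_on_ray_integral CkD) auto
  moreover have ev: "\<forall>\<^sub>F x in nhds 0. x \<in> ball (0::'a) r"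
    using r(1) by (intro eventually_nhds_in_open) auto
  have "g x = g 0 + (\<Sum>b\<in>Basis. (x \<bullet> b) *\<^sub>R G b x)" if x: "x \<in> ball 0 r" for x
  proof -
    have mem: "t *\<^sub>R x \<in> ball 0 r" if "t \<in> {0..1}" for t
      using that x mult_left_le_one_le[of "norm x" t] by simp
    have dg: "g differentiable (at y)" if "y \<in> ball 0 r" for y
      using Ck[of "Suc 0"] that by simp
    have "((\<lambda>t. g (t *\<^sub>R x)) has_vector_derivative dir_deriv x g (t *\<^sub>R x)) (at t within {0..1})"
      if "t \<in> {0..1}" for t
    proof -
      have "((\<lambda>t. t *\<^sub>R x) has_derivative (\<lambda>s. s *\<^sub>R x)) (at t)" by (auto intro!: derivative_eq_intros)
      from has_derivative_compose[OF this differentiable_has_dir_deriv[OF dg[OF mem[OF that]]]]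
      have "((\<lambda>t. g (t *\<^sub>R x)) has_derivative (\<lambda>s. s *\<^sub>R dir_deriv x g (t *\<^sub>R x))) (at t)"
        by (simp add: linear_scale[OF linear_dir_deriv[OF dg[OF mem[OF that]]]])
      then show ?thesis
        by (simp add: has_vector_derivative_def has_derivative_at_withinI)
    qed
    from fundamental_theorem_of_calculus[OF _ this]
    have "((\<lambda>t. dir_deriv x g (t *\<^sub>R x)) has_integral g x - g 0) {0..1}" by simp
    then have "((\<lambda>t. \<Sum>b\<in>Basis. (x \<bullet> b) *\<^sub>R dir_deriv b g (t *\<^sub>R x)) has_integral g x - g 0) {0..1}"
      by (rule has_integral_eq[rotated]) (rule dir_deriv_expand[OF dg[OF mem]])
    then have "g x - g 0 = integral {0..1} (\<lambda>t. \<Sum>b\<in>Basis. (x \<bullet> b) *\<^sub>R dir_deriv b g (t *\<^sub>R x))"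
      by (rule integral_unique[symmetric])
    also have "\<dots> = (\<Sum>b\<in>Basis. (x \<bullet> b) *\<^sub>R integral {0..1} (\<lambda>t. dir_deriv b g (t *\<^sub>R x)))"
    proof (subst integral_sum)
      fix b :: 'a
      have "continuous_on {0..1} (\<lambda>t. dir_deriv b g (t *\<^sub>R x))"
        by (rule continuous_on_compose2[of "ball 0 r" "dir_deriv b g"])
          (use CkD[of 0 b] mem in \<open>auto intro!: continuous_intros\<close>)
      then show "(\<lambda>t. (x \<bullet> b) *\<^sub>R dir_deriv b g (t *\<^sub>R x)) integrable_on {0..1}"
        by (intro integrable_continuous_real continuous_intros)
    qed auto
    finally show ?thesis by (simp add: G_def algebra_simps)
  qed
  then have "\<forall>\<^sub>F x in nhds 0. g x = g 0 + (\<Sum>b\<in>Basis. (x \<bullet> b) *\<^sub>R G b x)"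
    by (intro eventually_mono[OF ev])
  ultimately show ?thesis using that by blast
qed

text \<open>Both facts follow by differentiating the representation of \<open>g\<close> once or twice at 0. The second one is
  symmetric in \<open>c\<close> and \<open>d\<close>, which already is the symmetry of second derivatives at 0.\<close>

lemma Hadamard_dir_deriv:
  fixes g :: "'a::euclidean_space \<Rightarrow> 'b::euclidean_space"
  assumes "\<And>b. smooth_germ (G b)"
    and "\<forall>\<^sub>F x in nhds 0. g x = g 0 + (\<Sum>b\<in>Basis. (x \<bullet> b) *\<^sub>R G b x)"
  shows "c \<in> Basis \<Longrightarrow> dir_deriv c g 0 = G c 0"
    and "c \<in> Basis \<Longrightarrow> d \<in> Basis \<Longrightarrow>
      dir_deriv d (dir_deriv c g) 0 = dir_deriv d (G c) 0 + dir_deriv c (G d) 0"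
proof -
  have 1: "\<forall>\<^sub>F x in nhds 0. dir_deriv c g x =
      (\<Sum>b\<in>Basis. (x \<bullet> b) *\<^sub>R dir_deriv c (G b) x) + G c x" if c: "c \<in> Basis" for c
  proof -
    have "\<forall>\<^sub>F x in nhds 0. \<forall>b\<in>Basis. (G b has_derivative (\<lambda>v. dir_deriv v (G b) x)) (at x)"
      using assms(1) by (simp add: eventually_ball_finite_distrib smooth_germ_has_dir_deriv)
    with eventually_dir_deriv_cong[OF assms(2), of c] show ?thesis
    proof eventually_elim
      case (elim x)
      have "((\<lambda>x. g 0 + (\<Sum>b\<in>Basis. (x \<bullet> b) *\<^sub>R G b x)) has_derivative
         (\<lambda>v. 0 + (\<Sum>b\<in>Basis. (x \<bullet> b) *\<^sub>R dir_deriv v (G b) x + (v \<bullet> b) *\<^sub>R G b x))) (at x)"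
        using elim(2) by (intro has_derivative_add has_derivative_const has_derivative_sum has_derivative_scaleR
          has_derivative_inner_left has_derivative_ident) auto
      from dir_deriv_eqI[OF this, of c] elim(1) c show ?case
        by (simp add: sum.distrib inner_Basis if_distrib[of "\<lambda>r. r *\<^sub>R _"] sum.delta cong: if_cong)
    qed
  qed
  show "dir_deriv c g 0 = G c 0" if "c \<in> Basis"
    using eventually_nhds_x_imp_x[OF 1[OF that]] by simp
  show "dir_deriv d (dir_deriv c g) 0 = dir_deriv d (G c) 0 + dir_deriv c (G d) 0"
    if c: "c \<in> Basis" and d: "d \<in> Basis"
  proof -
    have "((\<lambda>x. (\<Sum>b\<in>Basis. (x \<bullet> b) *\<^sub>R dir_deriv c (G b) x) + G c x) has_derivative
       (\<lambda>v. (\<Sum>b\<in>Basis. (0 \<bullet> b) *\<^sub>R dir_deriv v (dir_deriv c (G b)) 0 + (v \<bullet> b) *\<^sub>R dir_deriv c (G b) 0)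
          + dir_deriv v (G c) 0)) (at 0)"
      using assms(1) smooth_germ_dir_deriv
      by (intro has_derivative_add has_derivative_sum has_derivative_scaleR
          has_derivative_inner_left has_derivative_ident smooth_germ_has_dir_deriv_0) auto
    from dir_deriv_eqI[OF this, of d] dir_deriv_cong[OF 1[OF c], of d] d show ?thesis
      by (simp add: inner_Basis if_distrib[of "\<lambda>r. r *\<^sub>R _"] sum.delta cong: if_cong)
  qed
qed

text \<open>At the origin this is the symmetry of the formula in \<open>Hadamard_dir_deriv\<close>; any other point is moved to
  the origin by a translation.\<close>

theorem dir_deriv_commute:
  fixes g :: "'a::euclidean_space \<Rightarrow> 'b::euclidean_space"
  assumes "smooth_germ g" and c: "c \<in> Basis" and d: "d \<in> Basis"
  shows "\<forall>\<^sub>F x in nhds 0. dir_deriv c (dir_deriv d g) x = dir_deriv d (dir_deriv c g) x"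
proof -
  obtain r where r: "r > 0" "smooth_on (ball 0 r) g" using smooth_germE[OF assms(1)] .
  have key: "dir_deriv c (dir_deriv d g) p = dir_deriv d (dir_deriv c g) p" if p: "p \<in> ball 0 r" for p
  proof -
    define U where "U = (\<lambda>x. x - p) ` ball 0 r"
    have U: "open U" "0 \<in> U" and memU: "x \<in> U \<longleftrightarrow> p + x \<in> ball 0 r" for x
      unfolding U_def using p by (auto simp: open_translation_subtract image_iff intro!: bexI[of _ "p + x"])
    have shift: "smooth_germ (\<lambda>x. f (p + x)) \<and>
        (\<forall>\<^sub>F x in nhds 0. \<forall>v. dir_deriv v (\<lambda>x. f (p + x)) x = dir_deriv v f (p + x))"
      if f: "\<And>n. Ck_on n (ball 0 r) f" for f :: "'a \<Rightarrow> 'b"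
    proof
      show "smooth_germ (\<lambda>x. f (p + x))"
      proof (rule smooth_germI[OF U])
        show "Ck_on n U (\<lambda>x. f (p + x))" for n
          using Ck_on_compose[OF U(1) open_ball f[of n] Ck_on_add[OF Ck_on_const Ck_on_ident], of p] U(1) memU
          by (simp add: image_subset_iff)
      qed
      have "dir_deriv v (\<lambda>x. f (p + x)) x = dir_deriv v f (p + x)" if "x \<in> U" for x v
      proof -
        have "((\<lambda>x. p + x) has_derivative (\<lambda>v. v)) (at x)" by (auto intro!: derivative_eq_intros)
        moreover have "(f has_derivative (\<lambda>v. dir_deriv v f (p + x))) (at (p + x))"
          using f[of "Suc 0"] that memU by (intro differentiable_has_dir_deriv) auto
        ultimately have "((\<lambda>x. f (p + x)) has_derivative (\<lambda>v. dir_deriv v f (p + x))) (at x)"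
          by (rule has_derivative_compose)
        then show ?thesis by (rule dir_deriv_eqI)
      qed
      then show "\<forall>\<^sub>F x in nhds 0. \<forall>v. dir_deriv v (\<lambda>x. f (p + x)) x = dir_deriv v f (p + x)"
        using U by (auto simp: eventually_nhds)
    qed
    have g: "Ck_on n (ball 0 r) g" and dg: "Ck_on n (ball 0 r) (dir_deriv v g)" for n v
      using r(2) Ck_on.simps(2)[of n "ball 0 r" g] by (auto simp: smooth_on_def dir_deriv_def[abs_def] simp del: Ck_on.simps)
    let ?g = "\<lambda>x. g (p + x)"
    have 2: "dir_deriv u (dir_deriv v ?g) 0 = dir_deriv u (dir_deriv v g) p" for u v
    proof -
      have "\<forall>\<^sub>F x in nhds 0. dir_deriv v ?g x = dir_deriv v g (p + x)"
        using conjunct2[OF shift[OF g]] by (rule eventually_mono) simp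
      then have "dir_deriv u (dir_deriv v ?g) 0 = dir_deriv u (\<lambda>x. dir_deriv v g (p + x)) 0"
        by (rule dir_deriv_cong)
      also have "\<dots> = dir_deriv u (dir_deriv v g) p"
        using eventually_nhds_x_imp_x[OF conjunct2[OF shift[OF dg[of _ v]]]] by simp
      finally show ?thesis .
    qed
    obtain G where "\<And>b. smooth_germ (G b)"
      "\<forall>\<^sub>F x in nhds 0. ?g x = ?g 0 + (\<Sum>b\<in>Basis. (x \<bullet> b) *\<^sub>R G b x)"
      by (rule Hadamard_lemma[OF conjunct1[OF shift[OF g]]]) (rule that)
    note H = Hadamard_dir_deriv(2)[of G ?g, OF this]
    show ?thesis using H[OF c d] H[OF d c] unfolding 2 by simp
  qed
  have "\<forall>\<^sub>F x in nhds 0. x \<in> ball (0::'a) r"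
    using r(1) by (intro eventually_nhds_in_open) auto
  then show ?thesis by (rule eventually_mono) (rule key)
qed

subsection \<open>Partial derivatives\<close>

abbreviation pd :: "'n::finite \<Rightarrow> (real^'n \<Rightarrow> 'b::real_normed_vector) \<Rightarrow> real^'n \<Rightarrow> 'b" where
  "pd i \<equiv> dir_deriv (axis i 1)"

lemma partial_deriv_eq: "partial_deriv i f = pd i f"
  by (simp add: fun_eq_iff partial_deriv_def dir_deriv_def)

lemma sum_Basis_vec: "(\<Sum>b\<in>(Basis::(real^'n) set). F b) = (\<Sum>i\<in>UNIV. F (axis i 1))"
proof -
  have B: "(Basis::(real^'n) set) = (\<lambda>i. axis i 1) ` UNIV" by (auto simp: Basis_vec_def)
  have "inj (\<lambda>i::'n. axis i (1::real))" by (simp add: inj_on_def axis_eq_axis)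
  then show ?thesis unfolding B by (simp add: sum.reindex)
qed

lemma dir_deriv_expand_vec:
  fixes f :: "real^'n \<Rightarrow> 'b::real_normed_vector"
  shows "f differentiable (at x) \<Longrightarrow> dir_deriv v f x = (\<Sum>i\<in>UNIV. (v $ i) *\<^sub>R pd i f x)"
  using dir_deriv_expand[of f x v] by (simp add: sum_Basis_vec inner_axis)

lemma pd_commute:
  fixes g :: "real^'n \<Rightarrow> 'b::euclidean_space"
  assumes "smooth_germ g"
  shows "\<forall>\<^sub>F x in nhds 0. pd i (pd j g) x = pd j (pd i g) x"
  by (rule dir_deriv_commute[OF assms]) (simp_all add: axis_in_Basis_iff)

text \<open>The version of Hadamard's lemma for coordinates. The last two clauses determine the values and, up to
  symmetrization, the first derivatives of the coefficients at 0.\<close>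

lemma Hadamard_vec:
  fixes g :: "real^'n \<Rightarrow> 'b::euclidean_space"
  assumes "smooth_germ g"
  obtains G where "\<And>i. smooth_germ (G i)"
    and "\<forall>\<^sub>F x in nhds 0. g x = g 0 + (\<Sum>i\<in>UNIV. (x $ i) *\<^sub>R G i x)"
    and "\<And>i. G i 0 = pd i g 0"
    and "\<And>i j. pd i (pd j g) 0 = pd i (G j) 0 + pd j (G i) 0"
proof -
  obtain G where G: "\<And>b. smooth_germ (G b)"
      "\<forall>\<^sub>F x in nhds 0. g x = g 0 + (\<Sum>b\<in>Basis. (x \<bullet> b) *\<^sub>R G b x)"
    by (rule Hadamard_lemma[OF assms]) (rule that)
  note H = Hadamard_dir_deriv[of G g, OF G]
  show ?thesis
  proof (rule that[of "\<lambda>i. G (axis i 1)"])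
    show "\<forall>\<^sub>F x in nhds 0. g x = g 0 + (\<Sum>i\<in>UNIV. (x $ i) *\<^sub>R G (axis i 1) x)"
      using G(2) by (simp add: sum_Basis_vec inner_axis)
    show "G (axis i 1) 0 = pd i g 0" for i using H(1)[of "axis i 1"] by (simp add: axis_in_Basis_iff)
    show "pd i (pd j g) 0 = pd i (G (axis j 1)) 0 + pd j (G (axis i 1)) 0" for i j
      using H(2)[of "axis j 1" "axis i 1"] by (simp add: axis_in_Basis_iff)
  qed (rule G(1))
qed

section \<open>Recognition of singularities\<close>

text \<open>The inverse function theorem provides a differentiable inverse \<open>g\<close> with \<open>Dg(y) = D\<phi>(g y)\<^sup>-\<^sup>1\<close>. By Cramer's
  rule the matrix on the right is a smooth function \<open>K\<close> of the point \<open>g y\<close>, so that \<open>g\<close> gains one order of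
  differentiability in each step of an induction.\<close>

lemma diffeo_germ_of_coordinates:
  fixes X Y :: "real^2 \<Rightarrow> real"
  assumes X: "smooth_germ X" "X 0 = 0" and Y: "smooth_germ Y" "Y 0 = 0"
    and J: "pd 1 X 0 * pd 2 Y 0 - pd 2 X 0 * pd 1 Y 0 \<noteq> 0"
  obtains \<phi>i where "diffeo_germ (\<lambda>p. vector [X p, Y p]) \<phi>i"
proof -
  define \<phi> where "\<phi> = (\<lambda>p. vector [X p, Y p] :: real^2)"
  define Jac where "Jac = (\<lambda>p. pd 1 X p * pd 2 Y p - pd 2 X p * pd 1 Y p)"
  have "smooth_germ Jac" unfolding Jac_def
    by (intro smooth_germ_diff smooth_germ_mult smooth_germ_dir_deriv X Y)
  then have "\<forall>\<^sub>F p in nhds 0. Jac p \<noteq> 0"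
    using J by (intro smooth_germ_eventually_nonzero) (simp_all add: Jac_def)
  from smooth_germ_nhdE[OF X(1) this] obtain U1 where
    U1: "open U1" "0 \<in> U1" "smooth_on U1 X" "\<And>p. p \<in> U1 \<Longrightarrow> Jac p \<noteq> 0" by blast
  obtain U2 where U2: "open U2" "0 \<in> U2" "smooth_on U2 Y" using Y(1) by (auto simp: smooth_germ_def)
  define U where "U = U1 \<inter> U2"
  have U: "open U" "0 \<in> U" and JU: "\<And>p. p \<in> U \<Longrightarrow> Jac p \<noteq> 0" using U1 U2 by (auto simp: U_def)
  have CX: "Ck_on n U X" and CY: "Ck_on n U Y" for n
    using U1(3) U2(3) by (auto simp: U_def smooth_on_def intro: Ck_on_subset)
  have DX: "Ck_on n U (dir_deriv v X)" and DY: "Ck_on n U (dir_deriv v Y)" for n v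
    using CX[of "Suc n"] CY[of "Suc n"] by (simp_all add: dir_deriv_def[abs_def])
  have C\<phi>: "Ck_on n U \<phi>" for n
    unfolding \<phi>_def vector_2_eq by (intro Ck_on_add Ck_on_scaleR Ck_on_const CX CY U)
  define D where "D = (\<lambda>p v. vector [dir_deriv v X p, dir_deriv v Y p] :: real^2)"
  (* Cramer's rule: K p is the inverse of D p. *)
  define K where "K = (\<lambda>p (w::real^2). vector [inverse (Jac p) * (w $ 1 * pd 2 Y p + - (w $ 2) * pd 2 X p),
     inverse (Jac p) * (w $ 2 * pd 1 X p + - (w $ 1) * pd 1 Y p)] :: real^2)"
  have dX: "X differentiable (at p)" and dY: "Y differentiable (at p)" if "p \<in> U" for p
    using CX[of "Suc 0"] CY[of "Suc 0"] that by auto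
  have der: "(\<phi> has_derivative D p) (at p)" if "p \<in> U" for p
    unfolding \<phi>_def D_def vector_2_eq
    by (intro has_derivative_add has_derivative_scaleR_left differentiable_has_dir_deriv dX[OF that] dY[OF that])
  have DK: "D p (K p w) = w" and KD: "K p (D p w) = w" if "p \<in> U" for p w
  proof -
    have e: "dir_deriv v X p = v $ 1 * pd 1 X p + v $ 2 * pd 2 X p"
         "dir_deriv v Y p = v $ 1 * pd 1 Y p + v $ 2 * pd 2 Y p" for v
      using dir_deriv_expand_vec[OF dX[OF that], of v] dir_deriv_expand_vec[OF dY[OF that], of v]
      by (simp_all add: sum_2)
    have j: "Jac p \<noteq> 0" using JU that .
    have jj: "inverse (Jac p) * (c * Jac p) = c" for c using j by simp
    define i a b c d where ab: "i = inverse (Jac p)" "a = pd 1 X p" "b = pd 2 X p" "c = pd 1 Y p" "d = pd 2 Y p"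
    have j': "Jac p = a * d - b * c" by (simp add: Jac_def ab)
    have K12: "K p w $ 1 = i * (w $ 1 * d + - (w $ 2) * b)" "K p w $ 2 = i * (w $ 2 * a + - (w $ 1) * c)" for w
      by (simp_all add: K_def ab)
    have D12: "D p w $ 1 = w $ 1 * a + w $ 2 * b" "D p w $ 2 = w $ 1 * c + w $ 2 * d" for w
      unfolding D_def ab e[of w] by simp_all
    have "D p (K p w) $ 1 = i * (w $ 1 * Jac p)" "D p (K p w) $ 2 = i * (w $ 2 * Jac p)"
      unfolding D12 K12 j' by (simp_all add: algebra_simps)
    then show "D p (K p w) = w" unfolding ab jj by (simp add: vec_eq_iff forall_2)
    have "K p (D p w) $ 1 = i * (w $ 1 * Jac p)" "K p (D p w) $ 2 = i * (w $ 2 * Jac p)"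
      unfolding D12 K12 j' by (simp_all add: algebra_simps)
    then show "K p (D p w) = w" unfolding ab jj by (simp add: vec_eq_iff forall_2)
  qed
  have bl: "bounded_linear (D p)" if "p \<in> U" for p using der[OF that] by (rule has_derivative_bounded_linear)
  have blK: "bounded_linear (K p)" for p
    unfolding linear_conv_bounded_linear[symmetric]
    by (rule linearI) (simp_all add: vec_eq_iff forall_2 K_def algebra_simps)
  define f' where "f' = (\<lambda>p. Blinfun (D p))"
  have f': "blinfun_apply (f' p) = D p" if "p \<in> U" for p
    using bl[OF that] by (simp add: f'_def bounded_linear_Blinfun_apply)
  have contf: "continuous_on U f'"
  proof (rule continuous_on_blinfun_componentwise)
    fix i :: "real^2"
    have "Ck_on 0 U (\<lambda>p. D p i)"
      unfolding D_def vector_2_eq by (intro Ck_on_add Ck_on_scaleR Ck_on_const DX DY U)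
    then show "continuous_on U (\<lambda>p. blinfun_apply (f' p) i)"
      using f' by (simp cong: continuous_on_cong)
  qed
  have inv0: "Blinfun (K 0) o\<^sub>L f' 0 = id_blinfun"
    by (rule blinfun_eqI) (simp add: f' U bounded_linear_Blinfun_apply blK KD)
  obtain U' V g g' where UV: "open U'" "U' \<subseteq> U" "0 \<in> U'" "open V" "\<phi> 0 \<in> V" "homeomorphism U' V \<phi> g"
    and g: "\<And>y. y \<in> V \<Longrightarrow> (g has_derivative (g' y)) (at y)"
    "\<And>y. y \<in> V \<Longrightarrow> g' y = inv (blinfun_apply (f'(g y)))"
    using inverse_function_theorem[OF U(1) _ contf U(2) inv0, of \<phi>] der f' by (metis (no_types, lifting))
  have gV: "g y \<in> U" if "y \<in> V" for y
    using UV(2,6) that by (auto simp: homeomorphism_def)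
  have g'K: "g' y = K (g y)" if "y \<in> V" for y
    unfolding g(2)[OF that] f'[OF gV[OF that]]
    by (rule inv_equality) (simp_all add: DK KD gV[OF that])
  have "Ck_on n V g" for n
  proof (induction n)
    case 0
    then show ?case using UV(6) by (simp add: homeomorphism_def)
  next
    case (Suc n)
    show ?case
    proof (rule Ck_on_SucI)
      show "(g has_derivative K (g y)) (at y)" if "y \<in> V" for y using g(1)[OF that] g'K[OF that] by simp
      have "Ck_on n U (\<lambda>p. K p v)" for v
        unfolding K_def vector_2_eq
        by (intro Ck_on_add Ck_on_scaleR Ck_on_mult Ck_on_const DX DY U Ck_on_inverse JU)
           (auto simp: Jac_def diff_conv_add_uminus simp del: add_uminus_conv_diff
             intro!: Ck_on_add Ck_on_mult DX DY U Ck_on_bounded_linear[OF _ bounded_linear_minus[OF bounded_linear_ident]])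
      then show "Ck_on n V (\<lambda>y. K (g y) v)" for v
        using Ck_on_compose[OF UV(4) U(1), of n "\<lambda>p. K p v" g] Suc gV by (simp add: image_subset_iff)
    qed (rule UV)
  qed
  then have "diffeo_germ \<phi> g"
    using UV C\<phi> X(2) Y(2) Ck_on_subset[OF C\<phi> UV(2)]
    unfolding diffeo_germ_def smooth_on_def
    by (intro conjI exI[of _ U'] exI[of _ V]) (simp_all add: \<phi>_def vector_2_eq)
  then show ?thesis unfolding \<phi>_def by (rule that)
qed

lemma diffeo_germD:
  assumes "diffeo_germ \<phi> \<phi>i"
  shows "smooth_germ \<phi>" "smooth_germ \<phi>i" "\<phi> 0 = 0" "\<phi>i 0 = 0"
    "\<forall>\<^sub>F x in nhds 0. \<phi>i (\<phi> x) = x" "\<forall>\<^sub>F x in nhds 0. \<phi> (\<phi>i x) = x"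
proof -
  from assms obtain U V where *: "\<phi> 0 = 0" "open U" "0 \<in> U" "open V" "homeomorphism U V \<phi> \<phi>i"
    "smooth_on U \<phi>" "smooth_on V \<phi>i" unfolding diffeo_germ_def by blast
  then have "0 \<in> V" "\<phi>i 0 = 0" by (force simp: homeomorphism_def)+
  with * show "smooth_germ \<phi>" "smooth_germ \<phi>i" "\<phi> 0 = 0" "\<phi>i 0 = 0"
    by (auto simp: smooth_germ_def)
  show "\<forall>\<^sub>F x in nhds 0. \<phi>i (\<phi> x) = x"
    by (rule eventually_mono[OF eventually_nhds_in_open[OF *(2,3)]]) (use *(5) in \<open>auto simp: homeomorphism_def\<close>)
  show "\<forall>\<^sub>F x in nhds 0. \<phi> (\<phi>i x) = x"
    by (rule eventually_mono[OF eventually_nhds_in_open[OF *(4) \<open>0 \<in> V\<close>]]) (use *(5) in \<open>auto simp: homeomorphism_def\<close>)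
qed

text \<open>A unit times the normal form in some coordinates \<open>X\<close>, \<open>Y\<close> suffices; the inverse of the coordinate map and
  the inverse of the unit witness \<open>\<K>\<close>-equivalence.\<close>

lemma A_singularityI:
  fixes X Y a h :: "real^2 \<Rightarrow> real"
  assumes X: "smooth_germ X" "X 0 = 0" and Y: "smooth_germ Y" "Y 0 = 0"
    and J: "pd 1 X 0 * pd 2 Y 0 - pd 2 X 0 * pd 1 Y 0 \<noteq> 0"
    and a: "smooth_germ a" "a 0 \<noteq> 0" and s: "s \<in> {1, -1}"
    and h: "\<forall>\<^sub>F p in nhds 0. h p = a p * ((X p)\<^sup>2 + s * (Y p) ^ (k + 1))"
  shows "A_singularity k h"
proof -
  obtain \<phi>i where d: "diffeo_germ (\<lambda>p. vector [X p, Y p]) \<phi>i"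
    by (rule diffeo_germ_of_coordinates[OF X Y J]) (rule that)
  note d' = diffeo_germD[OF d]
  have "\<forall>\<^sub>F p in nhds 0. h (\<phi>i p) = a (\<phi>i p) * ((X (\<phi>i p))\<^sup>2 + s * (Y (\<phi>i p)) ^ (k + 1))"
    by (rule eventually_nhds_0_compose[OF d'(2,4) h])
  moreover
  have sa: "smooth_germ (\<lambda>p. a (\<phi>i p))" by (rule smooth_germ_compose[OF a(1) d'(2,4)])
  have "\<forall>\<^sub>F p in nhds 0. a (\<phi>i p) \<noteq> 0"
    by (rule smooth_germ_eventually_nonzero[OF sa]) (simp add: d'(4) a(2))
  ultimately have "\<forall>\<^sub>F p in nhds 0. (p $ 1)\<^sup>2 + s * (p $ 2) ^ (k + 1) = inverse (a (\<phi>i p)) * h (\<phi>i p)"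
    using d'(6)
  proof eventually_elim
    case (elim p)
    from elim(3) have "X (\<phi>i p) = p $ 1" "Y (\<phi>i p) = p $ 2" by (auto simp: vec_eq_iff forall_2)
    with elim show ?case by simp
  qed
  moreover have "smooth_germ (\<lambda>p. inverse (a (\<phi>i p)))" "inverse (a (\<phi>i 0)) \<noteq> 0"
    using a(2) d'(4) by (auto intro: smooth_germ_inverse sa)
  ultimately have "K_equivalent h (\<lambda>p. (p $ 1)\<^sup>2 + s * (p $ 2) ^ (k + 1))"
    using d unfolding K_equivalent_def by blast
  with s show ?thesis unfolding A_singularity_def by blast
qed

lemma dir_deriv_mult_0:
  fixes a f :: "'a::real_normed_vector \<Rightarrow> real"
  assumes "smooth_germ a" "smooth_germ f" "f 0 = 0"
  shows "dir_deriv v (\<lambda>p. a p * f p) 0 = a 0 * dir_deriv v f 0"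
  using dir_deriv_eqI[OF has_derivative_mult[OF smooth_germ_has_dir_deriv_0[OF assms(1)]
        smooth_germ_has_dir_deriv_0[OF assms(2)]], of v] assms(3) by simp

lemma dir_deriv_add_0:
  assumes "smooth_germ f" "smooth_germ g"
  shows "dir_deriv v (\<lambda>p. f p + g p) 0 = dir_deriv v f 0 + dir_deriv v g 0"
  using dir_deriv_eqI[OF has_derivative_add[OF smooth_germ_has_dir_deriv_0[OF assms(1)]
        smooth_germ_has_dir_deriv_0[OF assms(2)]], of v] .

text \<open>Completing the square gives \<open>h = A (X\<^sup>2 + m y\<^sup>3)\<close> with a unit \<open>m\<close>. Since 2 and 3 are coprime, \<open>m\<close> can be removed
  without taking roots: \<open>m\<^sup>2 (X\<^sup>2 + m y\<^sup>3) = (m X)\<^sup>2 + (m y)\<^sup>3\<close>.\<close>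

lemma A2_of_weighted_form:
  fixes x y A B C h :: "real^2 \<Rightarrow> real"
  assumes x: "smooth_germ x" "x 0 = 0" and y: "smooth_germ y" "y 0 = 0"
    and J: "pd 1 x 0 * pd 2 y 0 - pd 2 x 0 * pd 1 y 0 \<noteq> 0"
    and A: "smooth_germ A" "A 0 \<noteq> 0" and B: "smooth_germ B" and C: "smooth_germ C" "C 0 \<noteq> 0"
    and h: "\<forall>\<^sub>F p in nhds 0. h p = A p * (x p)\<^sup>2 + 2 * B p * x p * (y p)\<^sup>2 + C p * (y p) ^ 3"
  shows "A_singularity 2 h"
proof -
  define m where "m = (\<lambda>p. (C p - y p * ((B p)\<^sup>2 / A p)) / A p)"
  have m: "smooth_germ m" "m 0 \<noteq> 0"
    unfolding m_def using x y A B C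
    by (auto intro!: smooth_germ_intros smooth_germ_divide)
  define E where "E = (\<lambda>p. (y p * (B p / A p)) * y p)"
  have E: "smooth_germ E" "E 0 = 0" "dir_deriv v E 0 = 0" for v
  proof -
    have s: "smooth_germ (\<lambda>p. y p * (B p / A p))" using y A B
      by (auto intro!: smooth_germ_intros smooth_germ_divide)
    show "smooth_germ E" unfolding E_def by (rule smooth_germ_mult[OF s y(1)])
    show "E 0 = 0" by (simp add: E_def y)
    show "dir_deriv v E 0 = 0" unfolding E_def dir_deriv_mult_0[OF s y] by (simp add: y)
  qed
  define X where "X = (\<lambda>p. m p * (x p + E p))"
  define Y where "Y = (\<lambda>p. m p * y p)"
  have dX: "dir_deriv v X 0 = m 0 * dir_deriv v x 0" for v
    unfolding X_def using x E m by (simp add: dir_deriv_mult_0 dir_deriv_add_0 smooth_germ_add)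
  have dY: "dir_deriv v Y 0 = m 0 * dir_deriv v y 0" for v
    unfolding Y_def using y m by (simp add: dir_deriv_mult_0)
  show ?thesis
  proof (rule A_singularityI[of X Y "\<lambda>p. A p / (m p * m p)" 1])
    show "smooth_germ X" "X 0 = 0" "smooth_germ Y" "Y 0 = 0"
      unfolding X_def Y_def using x y E m by (auto intro!: smooth_germ_intros)
    have "pd 1 X 0 * pd 2 Y 0 - pd 2 X 0 * pd 1 Y 0 =
        (m 0)\<^sup>2 * (pd 1 x 0 * pd 2 y 0 - pd 2 x 0 * pd 1 y 0)"
      unfolding dX dY by (simp add: algebra_simps power2_eq_square)
    then show "pd 1 X 0 * pd 2 Y 0 - pd 2 X 0 * pd 1 Y 0 \<noteq> 0" using J m by simp
    show "smooth_germ (\<lambda>p. A p / (m p * m p))" "A 0 / (m 0 * m 0) \<noteq> 0"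
      using A m by (auto intro!: smooth_germ_divide smooth_germ_mult)
    show "\<forall>\<^sub>F p in nhds 0. h p = A p / (m p * m p) * ((X p)\<^sup>2 + 1 * Y p ^ (2 + 1))"
      using h smooth_germ_eventually_nonzero[OF A] smooth_germ_eventually_nonzero[OF m]
    proof eventually_elim
      case (elim p)
      have 1: "Y p ^ 3 = m p * m p * (m p * y p ^ 3)" "(X p)\<^sup>2 = m p * m p * (x p + E p)\<^sup>2"
        by (simp_all add: X_def Y_def power2_eq_square power3_eq_cube)
      have 2: "A p * m p = C p - y p * (B p)\<^sup>2 / A p" using elim by (simp add: m_def)
      have 3: "A p * E p = B p * (y p)\<^sup>2" "A p * (E p)\<^sup>2 = (B p)\<^sup>2 * y p ^ 4 / A p" using elim
        by (simp_all add: E_def power2_eq_square power4_eq_xxxx)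
      have "A p / (m p * m p) * ((X p)\<^sup>2 + 1 * Y p ^ (2 + 1)) = A p * ((x p + E p)\<^sup>2 + m p * y p ^ 3)"
      proof -
        have "c / q * (q * a + 1 * (q * b)) = c * (a + b)" if "q \<noteq> 0" for c q a b :: real
          using that by (simp add: field_simps)
        then show ?thesis unfolding add_2_eq_Suc' one_add_one 1(2) using 1(1) elim(3)
          by (simp add: numeral_3_eq_3 numeral_2_eq_2 1 del: power_Suc)
      qed
      also have "\<dots> = A p * (x p)\<^sup>2 + 2 * x p * (A p * E p) + A p * (E p)\<^sup>2 + (A p * m p) * y p ^ 3"
        by (simp add: algebra_simps power2_eq_square)
      also have "\<dots> = A p * (x p)\<^sup>2 + 2 * x p * (B p * (y p)\<^sup>2) + C p * y p ^ 3"
        unfolding 2 3 by (simp add: algebra_simps power3_eq_cube power4_eq_xxxx)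
      finally show ?case using elim by simp
    qed
  qed simp
qed

text \<open>The Morse lemma for an indefinite form without pure squares at 0. In the coordinates \<open>u = (x + y)/2\<close> and
  \<open>v = (x - y)/2\<close> the coefficient of \<open>u\<^sup>2\<close> is a unit, so the square can be completed; the coefficient \<open>- m\<close> of
  \<open>v\<^sup>2\<close> is then negative and is absorbed by a square root.\<close>

lemma A1_of_saddle_form:
  fixes x y A B C h :: "real^2 \<Rightarrow> real"
  assumes x: "smooth_germ x" "x 0 = 0" and y: "smooth_germ y" "y 0 = 0"
    and J: "pd 1 x 0 * pd 2 y 0 - pd 2 x 0 * pd 1 y 0 \<noteq> 0"
    and A: "smooth_germ A" "A 0 = 0" and B: "smooth_germ B" "B 0 \<noteq> 0" and C: "smooth_germ C" "C 0 = 0"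
    and h: "\<forall>\<^sub>F p in nhds 0. h p = A p * (x p)\<^sup>2 + 2 * B p * x p * y p + C p * (y p)\<^sup>2"
  shows "A_singularity 1 h"
proof -
  define A' where "A' = (\<lambda>p. A p + 2 * B p + C p)"
  define B' where "B' = (\<lambda>p. A p - C p)"
  define C' where "C' = (\<lambda>p. A p - 2 * B p + C p)"
  define u where "u = (\<lambda>p. (1/2) * (x p + y p))"
  define v where "v = (\<lambda>p. (1/2) * (x p - y p))"
  have A': "smooth_germ A'" "A' 0 \<noteq> 0" and B': "smooth_germ B'" "B' 0 = 0" and C': "smooth_germ C'"
    unfolding A'_def B'_def C'_def using A B C by (auto intro!: smooth_germ_intros)
  have "smooth_germ u" "smooth_germ v"
    unfolding u_def v_def by (intro smooth_germ_intros x y)+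
  then have u: "smooth_germ u" "u 0 = 0" and v: "smooth_germ v" "v 0 = 0"
    by (simp_all add: u_def v_def x y)
  define m where "m = (\<lambda>p. ((B' p)\<^sup>2 - A' p * C' p) / (A' p)\<^sup>2)"
  have m: "smooth_germ m" "m 0 > 0"
  proof -
    show "smooth_germ m" unfolding m_def using A' B' C' by (auto intro!: smooth_germ_intros smooth_germ_divide)
    have "(B' 0)\<^sup>2 - A' 0 * C' 0 = (2 * B 0)\<^sup>2"
      using A C B'(2) by (simp add: A'_def C'_def power2_eq_square)
    then show "m 0 > 0" unfolding m_def using A' B by simp
  qed
  define r where "r = (\<lambda>p. sqrt (m p))"
  have r: "smooth_germ r" "r 0 > 0" unfolding r_def using m by (auto intro: smooth_germ_sqrt)
  define X where "X = (\<lambda>p. u p + (B' p / A' p) * v p)"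
  define Y where "Y = (\<lambda>p. r p * v p)"
  have q: "smooth_germ (\<lambda>p. B' p / A' p)" using A' B' by (auto intro: smooth_germ_divide)
  have dX: "dir_deriv w X 0 = dir_deriv w u 0" for w
    unfolding X_def dir_deriv_add_0[OF u(1) smooth_germ_mult[OF q v(1)]] dir_deriv_mult_0[OF q v]
    by (simp add: B'(2))
  have dY: "dir_deriv w Y 0 = r 0 * dir_deriv w v 0" for w
    unfolding Y_def using r v by (simp add: dir_deriv_mult_0)
  have du: "dir_deriv w u 0 = (1/2) * (dir_deriv w x 0 + dir_deriv w y 0)" for w
  proof -
    have "((\<lambda>p. (1/2) * (x p + y p)) has_derivative (\<lambda>w. (1/2) * (dir_deriv w x 0 + dir_deriv w y 0))) (at 0)"
      using x y by (intro has_derivative_mult_right has_derivative_add smooth_germ_has_dir_deriv_0)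
    then show ?thesis unfolding u_def by (rule dir_deriv_eqI)
  qed
  have dv: "dir_deriv w v 0 = (1/2) * (dir_deriv w x 0 - dir_deriv w y 0)" for w
  proof -
    have "((\<lambda>p. (1/2) * (x p - y p)) has_derivative (\<lambda>w. (1/2) * (dir_deriv w x 0 - dir_deriv w y 0))) (at 0)"
      using x y by (intro has_derivative_mult_right has_derivative_diff smooth_germ_has_dir_deriv_0)
    then show ?thesis unfolding v_def by (rule dir_deriv_eqI)
  qed
  show ?thesis
  proof (rule A_singularityI[of X Y "A'" "-1"])
    show "smooth_germ X" "X 0 = 0" "smooth_germ Y" "Y 0 = 0"
      unfolding X_def Y_def using smooth_germ_add[OF u(1) smooth_germ_mult[OF q v(1)]]
        smooth_germ_mult[OF r(1) v(1)] by (simp_all add: u(2) v(2))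
    have "pd 1 X 0 * pd 2 Y 0 - pd 2 X 0 * pd 1 Y 0 =
        - (r 0 / 2) * (pd 1 x 0 * pd 2 y 0 - pd 2 x 0 * pd 1 y 0)"
      unfolding dX dY du dv by (simp add: field_simps)
    then show "pd 1 X 0 * pd 2 Y 0 - pd 2 X 0 * pd 1 Y 0 \<noteq> 0" using J r by simp
    show "\<forall>\<^sub>F p in nhds 0. h p = A' p * ((X p)\<^sup>2 + - 1 * Y p ^ (1 + 1))"
      using h smooth_germ_eventually_nonzero[OF A'] smooth_germ_eventually_pos[OF m]
    proof eventually_elim
      case (elim p)
      define e where "e = (B' p / A' p) * v p"
      have 1: "A' p * e = B' p * v p" "A' p * e\<^sup>2 = (B' p)\<^sup>2 * (v p)\<^sup>2 / A' p" using elim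
        by (simp_all add: e_def power2_eq_square)
      have 2: "A' p * m p = (B' p)\<^sup>2 / A' p - C' p" using elim by (simp add: m_def power2_eq_square field_simps)
      have 3: "Y p ^ (1 + 1) = m p * (v p)\<^sup>2" using elim by (simp add: Y_def r_def power2_eq_square)
      have 4: "x p = u p + v p" "y p = u p - v p" by (simp_all add: u_def v_def field_simps)
      have "A' p * ((X p)\<^sup>2 + - 1 * Y p ^ (1 + 1)) =
         A' p * (u p)\<^sup>2 + 2 * u p * (A' p * e) + A' p * e\<^sup>2 - (A' p * m p) * (v p)\<^sup>2"
        unfolding 3 X_def e_def[symmetric] by (simp add: algebra_simps power2_eq_square)
      also have "\<dots> = A' p * (u p)\<^sup>2 + 2 * u p * (B' p * v p) + C' p * (v p)\<^sup>2"
        unfolding 1 2 by (simp add: algebra_simps)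
      also have "\<dots> = A p * (x p)\<^sup>2 + 2 * B p * x p * y p + C p * (y p)\<^sup>2"
        unfolding A'_def B'_def C'_def 4 by (simp add: algebra_simps power2_eq_square)
      finally show ?case using elim by simp
    qed
  qed (use A' in auto)
qed

lemma smooth_germ_H: "smooth_germ (H_germ k)"
  unfolding H_germ_def by (intro smooth_germ_intros)

lemma H_germ_0: "k \<ge> 1 \<Longrightarrow> H_germ k 0 = 0"
  by (simp add: H_germ_def vector_3_eq)

text \<open>Applying Hadamard's lemma to \<open>G\<close> and again to its first two coefficients expresses \<open>G \<circ> H\<^sub>k\<close>
  through the components \<open>x\<close>, \<open>x y + y^(3k-1)\<close> and \<open>y\<^sup>3\<close> and their products. Collecting powers of \<open>x\<close> and
  \<open>y\<close> gives the two forms recognized above. The assumption \<open>k \<ge> 2\<close> makes \<open>y^(3k-1)\<close> divisible by \<open>y\<^sup>5\<close>, so that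
  it contributes only to terms of higher weight.\<close>

lemma function_on_H:
  fixes G :: "real^3 \<Rightarrow> real" and \<phi> :: "real^2 \<Rightarrow> real^2"
  assumes k: "k \<ge> 2" and G: "smooth_germ G" "G 0 = 0" "pd 1 G 0 = 0"
    and \<phi>: "smooth_germ \<phi>" "\<phi> 0 = 0"
    and J: "pd 1 \<phi> 0 $ 1 * pd 2 \<phi> 0 $ 2 - pd 2 \<phi> 0 $ 1 * pd 1 \<phi> 0 $ 2 \<noteq> 0"
    and h: "\<forall>\<^sub>F p in nhds 0. h p = G (H_germ k (\<phi> p))"
  shows "pd 1 (pd 1 G) 0 = 0 \<Longrightarrow> pd 2 G 0 \<noteq> 0 \<Longrightarrow> A_singularity 1 h"
    and "pd 1 (pd 1 G) 0 \<noteq> 0 \<Longrightarrow> pd 2 G 0 = 0 \<Longrightarrow> pd 3 G 0 \<noteq> 0 \<Longrightarrow> A_singularity 2 h"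
proof -
  obtain G1 where G1: "\<And>i. smooth_germ (G1 i)"
     "\<forall>\<^sub>F z in nhds 0. G z = G 0 + (\<Sum>i\<in>UNIV. (z $ i) *\<^sub>R G1 i z)"
     "\<And>i. G1 i 0 = pd i G 0" "\<And>i j. pd i (pd j G) 0 = pd i (G1 j) 0 + pd j (G1 i) 0"
    by (rule Hadamard_vec[OF G(1)]) (rule that)
  have "\<exists>G2. \<forall>j. (\<forall>i. smooth_germ (G2 j i)) \<and>
      (\<forall>\<^sub>F z in nhds 0. G1 j z = G1 j 0 + (\<Sum>i\<in>UNIV. (z $ i) *\<^sub>R G2 j i z)) \<and>
      (\<forall>i. G2 j i 0 = pd i (G1 j) 0)"
    by (rule choice, rule allI, rule Hadamard_vec[OF G1(1)]) blast
  then obtain G2 where G2: "\<And>i j. smooth_germ (G2 j i)"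
     "\<And>j. \<forall>\<^sub>F z in nhds 0. G1 j z = G1 j 0 + (\<Sum>i\<in>UNIV. (z $ i) *\<^sub>R G2 j i z)"
     "\<And>i j. G2 j i 0 = pd i (G1 j) 0" by blast
  define F where "F = (\<lambda>p. H_germ k (\<phi> p))"
  have F: "smooth_germ F" "F 0 = 0"
    unfolding F_def using smooth_germ_compose[OF smooth_germ_H \<phi>] k by (simp_all add: \<phi>(2) H_germ_0)
  define x where "x = (\<lambda>p. \<phi> p $ 1)"
  define y where "y = (\<lambda>p. \<phi> p $ 2)"
  have xy: "smooth_germ x" "x 0 = 0" "smooth_germ y" "y 0 = 0"
    unfolding x_def y_def using \<phi> by (auto intro: smooth_germ_nth)
  have dxy: "dir_deriv v x 0 = dir_deriv v \<phi> 0 $ 1" "dir_deriv v y 0 = dir_deriv v \<phi> 0 $ 2" for v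
    unfolding x_def y_def
    by (auto intro!: dir_deriv_eqI bounded_linear.has_derivative[OF bounded_linear_vec_nth]
        smooth_germ_has_dir_deriv_0 \<phi>)
  have J': "pd 1 x 0 * pd 2 y 0 - pd 2 x 0 * pd 1 y 0 \<noteq> 0" using J by (simp add: dxy)
  define g1 where "g1 = (\<lambda>i p. G1 i (F p))"
  define g2 where "g2 = (\<lambda>i j p. G2 i j (F p))"
  (* The exponent 3k - 1 is written as n + 5, so that subtraction disappears from all exponents. *)
  define n where "n = 3 * k - 6"
  have n: "3 * k - 1 = n + 5" using k by (simp add: n_def)
  have g: "smooth_germ (g1 i)" "smooth_germ (g2 i j)" for i j
    unfolding g1_def g2_def by (rule smooth_germ_compose[OF G1(1) F], rule smooth_germ_compose[OF G2(1) F])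
  have g0: "g1 i 0 = pd i G 0" "g2 1 1 0 = pd 1 (pd 1 G) 0 / 2" for i
    using G1(3,4)[of 1] G2(3)[of 1 1] G1(3)[of i] by (simp_all add: g1_def g2_def F)
  have h': "\<forall>\<^sub>F p in nhds 0. h p = G (F p)" using h by (simp add: F_def)
  have F3: "F p $ 1 = x p" "F p $ 2 = x p * y p + y p ^ (n + 5)" "F p $ 3 = y p ^ 3" for p
    unfolding F_def H_germ_def n x_def y_def by simp_all
  have H1: "\<forall>\<^sub>F p in nhds 0. h p = x p * g1 1 p + (x p * y p + y p ^ (n+5)) * g1 2 p + y p ^ 3 * g1 3 p"
    using h' eventually_nhds_0_compose[OF F G1(2)]
    by eventually_elim (simp add: F3 sum_3 g1_def G(2))
  have H2: "\<forall>\<^sub>F p in nhds 0. g1 i p = pd i G 0 + x p * g2 i 1 p + (x p * y p + y p ^ (n+5)) * g2 i 2 p + y p ^ 3 * g2 i 3 p" for i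
    using eventually_nhds_0_compose[OF F G2(2)[of i]]
    by eventually_elim (simp add: F3 sum_3 g1_def g2_def G1(3))
  note [intro!] = smooth_germ_intros smooth_germ_divide and [intro] = xy(1,3) g
  show "A_singularity 1 h" if "pd 1 (pd 1 G) 0 = 0" "pd 2 G 0 \<noteq> 0"
  proof (rule A1_of_saddle_form[OF xy J'])
    show "\<forall>\<^sub>F p in nhds 0. h p = (g2 1 1 p + y p * g2 1 2 p) * (x p)\<^sup>2
        + 2 * (1/2 * (g1 2 p + y p ^ (n + 4) * g2 1 2 p + y p ^ 2 * g2 1 3 p)) * x p * y p
        + (y p ^ (n + 3) * g1 2 p + y p * g1 3 p) * (y p)\<^sup>2"
      using H1 H2[of 1]
    proof eventually_elim
      case (elim p)
      show ?case unfolding elim(1) unfolding elim(2) G(3)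
        by (simp add: algebra_simps power_add power2_eq_square power3_eq_cube numeral_eq_Suc)
    qed
  qed (auto simp: that g0 xy power_0_left)
  show "A_singularity 2 h" if "pd 1 (pd 1 G) 0 \<noteq> 0" "pd 2 G 0 = 0" "pd 3 G 0 \<noteq> 0"
  proof (rule A2_of_weighted_form[OF xy J'])
    show "\<forall>\<^sub>F p in nhds 0. h p =
        (g2 1 1 p + y p * g2 1 2 p + y p * g2 2 1 p + y p ^ 2 * g2 2 2 p) * (x p)\<^sup>2
        + 2 * (1/2 * (y p ^ (n + 3) * g2 1 2 p + y p * g2 1 3 p + y p ^ (n + 3) * g2 2 1 p
             + 2 * y p ^ (n + 4) * g2 2 2 p + y p ^ 2 * g2 2 3 p)) * x p * (y p)\<^sup>2
        + (g1 3 p + y p ^ (n + n + 7) * g2 2 2 p + y p ^ (n + 5) * g2 2 3 p) * y p ^ 3"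
      using H1 H2[of 1] H2[of 2]
    proof eventually_elim
      case (elim p)
      show ?case unfolding elim(1) unfolding elim(2,3) G(3) that
        by (simp add: algebra_simps power_add power2_eq_square power3_eq_cube numeral_eq_Suc)
    qed
  qed (auto simp: that g0 xy power_0_left)
qed

section \<open>Surfaces given as images of the model germ\<close>

lemma chain_rule:
  fixes G :: "real^'n \<Rightarrow> 'b::euclidean_space" and K :: "'a::real_normed_vector \<Rightarrow> real^'n"
  assumes G: "smooth_germ G" and K: "smooth_germ K" "K 0 = 0"
  shows "\<forall>\<^sub>F p in nhds 0. dir_deriv v (\<lambda>p. G (K p)) p = (\<Sum>a\<in>UNIV. (dir_deriv v K p $ a) *\<^sub>R pd a G (K p))"
  using smooth_germ_has_dir_deriv[OF K(1)] 
    eventually_nhds_0_compose[OF K smooth_germ_eventually_differentiable[OF G]]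
proof eventually_elim
  case (elim p)
  show ?case
    using dir_deriv_eqI[OF has_derivative_compose[OF elim(1) differentiable_has_dir_deriv[OF elim(2)]], of v]
      dir_deriv_expand_vec[OF elim(2), of "dir_deriv v K p"] by simp
qed

text \<open>Differentiates the formula of \<open>chain_rule\<close> once more. Curves, reparametrizations of the plane and the
  composition with the model germ are all instances.\<close>

lemma chain_rule_2:
  fixes G :: "real^'n \<Rightarrow> 'b::euclidean_space" and K :: "'a::real_normed_vector \<Rightarrow> real^'n"
  assumes G: "smooth_germ G" and K: "smooth_germ K" "K 0 = 0"
  shows "\<forall>\<^sub>F p in nhds 0. dir_deriv u (dir_deriv v (\<lambda>p. G (K p))) p =
    (\<Sum>a\<in>UNIV. (dir_deriv u (dir_deriv v K) p $ a) *\<^sub>R pd a G (K p) +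
       (dir_deriv v K p $ a) *\<^sub>R (\<Sum>b\<in>UNIV. (dir_deriv u K p $ b) *\<^sub>R pd b (pd a G) (K p)))"
proof -
  have ev: "\<forall>\<^sub>F p in nhds 0. \<forall>a. ((\<lambda>p. pd a G (K p)) has_derivative (\<lambda>w. dir_deriv w (\<lambda>p. pd a G (K p)) p)) (at p)
      \<and> dir_deriv u (\<lambda>p. pd a G (K p)) p = (\<Sum>b\<in>UNIV. (dir_deriv u K p $ b) *\<^sub>R pd b (pd a G) (K p))"
    by (intro eventually_all_finite eventually_conj smooth_germ_has_dir_deriv
        smooth_germ_compose[OF _ K] chain_rule K smooth_germ_dir_deriv G)
  show ?thesis
    using eventually_dir_deriv_cong[OF chain_rule[OF G K, of v], of u]
      smooth_germ_has_dir_deriv[OF smooth_germ_dir_deriv[OF K(1), of v]] ev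
  proof eventually_elim
    case (elim p)
    have "((\<lambda>p. \<Sum>a\<in>UNIV. (dir_deriv v K p $ a) *\<^sub>R pd a G (K p)) has_derivative
      (\<lambda>w. \<Sum>a\<in>UNIV. (dir_deriv v K p $ a) *\<^sub>R dir_deriv w (\<lambda>p. pd a G (K p)) p +
        (dir_deriv w (dir_deriv v K) p $ a) *\<^sub>R pd a G (K p))) (at p)"
      using elim(2,3)
      by (intro has_derivative_sum has_derivative_scaleR
          bounded_linear.has_derivative[OF bounded_linear_vec_nth]) auto
    from dir_deriv_eqI[OF this, of u] show ?case
      unfolding elim(1) using elim(3) by (simp add: add.commute)
  qed
qed

lemma H_has_derivative:
  "(H_germ k has_derivative (\<lambda>v. vector [v $ 1,
     v $ 1 * z $ 2 + v $ 2 * (z $ 1 + real (3 * k - 1) * (z $ 2) ^ (3 * k - 2)), v $ 2 * (3 * (z $ 2)\<^sup>2)])) (at z)"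
  unfolding H_germ_def[abs_def] vector_3_eq
  by (rule has_derivative_eq_rhs, (rule derivative_eq_intros refl bounded_linear.has_derivative[OF bounded_linear_vec_nth])+)
     (simp add: fun_eq_iff vec_eq_iff forall_3 algebra_simps numeral_2_eq_2 Suc_diff_Suc)

text \<open>The derivative of the second component \<open>x y + y^(3k-1)\<close> of the model germ in \<open>y\<close>. The second column
  of the Jacobian matrix is \<open>(0, slope, 3 y\<^sup>2)\<close>, which makes the slope a better coordinate than \<open>x\<close> for the
  parabolic function.\<close>

definition slope :: "nat \<Rightarrow> real^2 \<Rightarrow> real" where
  "slope k z = z $ 1 + real (3 * k - 1) * (z $ 2) ^ (3 * k - 2)"

lemma axis_component: "axis i c $ j = (if j = i then c else 0)"
  by (simp add: axis_def)

lemma pd_H: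
  "pd 1 (H_germ k) = (\<lambda>z. vector [1, z $ 2, 0])"
  "pd 2 (H_germ k) = (\<lambda>z. vector [0, slope k z, 3 * (z $ 2)\<^sup>2])"
  by (simp_all add: fun_eq_iff dir_deriv_eqI[OF H_has_derivative] axis_component slope_def)

lemma pd_pd_H:
  "pd 1 (pd 1 (H_germ k)) z = 0"
  "pd 2 (pd 1 (H_germ k)) z = vector [0, 1, 0]"
  "pd 2 (pd 2 (H_germ k)) z =
     vector [0, real (3 * k - 1) * real (3 * k - 2) * (z $ 2) ^ (3 * k - 3), 6 * z $ 2]"
proof -
  have 1: "(pd 1 (H_germ k) has_derivative (\<lambda>v. vector [0, v $ 2, 0])) (at z)"
    unfolding pd_H vector_3_eq
    by (rule has_derivative_eq_rhs, (rule derivative_eq_intros refl bounded_linear.has_derivative[OF bounded_linear_vec_nth])+)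
      simp
  show "pd 1 (pd 1 (H_germ k)) z = 0" "pd 2 (pd 1 (H_germ k)) z = vector [0, 1, 0]"
    by (simp_all add: dir_deriv_eqI[OF 1] axis_component vector_3_eq)
  have 2: "(pd 2 (H_germ k) has_derivative (\<lambda>v. vector [0,
      v $ 1 + v $ 2 * (real (3 * k - 1) * real (3 * k - 2) * (z $ 2) ^ (3 * k - 3)), v $ 2 * (6 * z $ 2)])) (at z)"
    unfolding pd_H slope_def vector_3_eq
    by (rule has_derivative_eq_rhs, (rule derivative_eq_intros refl bounded_linear.has_derivative[OF bounded_linear_vec_nth])+)
      (simp add: fun_eq_iff vec_eq_iff forall_3 algebra_simps numeral_3_eq_3)
  show "pd 2 (pd 2 (H_germ k)) z =
     vector [0, real (3 * k - 1) * real (3 * k - 2) * (z $ 2) ^ (3 * k - 3), 6 * z $ 2]"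
    by (simp add: dir_deriv_eqI[OF 2] axis_component)
qed

text \<open>The normal vector \<open>n\<close> is orthogonal to the first derivatives of \<open>F\<close>, so the second derivatives of \<open>\<phi>\<close> drop
  out and the second fundamental form changes by congruence with \<open>D\<phi>\<close>, besides the factor \<open>det D\<phi>\<close> coming
  from \<open>n\<close>.\<close>

lemma parabolic_fun_reparametrize:
  fixes F :: "real^2 \<Rightarrow> real^3" and \<phi> :: "real^2 \<Rightarrow> real^2"
  assumes F: "smooth_germ F" and \<phi>: "smooth_germ \<phi>" "\<phi> 0 = 0"
  shows "\<forall>\<^sub>F p in nhds 0. parabolic_fun (\<lambda>p. F (\<phi> p)) p =
    (pd 1 \<phi> p $ 1 * pd 2 \<phi> p $ 2 - pd 2 \<phi> p $ 1 * pd 1 \<phi> p $ 2) ^ 4 * parabolic_fun F (\<phi> p)"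
  using chain_rule[OF F \<phi>, of "axis 1 1"] chain_rule[OF F \<phi>, of "axis 2 1"]
    chain_rule_2[OF F \<phi>, of "axis 1 1" "axis 1 1"] chain_rule_2[OF F \<phi>, of "axis 2 1" "axis 1 1"]
    chain_rule_2[OF F \<phi>, of "axis 2 1" "axis 2 1"] eventually_nhds_0_compose[OF \<phi> pd_commute[OF F, of 1 2]]
proof eventually_elim
  case (elim p)
  define a1 a2 b1 b2 where ab: "a1 = pd 1 \<phi> p $ 1" "a2 = pd 1 \<phi> p $ 2" "b1 = pd 2 \<phi> p $ 1" "b2 = pd 2 \<phi> p $ 2"
  define F1 F2 where F12: "F1 = pd 1 F (\<phi> p)" "F2 = pd 2 F (\<phi> p)"
  define n where "n = cross3 F1 F2"
  define L M N where LMN: "L = n \<bullet> pd 1 (pd 1 F) (\<phi> p)" "M = n \<bullet> pd 2 (pd 1 F) (\<phi> p)" "N = n \<bullet> pd 2 (pd 2 F) (\<phi> p)"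
  have nF: "n \<bullet> F1 = 0" "n \<bullet> F2 = 0" by (simp_all add: n_def dot_cross_self)
  have c: "cross3 (pd 1 (\<lambda>p. F (\<phi> p)) p) (pd 2 (\<lambda>p. F (\<phi> p)) p) = (a1 * b2 - b1 * a2) *\<^sub>R n"
    unfolding elim(1,2) n_def ab[symmetric] F12[symmetric] sum_2
    by (simp add: cross3_simps)
  have d: "n \<bullet> pd 1 (pd 1 (\<lambda>p. F (\<phi> p))) p = a1 * a1 * L + 2 * (a1 * a2) * M + a2 * a2 * N"
    "n \<bullet> pd 2 (pd 1 (\<lambda>p. F (\<phi> p))) p = a1 * b1 * L + (a1 * b2 + a2 * b1) * M + a2 * b2 * N"
    "n \<bullet> pd 2 (pd 2 (\<lambda>p. F (\<phi> p))) p = b1 * b1 * L + 2 * (b1 * b2) * M + b2 * b2 * N"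
    unfolding elim(3,4,5) sum_2 elim(6) ab[symmetric] F12[symmetric] LMN
    by (simp_all only: inner_add_right inner_scaleR_right nF) (simp_all add: algebra_simps)
  show ?case
    unfolding parabolic_fun_def Let_def partial_deriv_eq c inner_scaleR_left d
    unfolding F12[symmetric] n_def[symmetric] LMN[symmetric] ab[symmetric]
    by (simp add: algebra_simps power2_eq_square power4_eq_xxxx)
qed

text \<open>A surface germ brought to the model germ: \<open>\<phi>\<close> is the source diffeomorphism and \<open>\<Psi>\<close> the inverse of the target
  diffeomorphism. Of their invertibility only the Jacobian determinants at 0 are recorded.\<close>

locale H_chart =
  fixes k :: nat and \<phi> :: "real^2 \<Rightarrow> real^2" and \<Psi> :: "real^3 \<Rightarrow> real^3" and f :: "real^2 \<Rightarrow> real^3"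
  assumes k: "k \<ge> 2"
    and \<phi>: "smooth_germ \<phi>" "\<phi> 0 = 0"
    and J0: "pd 1 \<phi> 0 $ 1 * pd 2 \<phi> 0 $ 2 - pd 2 \<phi> 0 $ 1 * pd 1 \<phi> 0 $ 2 \<noteq> 0"
    and \<Psi>: "smooth_germ \<Psi>" "\<Psi> 0 = 0"
    and \<Delta>0: "cross3 (pd 1 \<Psi> 0) (pd 2 \<Psi> 0) \<bullet> pd 3 \<Psi> 0 \<noteq> 0"
    and f_eq: "\<forall>\<^sub>F p in nhds 0. f p = \<Psi> (H_germ k (\<phi> p))"

lemma diffeo_germ_sym:
  assumes "diffeo_germ \<phi> \<phi>i"
  shows "diffeo_germ \<phi>i \<phi>"
proof -
  from assms obtain U V where *: "\<phi> 0 = 0" "open U" "0 \<in> U" "open V" "homeomorphism U V \<phi> \<phi>i"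
    "smooth_on U \<phi>" "smooth_on V \<phi>i" unfolding diffeo_germ_def by blast
  then have "0 \<in> V" "\<phi>i 0 = 0" by (force simp: homeomorphism_def)+
  with * homeomorphism_symD[OF *(5)] show ?thesis unfolding diffeo_germ_def by blast
qed

lemma diffeo_germ_dir_deriv_inj:
  fixes \<phi> :: "'a::euclidean_space \<Rightarrow> 'a"
  assumes "diffeo_germ \<phi> \<phi>i"
  shows "inj (\<lambda>v. dir_deriv v \<phi> 0)"
proof -
  note d = diffeo_germD[OF assms]
  have "(\<phi>i has_derivative (\<lambda>v. dir_deriv v \<phi>i 0)) (at (\<phi> 0))"
    using smooth_germ_has_dir_deriv_0[OF d(2)] d(3) by simp
  from has_derivative_compose[OF smooth_germ_has_dir_deriv_0[OF d(1)] this]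
  have "dir_deriv v (\<lambda>x. \<phi>i (\<phi> x)) 0 = dir_deriv (dir_deriv v \<phi> 0) \<phi>i 0" for v
    by (rule dir_deriv_eqI)
  moreover have "dir_deriv v (\<lambda>x. \<phi>i (\<phi> x)) 0 = v" for v
    unfolding dir_deriv_cong[OF d(5)] using dir_deriv_eqI[OF has_derivative_ident] .
  ultimately have "dir_deriv (dir_deriv v \<phi> 0) \<phi>i 0 = v" for v by simp
  then show ?thesis by (rule inj_on_inverseI)
qed

lemma A_equivalent_H_chart:
  assumes "k \<ge> 2" and f: "smooth_germ f" "f 0 = 0" and "A_equivalent f (H_germ k)"
  obtains \<phi> \<Psi> where "H_chart k \<phi> \<Psi> f"
proof -
  from assms(4) obtain \<phi> \<phi>i \<Phi> \<Psi> where d: "diffeo_germ \<phi> \<phi>i" "diffeo_germ \<Phi> \<Psi>"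
    and eq: "\<forall>\<^sub>F x in nhds 0. H_germ k x = \<Phi> (f (\<phi>i x))" unfolding A_equivalent_def by blast
  note \<phi> = diffeo_germD[OF d(1)] and \<Phi> = diffeo_germD[OF d(2)]
  note inj = diffeo_germ_dir_deriv_inj[OF d(1)] diffeo_germ_dir_deriv_inj[OF diffeo_germ_sym[OF d(2)]]
  have lin: "linear (\<lambda>v. dir_deriv v \<phi> 0)" "linear (\<lambda>v. dir_deriv v \<Psi> 0)"
    using linear_dir_deriv smooth_germ_differentiable \<phi>(1) \<Phi>(2) by blast+
  have "det (matrix (\<lambda>v. dir_deriv v \<phi> 0)) \<noteq> 0" "det (matrix (\<lambda>v. dir_deriv v \<Psi> 0)) \<noteq> 0"
    using det_nz_iff_inj[OF lin(1)] det_nz_iff_inj[OF lin(2)] inj by simp_all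
  moreover have "det (matrix (\<lambda>v. dir_deriv v \<phi> 0)) = pd 1 \<phi> 0 $ 1 * pd 2 \<phi> 0 $ 2 - pd 2 \<phi> 0 $ 1 * pd 1 \<phi> 0 $ 2"
    by (simp add: matrix_def det_2)
  moreover have "det (matrix (\<lambda>v. dir_deriv v \<Psi> 0)) = cross3 (pd 1 \<Psi> 0) (pd 2 \<Psi> 0) \<bullet> pd 3 \<Psi> 0"
    by (simp add: matrix_def det_3 cross3_def inner_vec_def sum_3) (simp add: algebra_simps)
  ultimately have "pd 1 \<phi> 0 $ 1 * pd 2 \<phi> 0 $ 2 - pd 2 \<phi> 0 $ 1 * pd 1 \<phi> 0 $ 2 \<noteq> 0"
    "cross3 (pd 1 \<Psi> 0) (pd 2 \<Psi> 0) \<bullet> pd 3 \<Psi> 0 \<noteq> 0"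
    by simp_all
  moreover have "\<forall>\<^sub>F p in nhds 0. f p = \<Psi> (H_germ k (\<phi> p))"
    using eventually_nhds_0_compose[OF \<phi>(1,3) eq] \<phi>(5)
      eventually_nhds_0_compose[OF f \<Phi>(5)]
    by eventually_elim simp
  ultimately have "H_chart k \<phi> \<Psi> f" using assms(1) \<phi> \<Phi> by unfold_locales auto
  then show ?thesis by (rule that)
qed

context H_chart begin

text \<open>The surface in the source coordinates of the model germ.\<close>

definition F :: "real^2 \<Rightarrow> real^3" where "F = (\<lambda>z. \<Psi> (H_germ k z))"

lemma H0: "H_germ k 0 = 0" using k by (simp add: H_germ_0)

lemma smooth_F: "smooth_germ F"
  unfolding F_def by (rule smooth_germ_compose[OF \<Psi>(1) smooth_germ_H H0])

lemma f_eq_F: "\<forall>\<^sub>F p in nhds 0. f p = F (\<phi> p)" using f_eq by (simp add: F_def)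

lemma pd_F:
  "\<forall>\<^sub>F z in nhds 0. pd 1 F z = pd 1 \<Psi> (H_germ k z) + (z $ 2) *\<^sub>R pd 2 \<Psi> (H_germ k z)"
  "\<forall>\<^sub>F z in nhds 0. pd 2 F z = slope k z *\<^sub>R pd 2 \<Psi> (H_germ k z) + (3 * (z $ 2)\<^sup>2) *\<^sub>R pd 3 \<Psi> (H_germ k z)"
  using chain_rule[OF \<Psi>(1) smooth_germ_H H0, of "axis 1 1"] chain_rule[OF \<Psi>(1) smooth_germ_H H0, of "axis 2 1"]
  by (simp_all add: F_def sum_3 pd_H)

lemma pd_pd_F:
  "\<forall>\<^sub>F z in nhds 0. pd 1 (pd 1 F) z = pd 1 (pd 1 \<Psi>) (H_germ k z) + (z $ 2) *\<^sub>R pd 2 (pd 1 \<Psi>) (H_germ k z)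
     + (z $ 2) *\<^sub>R (pd 1 (pd 2 \<Psi>) (H_germ k z) + (z $ 2) *\<^sub>R pd 2 (pd 2 \<Psi>) (H_germ k z))"
  "\<forall>\<^sub>F z in nhds 0. pd 2 (pd 1 F) z = pd 2 \<Psi> (H_germ k z)
     + (slope k z *\<^sub>R pd 2 (pd 1 \<Psi>) (H_germ k z) + (3 * (z $ 2)\<^sup>2) *\<^sub>R pd 3 (pd 1 \<Psi>) (H_germ k z))
     + (z $ 2) *\<^sub>R (slope k z *\<^sub>R pd 2 (pd 2 \<Psi>) (H_germ k z) + (3 * (z $ 2)\<^sup>2) *\<^sub>R pd 3 (pd 2 \<Psi>) (H_germ k z))"
  "\<forall>\<^sub>F z in nhds 0. pd 2 (pd 2 F) z =
     (real (3 * k - 1) * real (3 * k - 2) * (z $ 2) ^ (3 * k - 3)) *\<^sub>R pd 2 \<Psi> (H_germ k z) + (6 * z $ 2) *\<^sub>R pd 3 \<Psi> (H_germ k z)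
     + slope k z *\<^sub>R (slope k z *\<^sub>R pd 2 (pd 2 \<Psi>) (H_germ k z) + (3 * (z $ 2)\<^sup>2) *\<^sub>R pd 3 (pd 2 \<Psi>) (H_germ k z))
     + (3 * (z $ 2)\<^sup>2) *\<^sub>R (slope k z *\<^sub>R pd 2 (pd 3 \<Psi>) (H_germ k z) + (3 * (z $ 2)\<^sup>2) *\<^sub>R pd 3 (pd 3 \<Psi>) (H_germ k z))"
  using chain_rule_2[OF \<Psi>(1) smooth_germ_H H0, of "axis 1 1" "axis 1 1"]
    chain_rule_2[OF \<Psi>(1) smooth_germ_H H0, of "axis 2 1" "axis 1 1"]
    chain_rule_2[OF \<Psi>(1) smooth_germ_H H0, of "axis 2 1" "axis 2 1"]
  by (simp_all add: F_def sum_3 pd_H pd_pd_H[unfolded pd_H] add_ac)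

end

section \<open>The parabolic set\<close>

context H_chart begin

text \<open>The determinants of \<open>\<Psi>\<^sub>1, \<Psi>\<^sub>2, \<Psi>\<^sub>1\<^sub>1\<close> and of \<open>\<Psi>\<^sub>1, \<Psi>\<^sub>2, \<Psi>\<^sub>3\<close> at 0. The first one vanishes exactly if the two
  quadratic forms of \<open>f\<close> in the normal plane are linearly dependent; the second one is the Jacobian
  determinant of \<open>\<Psi>\<close>.\<close>

abbreviation inflection_det :: real where "inflection_det \<equiv> cross3 (pd 1 \<Psi> 0) (pd 2 \<Psi> 0) \<bullet> pd 1 (pd 1 \<Psi>) 0"
abbreviation \<Delta> :: real where "\<Delta> \<equiv> cross3 (pd 1 \<Psi> 0) (pd 2 \<Psi> 0) \<bullet> pd 3 \<Psi> 0"

lemma tendsto_cross3: "(a \<longlongrightarrow> x) G \<Longrightarrow> (b \<longlongrightarrow> y) G \<Longrightarrow> ((\<lambda>t. cross3 (a t) (b t)) \<longlongrightarrow> cross3 x y) G"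
  using bounded_bilinear.tendsto[of cross3] bilinear_cross by (simp add: bilinear_conv_bounded_bilinear)

lemma tendsto_along:
  assumes "(\<beta> \<longlongrightarrow> 0) G" "smooth_germ g"
  shows "((\<lambda>t. g (H_germ k (\<beta> t))) \<longlongrightarrow> g 0) G"
proof -
  have "((\<lambda>t. H_germ k (\<beta> t)) \<longlongrightarrow> 0) G"
    using isCont_tendsto_compose[OF smooth_germ_isCont[OF smooth_germ_H[of k]] assms(1)] H0 by simp
  then show ?thesis using isCont_tendsto_compose[OF smooth_germ_isCont[OF assms(2)]] by blast
qed

lemma cross3_triple:
  fixes a b c :: "real^3"
  shows "cross3 (a + y *\<^sub>R b) (s *\<^sub>R b + w *\<^sub>R c) \<bullet> b = - w * (cross3 a b \<bullet> c)"
    "cross3 (a + y *\<^sub>R b) (s *\<^sub>R b + w *\<^sub>R c) \<bullet> c = s * (cross3 a b \<bullet> c)"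
  by (simp_all add: cross3_simps)

text \<open>For these orders of \<open>y\<close> and the slope \<open>s\<close> the monomial \<open>y s\<^sup>2\<close> dominates: with the normal vector written as \<open>s n\<close>, the
  parabolic function equals \<open>y s\<^sup>2 ((n \<bullet> E) N - (s\<^sup>2 / y) M\<^sup>2)\<close>, and the bracket tends to \<open>6 \<Delta>\<close> times the inflection
  determinant. All auxiliary functions of the proof are the original ones divided by suitable powers of
  \<open>y\<close> and \<open>s\<close>, chosen so that they stay bounded.\<close>

lemma parabolic_fun_off_branches:
  fixes \<beta> :: "'t \<Rightarrow> real^2"
  assumes q: "inflection_det \<noteq> 0" and \<beta>: "(\<beta> \<longlongrightarrow> 0) G"
    and nz: "\<forall>\<^sub>F t in G. \<beta> t $ 2 \<noteq> 0" "\<forall>\<^sub>F t in G. slope k (\<beta> t) \<noteq> 0"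
    and r: "((\<lambda>t. \<beta> t $ 2 / slope k (\<beta> t)) \<longlongrightarrow> r) G"
    and sy: "((\<lambda>t. (slope k (\<beta> t))\<^sup>2 / \<beta> t $ 2) \<longlongrightarrow> 0) G"
  shows "\<forall>\<^sub>F t in G. parabolic_fun F (\<beta> t) \<noteq> 0"
proof -
  define y where "y = (\<lambda>t. \<beta> t $ 2)"
  define s where "s = (\<lambda>t. slope k (\<beta> t))"
  define R where "R = (\<lambda>t. y t / s t)"
  define S where "S = (\<lambda>t. (s t)\<^sup>2 / y t)"
  have y: "(y \<longlongrightarrow> 0) G" unfolding y_def using tendsto_vec_nth[OF \<beta>, of 2] by simp
  have x: "((\<lambda>t. \<beta> t $ 1) \<longlongrightarrow> 0) G" using tendsto_vec_nth[OF \<beta>, of 1] by simp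
  have k2: "3 * k - 2 > 0" "3 * k - 3 > 0" using k by auto
  have s: "(s \<longlongrightarrow> 0) G"
    unfolding s_def slope_def using x y[unfolded y_def] k2
    by (intro tendsto_eq_rhs[OF tendsto_add[OF _ tendsto_mult[OF tendsto_const tendsto_power]]]) (auto simp: power_0_left)
  have R: "(R \<longlongrightarrow> r) G" and S: "(S \<longlongrightarrow> 0) G" using r sy by (simp_all add: R_def S_def y_def s_def)
  define A where "A = (\<lambda>a t. pd a \<Psi> (H_germ k (\<beta> t)))"
  define B where "B = (\<lambda>a b t. pd a (pd b \<Psi>) (H_germ k (\<beta> t)))"
  have A: "(A a \<longlongrightarrow> pd a \<Psi> 0) G" and B: "(B a b \<longlongrightarrow> pd a (pd b \<Psi>) 0) G" for a b
    unfolding A_def B_def by (intro tendsto_along \<beta> smooth_germ_dir_deriv \<Psi>)+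
  define n where "n = (\<lambda>t. cross3 (A 1 t + y t *\<^sub>R A 2 t) (1 *\<^sub>R A 2 t + (3 * y t * R t) *\<^sub>R A 3 t))"
  define D where "D = (\<lambda>t. cross3 (A 1 t) (A 2 t) \<bullet> A 3 t)"
  define E where "E = (\<lambda>t. B 1 1 t + y t *\<^sub>R B 2 1 t + y t *\<^sub>R (B 1 2 t + y t *\<^sub>R B 2 2 t))"
  define W where "W = (\<lambda>t. (B 2 1 t + (3 * y t * R t) *\<^sub>R B 3 1 t) + y t *\<^sub>R (B 2 2 t + (3 * y t * R t) *\<^sub>R B 3 2 t))"
  define c where "c = real (3 * k - 1) * real (3 * k - 2)"
  define V where "V = (\<lambda>t. S t *\<^sub>R (B 2 2 t + (3 * y t * R t) *\<^sub>R B 3 2 t)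
      + (3 * y t * s t) *\<^sub>R (B 2 3 t + (3 * y t * R t) *\<^sub>R B 3 3 t))"
  define N where "N = (\<lambda>t. - 3 * c * y t ^ (3 * k - 3) * R t * D t + 6 * D t + n t \<bullet> V t)"
  define M where "M = (\<lambda>t. - 3 * (R t)\<^sup>2 * D t + n t \<bullet> W t)"
  have n: "(n \<longlongrightarrow> cross3 (pd 1 \<Psi> 0) (pd 2 \<Psi> 0)) G"
    unfolding n_def by (rule tendsto_eq_rhs, (rule tendsto_cross3 tendsto_intros A y R)+) simp
  have D: "(D \<longlongrightarrow> \<Delta>) G" unfolding D_def by (intro tendsto_intros tendsto_cross3 A)
  have E: "(E \<longlongrightarrow> pd 1 (pd 1 \<Psi>) 0) G"
    unfolding E_def by (rule tendsto_eq_rhs, (rule tendsto_intros B y)+) simp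
  have "\<exists>l. (W \<longlongrightarrow> l) G" unfolding W_def by (rule exI, (rule tendsto_intros B y R)+)
  then obtain w where W: "(W \<longlongrightarrow> w) G" by blast
  have V: "(V \<longlongrightarrow> 0) G"
    unfolding V_def by (rule tendsto_eq_rhs, (rule tendsto_intros B y R s S)+) simp
  have N: "(N \<longlongrightarrow> 6 * \<Delta>) G"
    unfolding N_def by (rule tendsto_eq_rhs, (rule tendsto_intros n V y R D)+) (use k2 in \<open>simp add: power_0_left\<close>)
  have "\<exists>l. (M \<longlongrightarrow> l) G" unfolding M_def by (rule exI, (rule tendsto_intros n W R D)+)
  then obtain m where M: "(M \<longlongrightarrow> m) G" by blast
  have "((\<lambda>t. (n t \<bullet> E t) * N t - S t * (M t)\<^sup>2) \<longlongrightarrow> inflection_det * (6 * \<Delta>)) G"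
    by (rule tendsto_eq_rhs, (rule tendsto_intros n E N S M)+) simp
  then have nonzero: "\<forall>\<^sub>F t in G. (n t \<bullet> E t) * N t - S t * (M t)\<^sup>2 \<noteq> 0"
    by (rule tendsto_imp_eventually_ne) (use q \<Delta>0 in simp)
  have ev: "\<forall>\<^sub>F z in nhds 0. P z \<Longrightarrow> \<forall>\<^sub>F t in G. P (\<beta> t)" for P
    using \<beta> by (auto simp: filterlim_iff)
  show ?thesis
    using nonzero nz ev[OF pd_F(1)] ev[OF pd_F(2)] ev[OF pd_pd_F(1)] ev[OF pd_pd_F(2)] ev[OF pd_pd_F(3)]
  proof eventually_elim
    case (elim t)
    have abbr: "\<And>a. pd a \<Psi> (H_germ k (\<beta> t)) = A a t" "\<And>a b. pd a (pd b \<Psi>) (H_germ k (\<beta> t)) = B a b t"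
      "\<beta> t $ 2 = y t" "slope k (\<beta> t) = s t" "real (3 * k - 1) * real (3 * k - 2) = c"
      by (simp_all add: A_def B_def y_def s_def c_def)
    have s0: "s t \<noteq> 0" and y0: "y t \<noteq> 0" using elim by (simp_all add: s_def y_def)
    have y2: "3 * (y t)\<^sup>2 = s t * (3 * y t * R t)" using s0 by (simp add: R_def power2_eq_square)
    have n1: "cross3 (pd 1 F (\<beta> t)) (pd 2 F (\<beta> t)) = cross3 (A 1 t + y t *\<^sub>R A 2 t) (s t *\<^sub>R A 2 t + (3 * (y t)\<^sup>2) *\<^sub>R A 3 t)"
      unfolding elim(4,5) A_def y_def s_def ..
    have n2: "cross3 (A 1 t + y t *\<^sub>R A 2 t) (s t *\<^sub>R A 2 t + (3 * (y t)\<^sup>2) *\<^sub>R A 3 t) = s t *\<^sub>R n t"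
      unfolding y2 n_def cross_mult_right[symmetric] by (simp add: scaleR_add_right)
    have L: "s t *\<^sub>R n t \<bullet> pd 1 (pd 1 F) (\<beta> t) = s t * (n t \<bullet> E t)"
      unfolding elim(6) E_def B_def y_def by simp
    have nA: "s t * (n t \<bullet> A 2 t) = - (3 * (y t)\<^sup>2) * D t" "n t \<bullet> A 3 t = D t"
    proof -
      show "n t \<bullet> A 3 t = D t" unfolding n_def D_def cross3_triple(2) by simp
      show "s t * (n t \<bullet> A 2 t) = - (3 * (y t)\<^sup>2) * D t" unfolding y2 n_def D_def cross3_triple(1) by simp
    qed
    have F21: "pd 2 (pd 1 F) (\<beta> t) = A 2 t + s t *\<^sub>R W t"
      unfolding elim(7) abbr W_def
      unfolding y2 by (simp add: algebra_simps)
    have M': "s t *\<^sub>R n t \<bullet> pd 2 (pd 1 F) (\<beta> t) = (s t)\<^sup>2 * M t"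
    proof -
      have "(s t)\<^sup>2 * (- 3 * (R t)\<^sup>2 * D t) = s t * (n t \<bullet> A 2 t)"
        unfolding nA using s0 by (simp add: R_def power_divide)
      then show ?thesis
        unfolding F21 M_def by (simp add: inner_add_right power2_eq_square algebra_simps)
    qed
    have F22: "pd 2 (pd 2 F) (\<beta> t) = (c * y t ^ (3 * k - 3)) *\<^sub>R A 2 t + (6 * y t) *\<^sub>R A 3 t + y t *\<^sub>R V t"
    proof -
      have yS: "s t * s t = y t * S t" using y0 by (simp add: S_def power2_eq_square)
      have in2: "s t *\<^sub>R X + (3 * (y t)\<^sup>2) *\<^sub>R Y = s t *\<^sub>R (X + (3 * y t * R t) *\<^sub>R Y)" for X Y :: "real^3"
        unfolding y2 by (simp add: scaleR_add_right)
      show ?thesis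
        unfolding elim(8) abbr V_def in2 scaleR_scaleR yS
        by (simp add: scaleR_add_right power2_eq_square mult.assoc mult.left_commute)
    qed
    have N': "s t *\<^sub>R n t \<bullet> pd 2 (pd 2 F) (\<beta> t) = (y t * s t) * N t"
    proof -
      have "s t *\<^sub>R n t \<bullet> pd 2 (pd 2 F) (\<beta> t) =
        c * y t ^ (3 * k - 3) * (s t * (n t \<bullet> A 2 t)) + 6 * y t * s t * (n t \<bullet> A 3 t) + y t * s t * (n t \<bullet> V t)"
        unfolding F22 by (simp add: inner_add_right algebra_simps)
      then show ?thesis unfolding nA N_def using s0 by (simp add: R_def power2_eq_square algebra_simps)
    qed
    have "parabolic_fun F (\<beta> t) = y t * (s t)\<^sup>2 * ((n t \<bullet> E t) * N t - S t * (M t)\<^sup>2)"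
      unfolding parabolic_fun_def Let_def partial_deriv_eq n1 n2 L M' N'
      using y0 by (simp add: S_def power2_eq_square algebra_simps)
    then show ?case using s0 y0 elim(1) by simp
  qed
qed

text \<open>If \<open>s = O(y\<^sup>2)\<close>, the square of the mixed coefficient dominates: the normal vector is \<open>y\<^sup>2 n\<close> with a bounded \<open>n\<close>,
  and the parabolic function divided by \<open>y\<^sup>4\<close> tends to \<open>- (3 \<Delta>)\<^sup>2\<close>.\<close>

lemma parabolic_fun_tangent_to_axis:
  fixes \<beta> :: "'t \<Rightarrow> real^2"
  assumes \<beta>: "(\<beta> \<longlongrightarrow> 0) G"
    and nz: "\<forall>\<^sub>F t in G. \<beta> t $ 2 \<noteq> 0"
    and r: "((\<lambda>t. slope k (\<beta> t) / (\<beta> t $ 2)\<^sup>2) \<longlongrightarrow> r) G"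
  shows "\<forall>\<^sub>F t in G. parabolic_fun F (\<beta> t) \<noteq> 0"
proof -
  define y where "y = (\<lambda>t. \<beta> t $ 2)"
  define s where "s = (\<lambda>t. slope k (\<beta> t))"
  define R where "R = (\<lambda>t. s t / (y t)\<^sup>2)"
  have y: "(y \<longlongrightarrow> 0) G" unfolding y_def using tendsto_vec_nth[OF \<beta>, of 2] by simp
  have R: "(R \<longlongrightarrow> r) G" using r by (simp add: R_def y_def s_def)
  define A where "A = (\<lambda>a t. pd a \<Psi> (H_germ k (\<beta> t)))"
  define B where "B = (\<lambda>a b t. pd a (pd b \<Psi>) (H_germ k (\<beta> t)))"
  have A: "(A a \<longlongrightarrow> pd a \<Psi> 0) G" and B: "(B a b \<longlongrightarrow> pd a (pd b \<Psi>) 0) G" for a b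
    unfolding A_def B_def by (intro tendsto_along \<beta> smooth_germ_dir_deriv \<Psi>)+
  define n where "n = (\<lambda>t. cross3 (A 1 t + y t *\<^sub>R A 2 t) (R t *\<^sub>R A 2 t + 3 *\<^sub>R A 3 t))"
  define D where "D = (\<lambda>t. cross3 (A 1 t) (A 2 t) \<bullet> A 3 t)"
  define E where "E = (\<lambda>t. B 1 1 t + y t *\<^sub>R B 2 1 t + y t *\<^sub>R (B 1 2 t + y t *\<^sub>R B 2 2 t))"
  define W where "W = (\<lambda>t. (R t *\<^sub>R B 2 1 t + 3 *\<^sub>R B 3 1 t) + y t *\<^sub>R (R t *\<^sub>R B 2 2 t + 3 *\<^sub>R B 3 2 t))"
  define c where "c = real (3 * k - 1) * real (3 * k - 2)"
  define V where "V = (\<lambda>t. (c * y t ^ (3 * k - 4)) *\<^sub>R A 2 t + 6 *\<^sub>R A 3 t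
      + (y t ^ 3) *\<^sub>R (R t *\<^sub>R (R t *\<^sub>R B 2 2 t + 3 *\<^sub>R B 3 2 t) + 3 *\<^sub>R (R t *\<^sub>R B 2 3 t + 3 *\<^sub>R B 3 3 t)))"
  have "\<exists>l. (n \<longlongrightarrow> l) G" unfolding n_def by (rule exI, (rule tendsto_cross3 tendsto_intros A y R)+)
  then obtain n0 where n: "(n \<longlongrightarrow> n0) G" by blast
  have D: "(D \<longlongrightarrow> \<Delta>) G" unfolding D_def by (intro tendsto_intros tendsto_cross3 A)
  have "\<exists>l. (E \<longlongrightarrow> l) G" unfolding E_def by (rule exI, (rule tendsto_intros B y)+)
  then obtain e0 where E: "(E \<longlongrightarrow> e0) G" by blast
  have "\<exists>l. (W \<longlongrightarrow> l) G" unfolding W_def by (rule exI, (rule tendsto_intros B y R)+)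
  then obtain w0 where W: "(W \<longlongrightarrow> w0) G" by blast
  have "\<exists>l. (V \<longlongrightarrow> l) G" unfolding V_def by (rule exI, (rule tendsto_intros A B y R)+)
  then obtain v0 where V: "(V \<longlongrightarrow> v0) G" by blast
  have "((\<lambda>t. y t * ((n t \<bullet> E t) * (n t \<bullet> V t)) - (- 3 * D t + (y t)\<^sup>2 * (n t \<bullet> W t))\<^sup>2) \<longlongrightarrow> - (3 * \<Delta>)\<^sup>2) G"
    by (rule tendsto_eq_rhs, (rule tendsto_intros n E W V D y)+) (simp add: power2_eq_square)
  then have nonzero: "\<forall>\<^sub>F t in G. y t * ((n t \<bullet> E t) * (n t \<bullet> V t)) - (- 3 * D t + (y t)\<^sup>2 * (n t \<bullet> W t))\<^sup>2 \<noteq> 0"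
    by (rule tendsto_imp_eventually_ne) (use \<Delta>0 in simp)
  have ev: "\<forall>\<^sub>F z in nhds 0. P z \<Longrightarrow> \<forall>\<^sub>F t in G. P (\<beta> t)" for P
    using \<beta> by (auto simp: filterlim_iff)
  show ?thesis
    using nonzero nz ev[OF pd_F(1)] ev[OF pd_F(2)] ev[OF pd_pd_F(1)] ev[OF pd_pd_F(2)] ev[OF pd_pd_F(3)]
  proof eventually_elim
    case (elim t)
    have abbr: "\<And>a. pd a \<Psi> (H_germ k (\<beta> t)) = A a t" "\<And>a b. pd a (pd b \<Psi>) (H_germ k (\<beta> t)) = B a b t"
      "\<beta> t $ 2 = y t" "slope k (\<beta> t) = s t" "real (3 * k - 1) * real (3 * k - 2) = c"
      by (simp_all add: A_def B_def y_def s_def c_def)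
    have y0: "y t \<noteq> 0" using elim by (simp_all add: y_def)
    have sR: "s t = (y t)\<^sup>2 * R t" using y0 by (simp add: R_def)
    have y3: "3 * (y t)\<^sup>2 = (y t)\<^sup>2 * 3" by simp
    have n1: "cross3 (pd 1 F (\<beta> t)) (pd 2 F (\<beta> t)) = (y t)\<^sup>2 *\<^sub>R n t"
      unfolding elim(3,4) abbr
      unfolding sR y3 n_def cross_mult_right[symmetric] by (simp add: scaleR_add_right)
    have L: "(y t)\<^sup>2 *\<^sub>R n t \<bullet> pd 1 (pd 1 F) (\<beta> t) = (y t)\<^sup>2 * (n t \<bullet> E t)"
      unfolding elim(5) E_def B_def y_def by simp
    have nA: "n t \<bullet> A 2 t = - 3 * D t"
      unfolding n_def D_def cross3_triple(1) by simp
    have F21: "pd 2 (pd 1 F) (\<beta> t) = A 2 t + (y t)\<^sup>2 *\<^sub>R W t"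
      unfolding elim(6) abbr W_def
      unfolding sR y3 by (simp add: algebra_simps)
    have M: "(y t)\<^sup>2 *\<^sub>R n t \<bullet> pd 2 (pd 1 F) (\<beta> t) = (y t)\<^sup>2 * (- 3 * D t + (y t)\<^sup>2 * (n t \<bullet> W t))"
      unfolding F21 inner_add_right inner_scaleR_left inner_scaleR_right nA by (simp add: algebra_simps)
    have F22: "pd 2 (pd 2 F) (\<beta> t) = y t *\<^sub>R V t"
    proof -
      have "3 * k - 3 = Suc (3 * k - 4)" using k by simp
      then have yk: "c * y t ^ (3 * k - 3) = y t * (c * y t ^ (3 * k - 4))" by simp
      show ?thesis
        unfolding elim(7) abbr V_def
        unfolding sR yk by (simp add: algebra_simps power2_eq_square power3_eq_cube)
    qed
    have "parabolic_fun F (\<beta> t) = y t ^ 4 * (y t * ((n t \<bullet> E t) * (n t \<bullet> V t)) - (- 3 * D t + (y t)\<^sup>2 * (n t \<bullet> W t))\<^sup>2)"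
      unfolding parabolic_fun_def Let_def partial_deriv_eq n1 L M
      unfolding F22 by (simp add: power2_eq_square power4_eq_xxxx algebra_simps)
    then show ?case using y0 elim(1) by simp
  qed
qed

end

section \<open>Inflection points\<close>

text \<open>Expands a vector orthogonal to \<open>u\<close> in the orthonormal frame \<open>e \<times> u\<close>, \<open>e\<close> by computing its double cross product
  with \<open>e \<times> u\<close> in two ways.\<close>

lemma orthonormal_frame_span:
  fixes u e :: "real^3"
  assumes u: "norm u = 1" and e: "norm e = 1" and ue: "u \<bullet> e = 0"
  shows "norm (cross3 e u) = 1" "cross3 e u \<bullet> e = 0"
    "span {cross3 e u, e} = {x. x \<bullet> u = 0}"
proof -
  have uu: "u \<bullet> u = 1" "e \<bullet> e = 1" "e \<bullet> u = 0" using assms by (simp_all add: dot_square_norm inner_commute)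
  have "(norm (cross3 e u))\<^sup>2 = 1" using norm_cross_dot[of e u] u e uu by simp
  then show 1: "norm (cross3 e u) = 1" using power2_eq_1_iff[of "norm (cross3 e u)"] norm_ge_zero[of "cross3 e u"] by linarith
  show 2: "cross3 e u \<bullet> e = 0" by (simp add: dot_cross_self)
  show "span {cross3 e u, e} = {x. x \<bullet> u = 0}"
  proof (intro equalityI subsetI)
    fix x assume "x \<in> span {cross3 e u, e}"
    moreover have "subspace {x. x \<bullet> u = 0}" by (auto simp: subspace_def inner_add_left)
    moreover have "{cross3 e u, e} \<subseteq> {x. x \<bullet> u = 0}" using uu by (simp add: dot_cross_self)
    ultimately show "x \<in> {x. x \<bullet> u = 0}" using span_minimal by blast
  next
    fix x assume "x \<in> {x. x \<bullet> u = 0}"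
    then have xu: "x \<bullet> u = 0" by simp
    define a where "a = cross3 e u"
    have L: "cross3 w (cross3 y z) = (w \<bullet> z) *\<^sub>R y - (w \<bullet> y) *\<^sub>R z" for w y z :: "real^3" by (rule Lagrange)
    have "cross3 x a = - (x \<bullet> e) *\<^sub>R u" unfolding a_def L xu by simp
    moreover have "cross3 u a = e" unfolding a_def L using uu ue by (simp add: inner_commute)
    ultimately have "cross3 (cross3 x a) a = - (x \<bullet> e) *\<^sub>R e" by (simp add: cross_mult_left)
    moreover have "cross3 (cross3 x a) a = (a \<bullet> x) *\<^sub>R a - (a \<bullet> a) *\<^sub>R x"
      by (subst cross_skew) (simp add: L)
    moreover have "a \<bullet> a = 1" using 1 by (simp add: a_def dot_square_norm)
    ultimately have "(a \<bullet> x) *\<^sub>R a + (x \<bullet> e) *\<^sub>R e = x" by (simp add: algebra_simps)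
    moreover have "(a \<bullet> x) *\<^sub>R a + (x \<bullet> e) *\<^sub>R e \<in> span {a, e}"
      by (intro span_add span_scale span_base) auto
    ultimately show "x \<in> span {cross3 e u, e}" by (simp only: a_def)
  qed
qed

context H_chart begin

lemma smooth_f: "smooth_germ f"
proof (rule smooth_germ_cong)
  show "smooth_germ (\<lambda>p. F (\<phi> p))" by (rule smooth_germ_compose[OF smooth_F \<phi>])
  show "\<forall>\<^sub>F p in nhds 0. F (\<phi> p) = f p" using f_eq_F by (rule eventually_mono) simp
qed

text \<open>At the origin only the derivatives \<open>\<Psi>\<^sub>1\<close>, \<open>\<Psi>\<^sub>1\<^sub>1\<close> and \<open>\<Psi>\<^sub>2\<close> survive, since the 2-jet of the model germ is
  \<open>(x, x y, 0)\<close>. The map \<open>K\<close> may be a change of the source coordinates or a curve.\<close>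

lemma F_derivs_0:
  fixes K :: "'a::real_normed_vector \<Rightarrow> real^2"
  assumes K: "smooth_germ K" "K 0 = 0"
  shows "dir_deriv v (\<lambda>p. F (K p)) 0 = (dir_deriv v K 0 $ 1) *\<^sub>R pd 1 \<Psi> 0"
  "dir_deriv u (dir_deriv v (\<lambda>p. F (K p))) 0 = (dir_deriv u (dir_deriv v K) 0 $ 1) *\<^sub>R pd 1 \<Psi> 0
     + (dir_deriv v K 0 $ 1 * dir_deriv u K 0 $ 1) *\<^sub>R pd 1 (pd 1 \<Psi>) 0
     + (dir_deriv v K 0 $ 1 * dir_deriv u K 0 $ 2 + dir_deriv v K 0 $ 2 * dir_deriv u K 0 $ 1) *\<^sub>R pd 2 \<Psi> 0"
proof -
  note 0 = eventually_nhds_x_imp_x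
  have k3: "slope k 0 = 0" "(0::real) ^ (3 * k - 3) = 0" using k by (simp_all add: slope_def power_0_left)
  have d1: "pd 1 F 0 = pd 1 \<Psi> 0" "pd 2 F 0 = 0"
    using 0[OF pd_F(1)] 0[OF pd_F(2)] by (simp_all add: H0 k3)
  have d2: "pd 1 (pd 1 F) 0 = pd 1 (pd 1 \<Psi>) 0" "pd 2 (pd 1 F) 0 = pd 2 \<Psi> 0" "pd 2 (pd 2 F) 0 = 0"
    using 0[OF pd_pd_F(1)] 0[OF pd_pd_F(2)] 0[OF pd_pd_F(3)] by (simp_all add: H0 k3)
  have d3: "pd 1 (pd 2 F) 0 = pd 2 \<Psi> 0" using 0[OF pd_commute[OF smooth_F, of 1 2]] d2 by simp
  show "dir_deriv v (\<lambda>p. F (K p)) 0 = (dir_deriv v K 0 $ 1) *\<^sub>R pd 1 \<Psi> 0"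
    using 0[OF chain_rule[OF smooth_F K, of v]] by (simp add: sum_2 K(2) d1)
  show "dir_deriv u (dir_deriv v (\<lambda>p. F (K p))) 0 = (dir_deriv u (dir_deriv v K) 0 $ 1) *\<^sub>R pd 1 \<Psi> 0
     + (dir_deriv v K 0 $ 1 * dir_deriv u K 0 $ 1) *\<^sub>R pd 1 (pd 1 \<Psi>) 0
     + (dir_deriv v K 0 $ 1 * dir_deriv u K 0 $ 2 + dir_deriv v K 0 $ 2 * dir_deriv u K 0 $ 1) *\<^sub>R pd 2 \<Psi> 0"
    using 0[OF chain_rule_2[OF smooth_F K, of u v]]
    by (simp add: sum_2 K(2) d1 d2 d3 algebra_simps)
qed

lemmas f_derivs_0 = F_derivs_0[OF \<phi>,
  folded dir_deriv_cong[OF f_eq_F] dir_deriv_cong[OF eventually_dir_deriv_cong[OF f_eq_F]]]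

text \<open>The normal plane gets the orthonormal basis \<open>a\<close>, \<open>e\<close> with \<open>e\<close> parallel to \<open>\<Psi>\<^sub>1 \<times> \<Psi>\<^sub>2\<close>. Then \<open>\<Psi>\<^sub>2\<close> has no
  \<open>e\<close>-component, and by assumption \<open>\<Psi>\<^sub>1\<^sub>1\<close> has none either. So the second form vanishes and the first one is
  \<open>x (m y + c x / 2)\<close> with \<open>m \<noteq> 0\<close>, a product of two independent linear forms, hence equivalent to
  \<open>x\<^sup>2 - y\<^sup>2\<close>.\<close>

lemma inflection_point_if_inflection_det_0:
  assumes q0: "inflection_det = 0"
  shows "inflection_point f"
proof -
  define P1 P2 P11 where P: "P1 = pd 1 \<Psi> 0" "P2 = pd 2 \<Psi> 0" "P11 = pd 1 (pd 1 \<Psi>) 0"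
  define a1 a2 b1 b2 where ab: "a1 = pd 1 \<phi> 0 $ 1" "a2 = pd 1 \<phi> 0 $ 2" "b1 = pd 2 \<phi> 0 $ 1" "b2 = pd 2 \<phi> 0 $ 2"
  have J: "a1 * b2 - b1 * a2 \<noteq> 0" using J0 by (simp add: ab)
  have n0: "cross3 P1 P2 \<noteq> 0" using \<Delta>0 by (auto simp: P)
  then have P10: "P1 \<noteq> 0" by auto
  define u where "u = sgn P1"
  define e where "e = sgn (cross3 P1 P2)"
  define a where "a = cross3 e u"
  have ue: "norm u = 1" "norm e = 1" "u \<bullet> e = 0"
    using n0 P10 by (simp_all add: u_def e_def norm_sgn sgn_div_norm dot_cross_self)
  note frame = orthonormal_frame_span[OF ue, folded a_def]
  have aP1: "a \<bullet> P1 = 0" "e \<bullet> P1 = 0" "e \<bullet> P2 = 0" "e \<bullet> P11 = 0"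
    using q0 by (simp_all add: a_def u_def e_def sgn_div_norm cross_mult_right dot_cross_self P)
  define m where "m = P2 \<bullet> a"
  define c where "c = P11 \<bullet> a"
  have m0: "m \<noteq> 0"
  proof -
    have "m = e \<bullet> cross3 u P2" by (simp add: m_def a_def cross3_simps)
    also have "\<dots> = inverse (norm (cross3 P1 P2)) * inverse (norm P1) * (cross3 P1 P2 \<bullet> cross3 P1 P2)"
      by (simp add: e_def u_def sgn_div_norm cross_mult_left)
    finally show ?thesis using n0 P10 by simp
  qed
  have tan: "orthogonal_comp (tangent_line f) = {x. x \<bullet> u = 0}"
  proof -
    have fr: "frechet_derivative f (at 0) v = (dir_deriv v \<phi> 0 $ 1) *\<^sub>R P1" for v
      using f_derivs_0(1)[of v] by (simp add: dir_deriv_def P)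
    have "\<exists>v. dir_deriv v \<phi> 0 $ 1 \<noteq> 0"
    proof (rule ccontr)
      assume "\<not> ?thesis"
      then have "a1 = 0" "b1 = 0" by (simp_all add: ab)
      then show False using J by simp
    qed
    then obtain v where v: "dir_deriv v \<phi> 0 $ 1 \<noteq> 0" ..
    have "(\<forall>w\<in>range (frechet_derivative f (at 0)). orthogonal w x) \<longleftrightarrow> x \<bullet> P1 = 0" for x
      using v by (auto simp: fr orthogonal_def inner_commute)
    moreover have "x \<bullet> u = 0 \<longleftrightarrow> x \<bullet> P1 = 0" for x using P10 by (simp add: u_def sgn_div_norm)
    ultimately show ?thesis unfolding orthogonal_comp_def tangent_line_def by auto
  qed
  define Q where "Q = quadratic_jet (\<lambda>x. vector [f x \<bullet> a, f x \<bullet> e] :: real^2)"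
  have Q: "Q v = vector [(v $ 1 * a1 + v $ 2 * b1) * ((v $ 1 * a2 + v $ 2 * b2) * m + (v $ 1 * a1 + v $ 2 * b1) * c / 2), 0]" for v
  proof -
    define T where "T = (\<lambda>x::real^3. vector [x \<bullet> a, x \<bullet> e] :: real^2)"
    have T: "bounded_linear T"
      unfolding linear_conv_bounded_linear[symmetric]
      by (rule linearI) (simp_all add: T_def vec_eq_iff forall_2 inner_add_left)
    have DT: "\<forall>\<^sub>F p in nhds 0. dir_deriv w (\<lambda>x. T (g x)) p = T (dir_deriv w g p)" if "smooth_germ g" for g :: "real^2 \<Rightarrow> real^3" and w
      using smooth_germ_has_dir_deriv[OF that]
      by eventually_elim (rule dir_deriv_eqI[OF bounded_linear.has_derivative[OF T]])
    have "pd i (pd j (\<lambda>x. T (f x))) 0 = T (pd i (pd j f) 0)" for i j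
      using dir_deriv_cong[OF DT[OF smooth_f, of "axis j 1"], of "axis i 1"]
        eventually_nhds_x_imp_x[OF DT[OF smooth_germ_dir_deriv[OF smooth_f], of "axis i 1" "axis j 1"]] by simp
    then have "Q v = (1/2) *\<^sub>R (\<Sum>i\<in>UNIV. \<Sum>j\<in>UNIV. (v $ i * v $ j) *\<^sub>R T (pd i (pd j f) 0))"
      unfolding Q_def quadratic_jet_def partial_deriv_eq by (simp add: T_def)
    then show ?thesis
      unfolding sum_2 f_derivs_0(2) ab[symmetric] P[symmetric] T_def inner_add_left inner_scaleR_left
      using aP1 by (simp add: vec_eq_iff forall_2 m_def c_def inner_commute[of P1] inner_commute[of _ e] field_simps)
  qed
  (* M is the matrix of the derivative of \<phi>. T maps (w1, w2) to the point (x, y) with x = w1 - w2 and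
     m y + c x / 2 = w1 + w2. *)
  define M where "M = (vector [vector [a1, b1], vector [a2, b2]] :: real^2^2)"
  define T where "T = (vector [vector [1, -1], vector [(1 - c/2) / m, (1 + c/2) / m]] :: real^2^2)"
  have "invertible M" unfolding invertible_det_nz using J by (simp add: M_def det_2)
  then obtain Mi where Mi: "M ** Mi = mat 1" "Mi ** M = mat 1" unfolding invertible_def by blast
  then have "invertible Mi" unfolding invertible_def by blast
  moreover have "invertible T"
    unfolding invertible_det_nz using m0 by (simp add: T_def det_2 field_simps)
  ultimately have iA: "invertible (Mi ** T)" by (rule invertible_mult)
  have "GL2_equivalent Q (\<lambda>x. vector [(x$1)\<^sup>2 + (-1) * (x$2)\<^sup>2, 0])"
    unfolding GL2_equivalent_def
  proof (intro exI conjI allI)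
    show "invertible (Mi ** T)" by fact
    show "invertible (mat 1 :: real^2^2)" by (simp add: invertible_det_nz)
    fix x :: "real^2"
    define v where "v = (Mi ** T) *v x"
    have "M *v v = T *v x"
      unfolding v_def matrix_vector_mul_assoc matrix_mul_assoc Mi(1) by (simp add: matrix_mul_lid)
    moreover have "M *v v = vector [v $ 1 * a1 + v $ 2 * b1, v $ 1 * a2 + v $ 2 * b2]"
      by (simp add: M_def matrix_vector_mult_def vec_eq_iff forall_2 sum_2 mult.commute)
    moreover have "T *v x = vector [x $ 1 - x $ 2, (1 - c/2) / m * x $ 1 + (1 + c/2) / m * x $ 2]"
      by (simp add: T_def matrix_vector_mult_def vec_eq_iff forall_2 sum_2)
    ultimately have v1: "v $ 1 * a1 + v $ 2 * b1 = x $ 1 - x $ 2"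
      and v2: "v $ 1 * a2 + v $ 2 * b2 = (1 - c/2) / m * x $ 1 + (1 + c/2) / m * x $ 2"
      by (simp_all add: vec_eq_iff forall_2)
    have cancel: "(A / m * X + B / m * Y) * m = A * X + B * Y" for A B X Y
      using m0 by (simp add: field_simps)
    have v3: "((1 - c/2) / m * x $ 1 + (1 + c/2) / m * x $ 2) * m + (x $ 1 - x $ 2) * c / 2 = x $ 1 + x $ 2"
      unfolding cancel by (simp add: field_simps)
    show "vector [(x$1)\<^sup>2 + (-1) * (x$2)\<^sup>2, 0] = (mat 1 :: real^2^2) *v Q ((Mi ** T) *v x)"
      unfolding v_def[symmetric] Q v1 v2 v3
      by (simp add: matrix_vector_mul_lid vec_eq_iff forall_2 power2_eq_square algebra_simps)
  qed
  then show ?thesis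
    unfolding inflection_point_def tan
    using frame ue by (intro exI[of _ a] exI[of _ e] conjI bexI[of _ "-1"]) (simp_all add: Q_def)
qed

end

section \<open>Germs of curves\<close>

abbreviation D :: "(real \<Rightarrow> 'a::real_normed_vector) \<Rightarrow> real \<Rightarrow> 'a" where
  "D \<equiv> dir_deriv 1"

text \<open>The derivatives of a curve at \<open>t\<close> depend only on its values near \<open>t\<close>, so a curve that agrees near 0 with a
  smooth germ may be replaced by it.\<close>

lemma curve_deriv_eq_dir_deriv:
  assumes "smooth_germ c" "\<forall>\<^sub>F t in nhds 0. \<gamma> t = c t"
  shows "\<forall>\<^sub>F t in nhds 0. curve_deriv n \<gamma> t = (D ^^ n) c t"
proof (induction n)
  case 0
  then show ?case using assms(2) by (simp add: curve_deriv_def)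
next
  case (Suc n)
  have "smooth_germ ((D ^^ n) c)" by (induction n) (auto intro: assms(1) smooth_germ_dir_deriv)
  from smooth_germ_eventually_differentiable[OF this] Suc.IH
  have "\<forall>\<^sub>F t in nhds 0. ((D ^^ n) c) differentiable (at t) \<and> (\<forall>\<^sub>F s in nhds t. curve_deriv n \<gamma> s = (D ^^ n) c s)"
    by (intro eventually_conj) (simp_all add: eventually_eventually)
  then show ?case
  proof (rule eventually_mono)
    fix t assume t: "((D ^^ n) c) differentiable (at t) \<and> (\<forall>\<^sub>F s in nhds t. curve_deriv n \<gamma> s = (D ^^ n) c s)"
    have "curve_deriv (Suc n) \<gamma> t = vector_derivative (curve_deriv n \<gamma>) (at t)"
      by (simp add: curve_deriv_def)
    also have "\<dots> = vector_derivative ((D ^^ n) c) (at t)"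
      using t by (intro vector_derivative_cong_eq) auto
    also have "\<dots> = (D ^^ Suc n) c t"
      using t by (simp add: dir_deriv_def frechet_derivative_eq_vector_derivative)
    finally show "curve_deriv (Suc n) \<gamma> t = (D ^^ Suc n) c t" .
  qed
qed

lemma divide_by_parameter:
  fixes g :: "real \<Rightarrow> 'b::euclidean_space"
  assumes "smooth_germ g" "g 0 = 0"
  obtains h where "smooth_germ h" "\<forall>\<^sub>F t in nhds 0. g t = t *\<^sub>R h t" "h 0 = D g 0"
proof -
  obtain G where G: "\<And>b. smooth_germ (G b)" "\<forall>\<^sub>F x in nhds 0. g x = g 0 + (\<Sum>b\<in>Basis. (x \<bullet> b) *\<^sub>R G b x)"
    by (rule Hadamard_lemma[OF assms(1)]) (rule that)
  show ?thesis
    by (rule that[of "G 1"]) (use G assms(2) Hadamard_dir_deriv(1)[of G g 1, OF G] in simp_all)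
qed

lemma D_power_scale:
  fixes h :: "real \<Rightarrow> 'b::real_normed_vector"
  assumes "smooth_germ h"
  shows "\<forall>\<^sub>F t in nhds 0. D (\<lambda>t. t ^ Suc n *\<^sub>R h t) t = t ^ n *\<^sub>R (real (Suc n) *\<^sub>R h t + t *\<^sub>R D h t)"
  using smooth_germ_has_dir_deriv[OF assms]
proof eventually_elim
  case (elim t)
  have "((\<lambda>t::real. t ^ Suc n) has_derivative (\<lambda>s. s * (real (Suc n) * t ^ n))) (at t)"
    by (rule has_derivative_eq_rhs[OF has_derivative_power[OF has_derivative_ident]]) (simp add: fun_eq_iff)
  from dir_deriv_eqI[OF has_derivative_scaleR[OF this elim], of 1] show ?case
    by (simp add: algebra_simps)
qed

lemma D_scale:
  fixes h :: "real \<Rightarrow> 'b::real_normed_vector"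
  assumes "smooth_germ h" "\<forall>\<^sub>F t in nhds 0. g t = t *\<^sub>R h t"
  shows "\<forall>\<^sub>F t in nhds 0. D g t = h t + t *\<^sub>R D h t"
  using eventually_dir_deriv_cong[OF assms(2), of 1] D_power_scale[OF assms(1), of 0]
  by eventually_elim simp

text \<open>Leibniz rule for the product with the parameter, at \<open>t = 0\<close>.\<close>

lemma D2_D3_scale:
  fixes h :: "real \<Rightarrow> 'b::real_normed_vector"
  assumes h: "smooth_germ h" and g: "\<forall>\<^sub>F t in nhds 0. g t = t *\<^sub>R h t"
  shows "D (D g) 0 = 2 *\<^sub>R D h 0" "D (D (D g)) 0 = 3 *\<^sub>R D (D h) 0"
proof -
  have D1: "\<forall>\<^sub>F t in nhds 0. D f t + t *\<^sub>R D (D f) t = D (\<lambda>t. t *\<^sub>R D f t) t"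
    and D2: "\<forall>\<^sub>F t in nhds 0. D (\<lambda>t. f t + u t) t = D f t + D u t"
    if f: "smooth_germ f" "smooth_germ u" for f u :: "real \<Rightarrow> 'b"
  proof -
    show "\<forall>\<^sub>F t in nhds 0. D f t + t *\<^sub>R D (D f) t = D (\<lambda>t. t *\<^sub>R D f t) t"
      using D_scale[OF smooth_germ_dir_deriv[OF f(1)], of "\<lambda>t. t *\<^sub>R D f t" 1] by (auto elim: eventually_mono)
    show "\<forall>\<^sub>F t in nhds 0. D (\<lambda>t. f t + u t) t = D f t + D u t"
      using smooth_germ_has_dir_deriv[OF f(1)] smooth_germ_has_dir_deriv[OF f(2)]
      by eventually_elim (rule dir_deriv_eqI[OF has_derivative_add])
  qed
  have s: "smooth_germ (\<lambda>t. t *\<^sub>R D f t)" if "smooth_germ f" for f :: "real \<Rightarrow> 'b"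
    by (intro smooth_germ_scaleR smooth_germ_ident smooth_germ_dir_deriv that)
  have 2: "\<forall>\<^sub>F t in nhds 0. D (D g) t = D h t + (D h t + t *\<^sub>R D (D h) t)"
    using eventually_dir_deriv_cong[OF D_scale[OF h g], of 1] D2[OF h s[OF h]] D1[OF h h]
    by eventually_elim simp
  then show "D (D g) 0 = 2 *\<^sub>R D h 0"
    using eventually_nhds_x_imp_x[OF 2] by (simp add: scaleR_2)
  have h': "smooth_germ (D h)" using h by (rule smooth_germ_dir_deriv)
  have "\<forall>\<^sub>F t in nhds 0. D (D (D g)) t = D (D h) t + (D (D h) t + (D (D h) t + t *\<^sub>R D (D (D h)) t))"
    using eventually_dir_deriv_cong[OF 2, of 1] D2[OF h' smooth_germ_add[OF h' s[OF h']]] D2[OF h' s[OF h']] D1[OF h' h']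
    by eventually_elim simp
  from eventually_nhds_x_imp_x[OF this] show "D (D (D g)) 0 = 3 *\<^sub>R D (D h) 0"
    using scaleR_left_distrib[of 1 2 "D (D h) 0"] by (simp add: scaleR_2)
qed

lemma det_nonzero_if_independent:
  fixes a b :: "real^2"
  assumes "a \<noteq> b" "independent {a, b}"
  shows "a $ 1 * b $ 2 - a $ 2 * b $ 1 \<noteq> 0"
proof
  assume 0: "a $ 1 * b $ 2 - a $ 2 * b $ 1 = 0"
  have a: "a \<noteq> 0" using assms(2) dependent_zero by blast
  obtain i where i: "a $ i \<noteq> 0" using a by (auto simp: vec_eq_iff)
  have "b = (b $ i / a $ i) *\<^sub>R a"
    using 0 i exhaust_2[of i] by (auto simp: vec_eq_iff forall_2 field_simps)
  then have "b \<in> span {a}" by (metis span_base span_scale singletonI)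
  moreover have "{a, b} - {b} = {a}" using assms(1) by auto
  ultimately have "dependent {a, b}" unfolding dependent_def by (intro bexI[of _ b]) auto
  with assms(2) show False by simp
qed

section \<open>The branches of the parabolic set\<close>

lemma tendsto_0_vec_2:
  fixes \<beta> :: "'t \<Rightarrow> real^2"
  assumes "((\<lambda>t. \<beta> t $ 1) \<longlongrightarrow> 0) G" "((\<lambda>t. \<beta> t $ 2) \<longlongrightarrow> 0) G"
  shows "(\<beta> \<longlongrightarrow> 0) G"
proof (rule vec_tendstoI)
  show "((\<lambda>t. \<beta> t $ i) \<longlongrightarrow> 0 $ i) G" for i using assms exhaust_2[of i] by auto
qed

context H_chart begin

text \<open>The Jacobian of \<open>\<phi>\<close> does not vanish near 0, so the parabolic sets of \<open>f\<close> and \<open>F\<close> correspond under \<open>\<phi>\<close>.\<close>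

lemma parabolic_fun_F_zero:
  assumes \<alpha>: "smooth_germ \<alpha>" "\<alpha> 0 = 0" and P: "\<forall>\<^sub>F t in nhds 0. parabolic_fun f (\<alpha> t) = 0"
  shows "\<forall>\<^sub>F t in at (0::real). parabolic_fun F (\<phi> (\<alpha> t)) = 0"
proof -
  define Jac where "Jac = (\<lambda>p. pd 1 \<phi> p $ 1 * pd 2 \<phi> p $ 2 - pd 2 \<phi> p $ 1 * pd 1 \<phi> p $ 2)"
  have "smooth_germ Jac" unfolding Jac_def
    by (intro smooth_germ_diff smooth_germ_mult smooth_germ_nth smooth_germ_dir_deriv \<phi>)
  then have J: "\<forall>\<^sub>F p in nhds 0. Jac p \<noteq> 0"
    using J0 by (intro smooth_germ_eventually_nonzero) (simp_all add: Jac_def)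
  have "\<forall>\<^sub>F p in nhds 0. parabolic_fun f p = parabolic_fun (\<lambda>p. F (\<phi> p)) p"
  proof -
    have d1: "\<forall>\<^sub>F p in nhds 0. pd i f p = pd i (\<lambda>p. F (\<phi> p)) p" for i
      by (rule eventually_dir_deriv_cong[OF f_eq_F])
    have d2: "\<forall>\<^sub>F p in nhds 0. pd i (pd j f) p = pd i (pd j (\<lambda>p. F (\<phi> p))) p" for i j
      by (rule eventually_dir_deriv_cong[OF d1])
    show ?thesis using d1[of 1] d1[of 2] d2[of 1 1] d2[of 2 1] d2[of 2 2]
      by eventually_elim (simp add: parabolic_fun_def partial_deriv_eq)
  qed
  with parabolic_fun_reparametrize[OF smooth_F \<phi>] J
  have "\<forall>\<^sub>F p in nhds 0. parabolic_fun f p = 0 \<longrightarrow> parabolic_fun F (\<phi> p) = 0"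
    by eventually_elim (simp add: Jac_def)
  from eventually_nhds_0_compose[OF \<alpha> this] P
  have "\<forall>\<^sub>F t in nhds 0. parabolic_fun F (\<phi> (\<alpha> t)) = 0" by eventually_elim simp
  then show ?thesis by (simp add: eventually_at_filter eventually_mono)
qed

text \<open>For orders \<open>i\<close> of \<open>x\<close> and \<open>j\<close> of \<open>y\<close> in this range, \<open>y / s\<close> stays bounded and \<open>s\<^sup>2 / y\<close> tends to 0. The orders
  \<open>(1, 1)\<close> concern the regular branch, \<open>(2, 2)\<close> and \<open>(2, 3)\<close> the cusp.\<close>

lemma no_generic_branch:
  fixes \<beta> :: "real \<Rightarrow> real^2" and \<xi> \<eta> :: "real \<Rightarrow> real"
  assumes q: "inflection_det \<noteq> 0" and s: "smooth_germ \<xi>" "\<xi> 0 \<noteq> 0" "smooth_germ \<eta>" "\<eta> 0 \<noteq> 0"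
    and ij: "1 \<le> i" "i \<le> j" "j < 2 * i"
    and \<beta>: "\<forall>\<^sub>F t in nhds 0. \<beta> t $ 1 = t ^ i * \<xi> t" "\<forall>\<^sub>F t in nhds 0. \<beta> t $ 2 = t ^ j * \<eta> t"
    and P: "\<forall>\<^sub>F t in at 0. parabolic_fun F (\<beta> t) = 0"
  shows False
proof -
  have lim: "(\<xi> \<longlongrightarrow> \<xi> 0) (at 0)" "(\<eta> \<longlongrightarrow> \<eta> 0) (at 0)"
    using smooth_germ_isCont s by (simp_all add: isCont_def)
  have at0: "\<forall>\<^sub>F t in nhds (0::real). Q t \<Longrightarrow> \<forall>\<^sub>F t in at 0. Q t" for Q
    by (simp add: eventually_at_filter eventually_mono)
  note b = at0[OF \<beta>(1)] at0[OF \<beta>(2)]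
  have t0: "\<forall>\<^sub>F t in at 0. (t::real) \<noteq> 0" by (simp add: eventually_at_filter)
  define n where "n = 3 * k - 2"
  have n: "n \<ge> 4" using k by (simp add: n_def)
  have jn: "j * n > i"
  proof -
    have "j * n \<ge> j * 4" using n by (rule mult_le_mono2)
    then show ?thesis using ij by linarith
  qed
  define c where "c = real (3 * k - 1)"
  define \<sigma> where "\<sigma> = (\<lambda>t. \<xi> t + c * (t ^ (j * n - i) * \<eta> t ^ n))"
  have \<sigma>: "(\<sigma> \<longlongrightarrow> \<xi> 0) (at 0)"
    unfolding \<sigma>_def by (rule tendsto_eq_rhs, (rule tendsto_intros lim)+) (use jn in \<open>simp add: power_0_left\<close>)
  have slope: "\<forall>\<^sub>F t in at 0. slope k (\<beta> t) = t ^ i * \<sigma> t"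
    using b
  proof eventually_elim
    case (elim t)
    have "t ^ (j * n) = t ^ i * t ^ (j * n - i)" using jn by (simp flip: power_add)
    then have "(t ^ j * \<eta> t) ^ n = t ^ i * (t ^ (j * n - i) * \<eta> t ^ n)"
      by (simp add: power_mult_distrib power_mult)
    then show ?case
      unfolding slope_def c_def[symmetric] n_def[symmetric] elim \<sigma>_def
      by (simp only: distrib_left mult.left_commute)
  qed
  have nz: "\<forall>\<^sub>F t in at 0. \<sigma> t \<noteq> 0" "\<forall>\<^sub>F t in at 0. \<eta> t \<noteq> 0"
    using tendsto_imp_eventually_ne \<sigma> lim s by blast+
  have "\<forall>\<^sub>F t in at 0. parabolic_fun F (\<beta> t) \<noteq> 0"
  proof (rule parabolic_fun_off_branches[OF q])
    have "((\<lambda>t. t ^ i * \<xi> t) \<longlongrightarrow> 0) (at 0)" "((\<lambda>t. t ^ j * \<eta> t) \<longlongrightarrow> 0) (at 0)"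
      by (rule tendsto_eq_rhs, (rule tendsto_intros lim)+, use ij in \<open>simp add: power_0_left\<close>)+
    then have "((\<lambda>t. \<beta> t $ 1) \<longlongrightarrow> 0) (at 0)" "((\<lambda>t. \<beta> t $ 2) \<longlongrightarrow> 0) (at 0)"
      using b by (simp_all cong: tendsto_cong)
    then show "(\<beta> \<longlongrightarrow> 0) (at 0)" by (rule tendsto_0_vec_2)
    show "\<forall>\<^sub>F t in at 0. \<beta> t $ 2 \<noteq> 0" using b(2) nz(2) t0 by eventually_elim simp
    show "\<forall>\<^sub>F t in at 0. slope k (\<beta> t) \<noteq> 0" using slope nz(1) t0 by eventually_elim simp
    have "((\<lambda>t. t ^ (j - i) * (\<eta> t / \<sigma> t)) \<longlongrightarrow> 0 ^ (j - i) * (\<eta> 0 / \<xi> 0)) (at 0)"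
      by (intro tendsto_intros lim \<sigma> s)
    moreover have "\<forall>\<^sub>F t in at 0. \<beta> t $ 2 / slope k (\<beta> t) = t ^ (j - i) * (\<eta> t / \<sigma> t)"
      using b(2) slope t0
    proof eventually_elim
      case (elim t)
      have "t ^ j = t ^ (j - i) * t ^ i" using ij by (simp flip: power_add)
      then show ?case using elim by simp
    qed
    ultimately show "((\<lambda>t. \<beta> t $ 2 / slope k (\<beta> t)) \<longlongrightarrow> 0 ^ (j - i) * (\<eta> 0 / \<xi> 0)) (at 0)"
      by (rule tendsto_cong[THEN iffD2, rotated])
    have "((\<lambda>t. t ^ (2 * i - j) * ((\<sigma> t)\<^sup>2 / \<eta> t)) \<longlongrightarrow> 0) (at 0)"
      by (rule tendsto_eq_rhs, (rule tendsto_intros lim \<sigma> s)+) (use ij in \<open>simp add: power_0_left\<close>)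
    moreover have "\<forall>\<^sub>F t in at 0. (slope k (\<beta> t))\<^sup>2 / \<beta> t $ 2 = t ^ (2 * i - j) * ((\<sigma> t)\<^sup>2 / \<eta> t)"
      using b(2) slope t0
    proof eventually_elim
      case (elim t)
      have "(t ^ i)\<^sup>2 = t ^ (2 * i - j) * t ^ j" using ij by (simp flip: power_add power_mult add: mult.commute)
      then show ?case using elim by (simp add: power_mult_distrib)
    qed
    ultimately show "((\<lambda>t. (slope k (\<beta> t))\<^sup>2 / \<beta> t $ 2) \<longlongrightarrow> 0) (at 0)"
      by (rule tendsto_cong[THEN iffD2, rotated])
  qed
  with P have "\<forall>\<^sub>F t in at (0::real). False" by eventually_elim simp
  then show False by simp
qed

lemma no_vertical_branch:
  fixes \<beta> :: "real \<Rightarrow> real^2" and \<xi> \<eta> :: "real \<Rightarrow> real"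
  assumes s: "smooth_germ \<xi>" "smooth_germ \<eta>" "\<eta> 0 \<noteq> 0"
    and \<beta>: "\<forall>\<^sub>F t in nhds 0. \<beta> t $ 1 = t\<^sup>2 * \<xi> t" "\<forall>\<^sub>F t in nhds 0. \<beta> t $ 2 = t * \<eta> t"
    and P: "\<forall>\<^sub>F t in at 0. parabolic_fun F (\<beta> t) = 0"
  shows False
proof -
  have lim: "(\<xi> \<longlongrightarrow> \<xi> 0) (at 0)" "(\<eta> \<longlongrightarrow> \<eta> 0) (at 0)"
    using smooth_germ_isCont s by (simp_all add: isCont_def)
  have at0: "\<forall>\<^sub>F t in nhds (0::real). Q t \<Longrightarrow> \<forall>\<^sub>F t in at 0. Q t" for Q
    by (simp add: eventually_at_filter eventually_mono)
  note b = at0[OF \<beta>(1)] at0[OF \<beta>(2)]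
  have t0: "\<forall>\<^sub>F t in at 0. (t::real) \<noteq> 0" by (simp add: eventually_at_filter)
  have nz: "\<forall>\<^sub>F t in at 0. \<eta> t \<noteq> 0" using tendsto_imp_eventually_ne lim s by blast
  define c where "c = real (3 * k - 1)"
  have "\<forall>\<^sub>F t in at 0. parabolic_fun F (\<beta> t) \<noteq> 0"
  proof (rule parabolic_fun_tangent_to_axis)
    have "((\<lambda>t. t\<^sup>2 * \<xi> t) \<longlongrightarrow> 0) (at 0)" "((\<lambda>t. t * \<eta> t) \<longlongrightarrow> 0) (at 0)"
      by (rule tendsto_eq_rhs, (rule tendsto_intros lim)+, simp)+
    then have "((\<lambda>t. \<beta> t $ 1) \<longlongrightarrow> 0) (at 0)" "((\<lambda>t. \<beta> t $ 2) \<longlongrightarrow> 0) (at 0)"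
      using b by (simp_all cong: tendsto_cong)
    then show "(\<beta> \<longlongrightarrow> 0) (at 0)" by (rule tendsto_0_vec_2)
    show "\<forall>\<^sub>F t in at 0. \<beta> t $ 2 \<noteq> 0" using b(2) nz t0 by eventually_elim simp
    have "((\<lambda>t. \<xi> t / (\<eta> t)\<^sup>2 + c * (t ^ (3 * k - 4) * \<eta> t ^ (3 * k - 4)))
        \<longlongrightarrow> \<xi> 0 / (\<eta> 0)\<^sup>2 + c * (0 ^ (3 * k - 4) * \<eta> 0 ^ (3 * k - 4))) (at 0)"
      by (intro tendsto_intros lim) (use s in simp)
    moreover have "\<forall>\<^sub>F t in at 0. slope k (\<beta> t) / (\<beta> t $ 2)\<^sup>2 = \<xi> t / (\<eta> t)\<^sup>2 + c * (t ^ (3 * k - 4) * \<eta> t ^ (3 * k - 4))"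
      using b nz t0
    proof eventually_elim
      case (elim t)
      have "3 * k - 2 = (3 * k - 4) + 2" using k by simp
      then have "(t * \<eta> t) ^ (3 * k - 2) = (t * \<eta> t)\<^sup>2 * (t ^ (3 * k - 4) * \<eta> t ^ (3 * k - 4))"
        by (simp only: power_add power_mult_distrib) (simp add: algebra_simps)
      then have "slope k (\<beta> t) = (t * \<eta> t)\<^sup>2 * (\<xi> t / (\<eta> t)\<^sup>2 + c * (t ^ (3 * k - 4) * \<eta> t ^ (3 * k - 4)))"
      proof -
        have "(t * \<eta> t)\<^sup>2 * (\<xi> t / (\<eta> t)\<^sup>2) = t\<^sup>2 * \<xi> t" using elim by (simp add: power_mult_distrib)
        then show ?thesis
          unfolding slope_def c_def[symmetric] elim(1,2)
          using \<open>(t * \<eta> t) ^ (3 * k - 2) = _\<close> by (simp only: distrib_left mult.left_commute)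
      qed
      then show ?case using elim by simp
    qed
    ultimately show "((\<lambda>t. slope k (\<beta> t) / (\<beta> t $ 2)\<^sup>2) \<longlongrightarrow> \<xi> 0 / (\<eta> 0)\<^sup>2 + c * (0 ^ (3 * k - 4) * \<eta> 0 ^ (3 * k - 4))) (at 0)"
      by (simp cong: tendsto_cong)
  qed
  with P have "\<forall>\<^sub>F t in at (0::real). False" by eventually_elim simp
  then show False by simp
qed

text \<open>A regular curve that is not tangent to the x-axis either has orders \<open>(1, 1)\<close> or is tangent to the y-axis;
  both are excluded above.\<close>

lemma regular_branch_tangent:
  assumes q: "inflection_det \<noteq> 0" and \<beta>: "smooth_germ \<beta>" "\<beta> 0 = 0" "D \<beta> 0 \<noteq> 0"
    and P: "\<forall>\<^sub>F t in at 0. parabolic_fun F (\<beta> t) = 0"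
  shows "D \<beta> 0 $ 2 = 0" "D \<beta> 0 $ 1 \<noteq> 0"
proof -
  obtain h where h: "smooth_germ h" "\<forall>\<^sub>F t in nhds 0. \<beta> t = t *\<^sub>R h t" "h 0 = D \<beta> 0"
    by (rule divide_by_parameter[OF \<beta>(1,2)]) (rule that)
  have s: "smooth_germ (\<lambda>t. h t $ 1)" "smooth_germ (\<lambda>t. h t $ 2)" by (intro smooth_germ_nth h)+
  have b: "\<forall>\<^sub>F t in nhds 0. \<beta> t $ 1 = t * h t $ 1" "\<forall>\<^sub>F t in nhds 0. \<beta> t $ 2 = t * h t $ 2"
    using h(2) by (eventually_elim, simp)+
  show 2: "D \<beta> 0 $ 2 = 0"
  proof (rule ccontr)
    assume y: "D \<beta> 0 $ 2 \<noteq> 0"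
    show False
    proof (cases "h 0 $ 1 = 0")
      case True
      obtain g where g: "smooth_germ g" "\<forall>\<^sub>F t in nhds 0. h t $ 1 = t *\<^sub>R g t"
        by (rule divide_by_parameter[OF s(1) True]) (rule that)
      have "\<forall>\<^sub>F t in nhds 0. \<beta> t $ 1 = t\<^sup>2 * g t"
        using b(1) g(2) by eventually_elim (simp add: power2_eq_square)
      from no_vertical_branch[OF g(1) s(2) _ this b(2) P] y h(3) show False by simp
    next
      case False
      from no_generic_branch[OF q s(1) False s(2), of 1 1 \<beta>] y h(3) b P show False by simp
    qed
  qed
  with \<beta>(3) show "D \<beta> 0 $ 1 \<noteq> 0" by (auto simp: vec_eq_iff forall_2)
qed

text \<open>If \<open>E\<close> had a nonzero x-component at 0, the orders of \<open>x\<close> and \<open>y\<close> would be \<open>(2, 2)\<close> or, by the independence of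
  \<open>E\<close> and \<open>E'\<close>, \<open>(2, 3)\<close>. So the cusp is tangent to the y-axis, and independence gives the orders
  \<open>(3, 2)\<close>.\<close>

lemma singular_branch_form:
  assumes q: "inflection_det \<noteq> 0" and E: "smooth_germ E" "\<forall>\<^sub>F t in nhds 0. \<beta> t = t\<^sup>2 *\<^sub>R E t"
    and det: "E 0 $ 1 * D E 0 $ 2 - E 0 $ 2 * D E 0 $ 1 \<noteq> 0"
    and P: "\<forall>\<^sub>F t in at 0. parabolic_fun F (\<beta> t) = 0"
  obtains \<xi> \<eta> where "smooth_germ \<xi>" "\<xi> 0 \<noteq> 0" "smooth_germ \<eta>" "\<eta> 0 \<noteq> 0"
    "\<forall>\<^sub>F t in nhds 0. \<beta> t $ 1 = t ^ 3 * \<xi> t" "\<forall>\<^sub>F t in nhds 0. \<beta> t $ 2 = t\<^sup>2 * \<eta> t"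
proof -
  have s: "smooth_germ (\<lambda>t. E t $ 1)" "smooth_germ (\<lambda>t. E t $ 2)" by (intro smooth_germ_nth E)+
  have dE: "D (\<lambda>t. E t $ i) 0 = D E 0 $ i" for i
    by (rule dir_deriv_eqI[OF bounded_linear.has_derivative[OF bounded_linear_vec_nth smooth_germ_has_dir_deriv_0[OF E(1)]]])
  have b: "\<forall>\<^sub>F t in nhds 0. \<beta> t $ 1 = t ^ 2 * E t $ 1" "\<forall>\<^sub>F t in nhds 0. \<beta> t $ 2 = t ^ 2 * E t $ 2"
    using E(2) by (eventually_elim, simp)+
  have E1: "E 0 $ 1 = 0"
  proof (rule ccontr)
    assume x: "E 0 $ 1 \<noteq> 0"
    show False
    proof (cases "E 0 $ 2 = 0")
      case False
      from no_generic_branch[OF q s(1) x s(2) False, of 2 2 \<beta>] b P show False by simp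
    next
      case True
      obtain g where g: "smooth_germ g" "\<forall>\<^sub>F t in nhds 0. E t $ 2 = t *\<^sub>R g t" "g 0 = D (\<lambda>t. E t $ 2) 0"
        by (rule divide_by_parameter[OF s(2) True]) (rule that)
      have "\<forall>\<^sub>F t in nhds 0. \<beta> t $ 2 = t ^ 3 * g t"
        using b(2) g(2) by eventually_elim (simp add: power2_eq_square power3_eq_cube)
      moreover have "g 0 \<noteq> 0" using g(3) True det by (simp add: dE)
      ultimately show False using no_generic_branch[OF q s(1) x g(1), of 2 3 \<beta>] b(1) P by simp
    qed
  qed
  obtain \<xi> where \<xi>: "smooth_germ \<xi>" "\<forall>\<^sub>F t in nhds 0. E t $ 1 = t *\<^sub>R \<xi> t" "\<xi> 0 = D (\<lambda>t. E t $ 1) 0"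
    by (rule divide_by_parameter[OF s(1) E1]) (rule that)
  show ?thesis
  proof (rule that[of \<xi> "\<lambda>t. E t $ 2"])
    show "\<xi> 0 \<noteq> 0" "E 0 $ 2 \<noteq> 0" using det E1 \<xi>(3) by (auto simp: dE)
    show "\<forall>\<^sub>F t in nhds 0. \<beta> t $ 1 = t ^ 3 * \<xi> t"
      using b(1) \<xi>(2) by eventually_elim (simp add: power2_eq_square power3_eq_cube)
  qed (use \<xi>(1) s(2) b(2) in auto)
qed

end

section \<open>Binormals and height functions\<close>

lemma D_nth:
  assumes "smooth_germ c"
  shows "\<forall>\<^sub>F t in nhds 0. D (\<lambda>t. c t $ a) t = D c t $ a"
  using smooth_germ_has_dir_deriv[OF assms]
  by eventually_elim (rule dir_deriv_eqI[OF bounded_linear.has_derivative[OF bounded_linear_vec_nth]])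

text \<open>Exact forms of the asymptotic rules \<open>(t\<^sup>m)' = m t\<^sup>m\<^sup>-\<^sup>1\<close> and \<open>(t\<^sup>m)'' = m (m - 1) t\<^sup>m\<^sup>-\<^sup>2\<close> for \<open>t\<^sup>m h\<close>
  with \<open>m = n + 2\<close>: the smooth factors \<open>u\<close> and \<open>v\<close> have the expected values at 0.\<close>

lemma D_D_power_mult:
  fixes h :: "real \<Rightarrow> real"
  assumes h: "smooth_germ h"
  obtains u v where "smooth_germ u" "smooth_germ v"
    "\<forall>\<^sub>F t in nhds 0. D (\<lambda>t. t ^ (n + 2) * h t) t = t ^ (n + 1) * u t"
    "\<forall>\<^sub>F t in nhds 0. D (D (\<lambda>t. t ^ (n + 2) * h t)) t = t ^ n * v t"
    "u 0 = real (n + 2) * h 0" "v 0 = real (n + 1) * (real (n + 2) * h 0)"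
proof -
  define step where "step = (\<lambda>m (h::real \<Rightarrow> real) t. real (Suc m) * h t + t * D h t)"
  have s: "smooth_germ (step m h)" if "smooth_germ h" for m h
    unfolding step_def by (intro smooth_germ_intros smooth_germ_dir_deriv that)
  have d: "\<forall>\<^sub>F t in nhds 0. D (\<lambda>t. t ^ Suc m * h t) t = t ^ m * step m h t" if "smooth_germ h" for m h
    using D_power_scale[OF that, of m] by (simp add: step_def)
  have 1: "\<forall>\<^sub>F t in nhds 0. D (\<lambda>t. t ^ (n + 2) * h t) t = t ^ Suc n * step (Suc n) h t"
    using d[OF h, of "Suc n"] by simp
  have 2: "\<forall>\<^sub>F t in nhds 0. D (D (\<lambda>t. t ^ (n + 2) * h t)) t = t ^ n * step n (step (Suc n) h) t"
    using eventually_dir_deriv_cong[OF 1, of 1] d[OF s[OF h, of "Suc n"], of n] by eventually_elim simp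
  show ?thesis
  proof (rule that)
    show "smooth_germ (step (Suc n) h)" "smooth_germ (step n (step (Suc n) h))" by (intro s h)+
    show "\<forall>\<^sub>F t in nhds 0. D (\<lambda>t. t ^ (n + 2) * h t) t = t ^ (n + 1) * step (Suc n) h t" using 1 by simp
    show "\<forall>\<^sub>F t in nhds 0. D (D (\<lambda>t. t ^ (n + 2) * h t)) t = t ^ n * step n (step (Suc n) h) t" by (rule 2)
    show "step (Suc n) h 0 = real (n + 2) * h 0" "step n (step (Suc n) h) 0 = real (n + 1) * (real (n + 2) * h 0)"
      by (simp_all add: step_def)
  qed
qed

lemma cross3_combinations:
  fixes A B C :: "real^3"
  shows "cross3 (a1 *\<^sub>R A + a2 *\<^sub>R B + a3 *\<^sub>R C) (b1 *\<^sub>R A + b2 *\<^sub>R B + b3 *\<^sub>R C) =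
    (a1 * b2 - a2 * b1) *\<^sub>R cross3 A B + (a1 * b3 - a3 * b1) *\<^sub>R cross3 A C + (a2 * b3 - a3 * b2) *\<^sub>R cross3 B C"
  by (simp add: cross3_simps)

context H_chart begin

text \<open>In the coordinates of \<open>\<Psi>\<close> the curve is \<open>(t\<^sup>3 \<xi>, t\<^sup>5 \<mu>, t\<^sup>6 \<rho>)\<close> with \<open>\<mu>(0) = \<xi>(0) \<eta>(0)\<close>. The velocity is \<open>t\<^sup>2 U\<close> and the
  acceleration is \<open>t V + t\<^sup>4 W\<close>, where \<open>W\<close> comes from the second derivatives of \<open>\<Psi>\<close>. In \<open>U \<times> V\<close> the pair
  \<open>(1, 2)\<close> has the lowest order, with the coefficient
  \<open>3 \<xi> \<cdot> 20 \<mu> - 5 \<mu> \<cdot> 6 \<xi> = 30 \<xi> \<mu>\<close>; altogether the cross product is \<open>t\<^sup>5 b\<close> with \<open>b\<close> continuous.\<close>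

lemma singular_branch_binormal:
  assumes \<xi>: "smooth_germ \<xi>" "\<xi> 0 \<noteq> 0" and \<eta>: "smooth_germ \<eta>" "\<eta> 0 \<noteq> 0"
    and \<beta>: "\<forall>\<^sub>F t in nhds 0. \<beta> t $ 1 = t ^ 3 * \<xi> t" "\<forall>\<^sub>F t in nhds 0. \<beta> t $ 2 = t\<^sup>2 * \<eta> t"
    and \<gamma>: "\<forall>\<^sub>F t in nhds 0. \<gamma> t = F (\<beta> t)"
  shows "(unit_binormal \<gamma> \<longlongrightarrow> sgn ((30 * (\<xi> 0)\<^sup>2 * \<eta> 0) *\<^sub>R cross3 (pd 1 \<Psi> 0) (pd 2 \<Psi> 0))) (at_right 0)"
proof -
  (* The term y^(3k-1) of the second component has order 2 (3k - 1) = 5 + m > 5 in t. *)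
  define m where "m = 6 * k - 7"
  have m: "2 * (3 * k - 1) = 5 + m" "m > 0" using k by (simp_all add: m_def)
  define \<mu> where "\<mu> = (\<lambda>t. \<xi> t * \<eta> t + t ^ m * \<eta> t ^ (3 * k - 1))"
  define \<rho> where "\<rho> = (\<lambda>t. \<eta> t ^ 3)"
  have s: "smooth_germ \<mu>" "smooth_germ \<rho>"
    unfolding \<mu>_def \<rho>_def by (intro smooth_germ_intros \<xi> \<eta>)+
  have \<mu>0: "\<mu> 0 = \<xi> 0 * \<eta> 0" using m by (simp add: \<mu>_def)
  define c where "c = (\<lambda>t. vector [t ^ (1 + 2) * \<xi> t, t ^ (3 + 2) * \<mu> t, t ^ (4 + 2) * \<rho> t] :: real^3)"
  have c: "smooth_germ c" "c 0 = 0"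
    unfolding c_def by (intro smooth_germ_intros \<xi> s) (simp add: vector_3_eq)
  have \<gamma>c: "\<forall>\<^sub>F t in nhds 0. \<gamma> t = \<Psi> (c t)"
    using \<gamma> \<beta>
  proof eventually_elim
    case (elim t)
    have "(t\<^sup>2 * \<eta> t) ^ (3 * k - 1) = t ^ (5 + m) * \<eta> t ^ (3 * k - 1)"
      unfolding m(1)[symmetric] power_mult_distrib power_mult ..
    then have "(t ^ 3 * \<xi> t) * (t\<^sup>2 * \<eta> t) + (t\<^sup>2 * \<eta> t) ^ (3 * k - 1) = t ^ (3 + 2) * \<mu> t"
      by (simp only: \<mu>_def) (simp add: power_add algebra_simps numeral_eq_Suc)
    moreover have "(t\<^sup>2 * \<eta> t) ^ 3 = t ^ (4 + 2) * \<rho> t"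
      by (simp add: \<rho>_def power_mult_distrib flip: power_mult)
    moreover have "t ^ 3 * \<xi> t = t ^ (1 + 2) * \<xi> t" by (simp add: power3_eq_cube)
    ultimately have "H_germ k (\<beta> t) = c t"
      unfolding H_germ_def c_def elim(2,3) by (simp only:)
    then show ?case using elim(1) by (simp add: F_def)
  qed
  note \<Psi>c = smooth_germ_compose[OF \<Psi>(1) c]
  obtain u1 v1 where uv1: "smooth_germ u1" "smooth_germ v1"
    "\<forall>\<^sub>F t in nhds 0. D (\<lambda>t. t ^ (1 + 2) * \<xi> t) t = t ^ (1 + 1) * u1 t"
    "\<forall>\<^sub>F t in nhds 0. D (D (\<lambda>t. t ^ (1 + 2) * \<xi> t)) t = t ^ 1 * v1 t"
    "u1 0 = real (1 + 2) * \<xi> 0" "v1 0 = real (1 + 1) * (real (1 + 2) * \<xi> 0)"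
    by (rule D_D_power_mult[OF \<xi>(1), of 1]) (rule that)
  obtain u2 v2 where uv2: "smooth_germ u2" "smooth_germ v2"
    "\<forall>\<^sub>F t in nhds 0. D (\<lambda>t. t ^ (3 + 2) * \<mu> t) t = t ^ (3 + 1) * u2 t"
    "\<forall>\<^sub>F t in nhds 0. D (D (\<lambda>t. t ^ (3 + 2) * \<mu> t)) t = t ^ 3 * v2 t"
    "u2 0 = real (3 + 2) * \<mu> 0" "v2 0 = real (3 + 1) * (real (3 + 2) * \<mu> 0)"
    by (rule D_D_power_mult[OF s(1), of 3]) (rule that)
  obtain u3 v3 where uv3: "smooth_germ u3" "smooth_germ v3"
    "\<forall>\<^sub>F t in nhds 0. D (\<lambda>t. t ^ (4 + 2) * \<rho> t) t = t ^ (4 + 1) * u3 t"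
    "\<forall>\<^sub>F t in nhds 0. D (D (\<lambda>t. t ^ (4 + 2) * \<rho> t)) t = t ^ 4 * v3 t"
    "u3 0 = real (4 + 2) * \<rho> 0" "v3 0 = real (4 + 1) * (real (4 + 2) * \<rho> 0)"
    by (rule D_D_power_mult[OF s(2), of 4]) (rule that)
  have cn: "(\<lambda>t. c t $ 1) = (\<lambda>t. t ^ (1 + 2) * \<xi> t)" "(\<lambda>t. c t $ 2) = (\<lambda>t. t ^ (3 + 2) * \<mu> t)"
     "(\<lambda>t. c t $ 3) = (\<lambda>t. t ^ (4 + 2) * \<rho> t)"
    unfolding c_def by simp_all
  have DDc: "\<forall>\<^sub>F t in nhds 0. D (D (\<lambda>t. c t $ a)) t = D (D c) t $ a" for a
    using eventually_dir_deriv_cong[OF D_nth[OF c(1), of a], of 1] D_nth[OF smooth_germ_dir_deriv[OF c(1)], of 1 a]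
    by eventually_elim simp
  have Dc1: "\<forall>\<^sub>F t in nhds 0. D c t $ 1 = t\<^sup>2 * u1 t"
    using D_nth[OF c(1), of 1, unfolded cn] uv1(3) by eventually_elim (simp add: power2_eq_square)
  have Dc2: "\<forall>\<^sub>F t in nhds 0. D c t $ 2 = t ^ 4 * u2 t"
    using D_nth[OF c(1), of 2, unfolded cn] uv2(3) by eventually_elim simp
  have Dc3: "\<forall>\<^sub>F t in nhds 0. D c t $ 3 = t ^ 5 * u3 t"
    using D_nth[OF c(1), of 3, unfolded cn] uv3(3) by eventually_elim simp
  have DDc1: "\<forall>\<^sub>F t in nhds 0. D (D c) t $ 1 = t * v1 t"
    using DDc[of 1, unfolded cn] uv1(4) by eventually_elim simp
  have DDc2: "\<forall>\<^sub>F t in nhds 0. D (D c) t $ 2 = t ^ 3 * v2 t"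
    using DDc[of 2, unfolded cn] uv2(4) by eventually_elim simp
  have DDc3: "\<forall>\<^sub>F t in nhds 0. D (D c) t $ 3 = t ^ 4 * v3 t"
    using DDc[of 3, unfolded cn] uv3(4) by eventually_elim simp
  define A where "A = (\<lambda>a t. pd a \<Psi> (c t))"
  define B where "B = (\<lambda>a b t. pd a (pd b \<Psi>) (c t))"
  define U where "U = (\<lambda>t. u1 t *\<^sub>R A 1 t + (t\<^sup>2 * u2 t) *\<^sub>R A 2 t + (t ^ 3 * u3 t) *\<^sub>R A 3 t)"
  define V where "V = (\<lambda>t. v1 t *\<^sub>R A 1 t + (t\<^sup>2 * v2 t) *\<^sub>R A 2 t + (t ^ 3 * v3 t) *\<^sub>R A 3 t)"
  define W where "W = (\<lambda>t. u1 t *\<^sub>R (u1 t *\<^sub>R B 1 1 t + (t\<^sup>2 * u2 t) *\<^sub>R B 2 1 t + (t ^ 3 * u3 t) *\<^sub>R B 3 1 t)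
      + (t\<^sup>2 * u2 t) *\<^sub>R (u1 t *\<^sub>R B 1 2 t + (t\<^sup>2 * u2 t) *\<^sub>R B 2 2 t + (t ^ 3 * u3 t) *\<^sub>R B 3 2 t)
      + (t ^ 3 * u3 t) *\<^sub>R (u1 t *\<^sub>R B 1 3 t + (t\<^sup>2 * u2 t) *\<^sub>R B 2 3 t + (t ^ 3 * u3 t) *\<^sub>R B 3 3 t))"
  define b where "b = (\<lambda>t. (u1 t * v2 t - u2 t * v1 t) *\<^sub>R cross3 (A 1 t) (A 2 t)
      + (t * (u1 t * v3 t - u3 t * v1 t)) *\<^sub>R cross3 (A 1 t) (A 3 t)
      + (t ^ 3 * (u2 t * v3 t - u3 t * v2 t)) *\<^sub>R cross3 (A 2 t) (A 3 t) + t *\<^sub>R cross3 (U t) (W t))"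
  have "\<forall>\<^sub>F t in nhds 0. cross3 (curve_deriv 1 \<gamma> t) (curve_deriv 2 \<gamma> t) = t ^ 5 *\<^sub>R b t"
    using curve_deriv_eq_dir_deriv[OF \<Psi>c \<gamma>c, of 1] curve_deriv_eq_dir_deriv[OF \<Psi>c \<gamma>c, of 2]
      chain_rule[OF \<Psi>(1) c, of 1] chain_rule_2[OF \<Psi>(1) c, of 1 1] Dc1 Dc2 Dc3 DDc1 DDc2 DDc3
  proof eventually_elim
    case (elim t)
    have 1: "curve_deriv 1 \<gamma> t = t\<^sup>2 *\<^sub>R U t"
      using elim(1,3) elim(5-7)
      by (simp add: sum_3 U_def A_def scaleR_add_right power2_eq_square numeral_eq_Suc algebra_simps)
    have 2: "curve_deriv 2 \<gamma> t = t *\<^sub>R V t + t ^ 4 *\<^sub>R W t"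
    proof -
      have "curve_deriv 2 \<gamma> t = D (D (\<lambda>t. \<Psi> (c t))) t" using elim(2) by (simp add: numeral_2_eq_2)
      then show ?thesis
        unfolding elim(4) sum_3 elim(5-10) A_def[symmetric] V_def W_def
        by (simp add: A_def B_def scaleR_add_right numeral_eq_Suc algebra_simps)
    qed
    have 3: "cross3 (U t) (V t) = (t\<^sup>2 * (u1 t * v2 t - u2 t * v1 t)) *\<^sub>R cross3 (A 1 t) (A 2 t)
       + (t ^ 3 * (u1 t * v3 t - u3 t * v1 t)) *\<^sub>R cross3 (A 1 t) (A 3 t)
       + (t ^ 5 * (u2 t * v3 t - u3 t * v2 t)) *\<^sub>R cross3 (A 2 t) (A 3 t)"
      unfolding U_def V_def cross3_combinations
      by (simp add: algebra_simps numeral_eq_Suc)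
    show ?case
      unfolding 1 2 cross_mult_left cross_mult_right cross_add_right 3 b_def
      by (simp add: scaleR_add_right numeral_eq_Suc mult.assoc)
  qed
  then have ub: "\<forall>\<^sub>F t in at_right 0. unit_binormal \<gamma> t = sgn (b t)"
    unfolding eventually_at_filter
    by eventually_elim (simp add: unit_binormal_def sgn_scaleR)
  have cont: "(g \<longlongrightarrow> g 0) (at 0)" if "smooth_germ g" for g :: "real \<Rightarrow> 'z::real_normed_vector"
    using smooth_germ_isCont[OF that] by (simp add: isCont_def)
  have A: "(A a \<longlongrightarrow> pd a \<Psi> 0) (at 0)" and B: "(B a a' \<longlongrightarrow> pd a (pd a' \<Psi>) 0) (at 0)" for a a'
    using cont[OF smooth_germ_compose[OF smooth_germ_dir_deriv[OF \<Psi>(1)] c]]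
      cont[OF smooth_germ_compose[OF smooth_germ_dir_deriv[OF smooth_germ_dir_deriv[OF \<Psi>(1)]] c]] c(2)
    by (simp_all add: A_def B_def)
  note lims = tendsto_cross3 tendsto_intros A B cont[OF uv1(1)] cont[OF uv1(2)] cont[OF uv2(1)] cont[OF uv2(2)]
     cont[OF uv3(1)] cont[OF uv3(2)]
  have "\<exists>l. (U \<longlongrightarrow> l) (at 0)" unfolding U_def by (rule exI, (rule lims)+)
  then obtain lU where U: "(U \<longlongrightarrow> lU) (at 0)" by blast
  have "\<exists>l. (W \<longlongrightarrow> l) (at 0)" unfolding W_def by (rule exI, (rule lims)+)
  then obtain lW where W: "(W \<longlongrightarrow> lW) (at 0)" by blast
  have "(b \<longlongrightarrow> (30 * (\<xi> 0)\<^sup>2 * \<eta> 0) *\<^sub>R cross3 (pd 1 \<Psi> 0) (pd 2 \<Psi> 0)) (at 0)"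
    unfolding b_def
    by (rule tendsto_eq_rhs, (rule U W lims)+)
      (simp add: uv1(5,6) uv2(5,6) \<mu>0 power2_eq_square algebra_simps)
  then have "(b \<longlongrightarrow> (30 * (\<xi> 0)\<^sup>2 * \<eta> 0) *\<^sub>R cross3 (pd 1 \<Psi> 0) (pd 2 \<Psi> 0)) (at_right 0)"
    by (rule tendsto_within_subset) simp
  moreover have "(30 * (\<xi> 0)\<^sup>2 * \<eta> 0) *\<^sub>R cross3 (pd 1 \<Psi> 0) (pd 2 \<Psi> 0) \<noteq> 0"
    using \<xi> \<eta> \<Delta>0 by auto
  ultimately have "((\<lambda>t. sgn (b t)) \<longlongrightarrow> sgn ((30 * (\<xi> 0)\<^sup>2 * \<eta> 0) *\<^sub>R cross3 (pd 1 \<Psi> 0) (pd 2 \<Psi> 0))) (at_right 0)"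
    by (rule tendsto_sgn)
  then show ?thesis by (rule tendsto_cong[THEN iffD2, OF ub])
qed

lemma regular_branch_binormal:
  assumes \<beta>: "smooth_germ \<beta>" "\<beta> 0 = 0" "D \<beta> 0 $ 2 = 0"
    and \<gamma>: "\<forall>\<^sub>F t in nhds 0. \<gamma> t = F (\<beta> t)"
  shows "unit_binormal \<gamma> 0 = sgn ((D \<beta> 0 $ 1) ^ 3 *\<^sub>R cross3 (pd 1 \<Psi> 0) (pd 1 (pd 1 \<Psi>) 0))"
proof -
  note Fb = smooth_germ_compose[OF smooth_F \<beta>(1,2)]
  have "curve_deriv 1 \<gamma> 0 = D (\<lambda>t. F (\<beta> t)) 0" "curve_deriv 2 \<gamma> 0 = D (D (\<lambda>t. F (\<beta> t))) 0"
    using eventually_nhds_x_imp_x[OF curve_deriv_eq_dir_deriv[OF Fb \<gamma>, of 1]]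
      eventually_nhds_x_imp_x[OF curve_deriv_eq_dir_deriv[OF Fb \<gamma>, of 2]] by (simp_all add: numeral_2_eq_2)
  then show ?thesis
    unfolding unit_binormal_def F_derivs_0[OF \<beta>(1,2)] \<beta>(3)
    by (simp add: cross_mult_left cross_mult_right cross_add_right power3_eq_cube)
qed

text \<open>The height function is \<open>(\<Psi> \<bullet> w) \<circ> H\<^sub>k \<circ> \<phi>\<close>, to which \<open>function_on_H\<close> applies.\<close>

lemma height_singularity:
  assumes w: "pd 1 \<Psi> 0 \<bullet> w = 0"
  shows "pd 1 (pd 1 \<Psi>) 0 \<bullet> w = 0 \<Longrightarrow> pd 2 \<Psi> 0 \<bullet> w \<noteq> 0 \<Longrightarrow> A_singularity 1 (height f w)"
    and "pd 1 (pd 1 \<Psi>) 0 \<bullet> w \<noteq> 0 \<Longrightarrow> pd 2 \<Psi> 0 \<bullet> w = 0 \<Longrightarrow> pd 3 \<Psi> 0 \<bullet> w \<noteq> 0 \<Longrightarrow>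
      A_singularity 2 (height f w)"
proof -
  define G where "G = (\<lambda>z. \<Psi> z \<bullet> w)"
  have G: "smooth_germ G" "G 0 = 0" unfolding G_def by (simp_all add: smooth_germ_inner \<Psi>)
  have d: "\<forall>\<^sub>F z in nhds 0. dir_deriv v (\<lambda>z. g z \<bullet> w) z = dir_deriv v g z \<bullet> w"
    if "smooth_germ g" for g :: "real^3 \<Rightarrow> real^3" and v
    using smooth_germ_has_dir_deriv[OF that]
    by eventually_elim (rule dir_deriv_eqI[OF has_derivative_inner_left])
  have d1: "pd i G 0 = pd i \<Psi> 0 \<bullet> w" for i
    unfolding G_def using eventually_nhds_x_imp_x[OF d[OF \<Psi>(1)]] .
  have d2: "pd 1 (pd 1 G) 0 = pd 1 (pd 1 \<Psi>) 0 \<bullet> w"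
    unfolding G_def using dir_deriv_cong[OF d[OF \<Psi>(1)]]
      eventually_nhds_x_imp_x[OF d[OF smooth_germ_dir_deriv[OF \<Psi>(1)]]] by simp
  have h: "\<forall>\<^sub>F p in nhds 0. height f w p = G (H_germ k (\<phi> p))"
    using f_eq by eventually_elim (simp add: height_def G_def)
  note * = function_on_H[OF k G _ \<phi> J0 h, unfolded d1 d2, OF w]
  show "pd 1 (pd 1 \<Psi>) 0 \<bullet> w = 0 \<Longrightarrow> pd 2 \<Psi> 0 \<bullet> w \<noteq> 0 \<Longrightarrow> A_singularity 1 (height f w)"
    and "pd 1 (pd 1 \<Psi>) 0 \<bullet> w \<noteq> 0 \<Longrightarrow> pd 2 \<Psi> 0 \<bullet> w = 0 \<Longrightarrow> pd 3 \<Psi> 0 \<bullet> w \<noteq> 0 \<Longrightarrow>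
      A_singularity 2 (height f w)" by (fact *)+
qed

lemma D_phi_comp:
  assumes "smooth_germ \<alpha>" "\<alpha> 0 = 0"
  shows "D (\<lambda>t. \<phi> (\<alpha> t)) 0 = (D \<alpha> 0 $ 1) *\<^sub>R pd 1 \<phi> 0 + (D \<alpha> 0 $ 2) *\<^sub>R pd 2 \<phi> 0"
  using eventually_nhds_x_imp_x[OF chain_rule[OF \<phi>(1) assms, of 1]] assms(2) by (simp add: sum_2)

text \<open>Since \<open>\<alpha>\<close> has order 2, it is \<open>t\<^sup>2 \<delta>\<close>, and \<open>\<phi> \<circ> \<alpha> = t\<^sup>2 E\<close> by Hadamard's lemma for \<open>\<phi>\<close>. The derivative of \<open>\<alpha>\<close> at 0
  vanishes, so the second derivatives of \<open>\<phi>\<close> do not enter: \<open>E\<close> and \<open>E'\<close> at 0 are the images of \<open>\<delta>\<close> and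
  \<open>\<delta>'\<close> under \<open>D\<phi>\<close>.\<close>

lemma cusp_in_chart:
  assumes "cusp_curve_germ \<alpha>"
  obtains E where "smooth_germ E" "\<forall>\<^sub>F t in nhds 0. \<phi> (\<alpha> t) = t\<^sup>2 *\<^sub>R E t"
    "E 0 $ 1 * D E 0 $ 2 - E 0 $ 2 * D E 0 $ 1 \<noteq> 0"
proof -
  have \<alpha>: "smooth_germ \<alpha>" "\<alpha> 0 = 0" and cd: "curve_deriv 1 \<alpha> 0 = 0" "curve_deriv 2 \<alpha> 0 \<noteq> curve_deriv 3 \<alpha> 0"
    "independent {curve_deriv 2 \<alpha> 0, curve_deriv 3 \<alpha> 0}"
    using assms by (auto simp: cusp_curve_germ_def)
  have cD: "curve_deriv n \<alpha> 0 = (D ^^ n) \<alpha> 0" for n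
    using eventually_nhds_x_imp_x[OF curve_deriv_eq_dir_deriv[OF \<alpha>(1), of \<alpha> n]] by simp
  have D1: "D \<alpha> 0 = 0" using cd(1) by (simp add: cD)
  obtain h where h: "smooth_germ h" "\<forall>\<^sub>F t in nhds 0. \<alpha> t = t *\<^sub>R h t" "h 0 = D \<alpha> 0"
    by (rule divide_by_parameter[OF \<alpha>]) (rule that)
  obtain \<delta> where \<delta>: "smooth_germ \<delta>" "\<forall>\<^sub>F t in nhds 0. h t = t *\<^sub>R \<delta> t" "\<delta> 0 = D h 0"
    by (rule divide_by_parameter[OF h(1)]) (use h(3) D1 in \<open>auto intro: that\<close>)
  have "curve_deriv 2 \<alpha> 0 = 2 *\<^sub>R \<delta> 0" "curve_deriv 3 \<alpha> 0 = 6 *\<^sub>R D \<delta> 0"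
    using D2_D3_scale[OF h(1,2)] D2_D3_scale(1)[OF \<delta>(1,2)] \<delta>(3) by (simp_all add: cD numeral_2_eq_2 numeral_3_eq_3)
  with det_nonzero_if_independent[OF cd(2,3)]
  have det: "\<delta> 0 $ 1 * D \<delta> 0 $ 2 - \<delta> 0 $ 2 * D \<delta> 0 $ 1 \<noteq> 0" by auto
  obtain \<phi>' where \<phi>': "\<And>i. smooth_germ (\<phi>' i)"
    "\<forall>\<^sub>F x in nhds 0. \<phi> x = \<phi> 0 + (\<Sum>i\<in>UNIV. (x $ i) *\<^sub>R \<phi>' i x)" "\<And>i. \<phi>' i 0 = pd i \<phi> 0"
    by (rule Hadamard_vec[OF \<phi>(1)]) (rule that)
  define E where "E = (\<lambda>t. (\<delta> t $ 1) *\<^sub>R \<phi>' 1 (\<alpha> t) + (\<delta> t $ 2) *\<^sub>R \<phi>' 2 (\<alpha> t))"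
  have s: "smooth_germ (\<lambda>t. \<phi>' i (\<alpha> t))" for i by (rule smooth_germ_compose[OF \<phi>'(1) \<alpha>])
  have E: "smooth_germ E" unfolding E_def by (intro smooth_germ_add smooth_germ_scaleR smooth_germ_nth \<delta> s)
  have E0: "E 0 = (\<delta> 0 $ 1) *\<^sub>R pd 1 \<phi> 0 + (\<delta> 0 $ 2) *\<^sub>R pd 2 \<phi> 0"
    by (simp add: E_def \<alpha>(2) \<phi>'(3))
  have DE0: "D E 0 = (D \<delta> 0 $ 1) *\<^sub>R pd 1 \<phi> 0 + (D \<delta> 0 $ 2) *\<^sub>R pd 2 \<phi> 0"
  proof -
    have z: "D (\<lambda>t. \<phi>' i (\<alpha> t)) 0 = 0" for i
      using eventually_nhds_x_imp_x[OF chain_rule[OF \<phi>'(1) \<alpha>, of 1 i]] D1 by simp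
    have "(E has_derivative (\<lambda>v. (\<delta> 0 $ 1 *\<^sub>R dir_deriv v (\<lambda>t. \<phi>' 1 (\<alpha> t)) 0 + dir_deriv v \<delta> 0 $ 1 *\<^sub>R \<phi>' 1 (\<alpha> 0))
       + (\<delta> 0 $ 2 *\<^sub>R dir_deriv v (\<lambda>t. \<phi>' 2 (\<alpha> t)) 0 + dir_deriv v \<delta> 0 $ 2 *\<^sub>R \<phi>' 2 (\<alpha> 0)))) (at 0)"
      unfolding E_def
      by (intro has_derivative_add has_derivative_scaleR bounded_linear.has_derivative[OF bounded_linear_vec_nth]
        smooth_germ_has_dir_deriv_0 \<delta> s)
    from dir_deriv_eqI[OF this, of 1] show ?thesis by (simp add: z \<alpha>(2) \<phi>'(3))
  qed
  show ?thesis
  proof (rule that[OF E])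
    show "\<forall>\<^sub>F t in nhds 0. \<phi> (\<alpha> t) = t\<^sup>2 *\<^sub>R E t"
      using eventually_nhds_0_compose[OF \<alpha> \<phi>'(2)] h(2) \<delta>(2)
    proof eventually_elim
      case (elim t)
      have "\<alpha> t $ i = t\<^sup>2 * \<delta> t $ i" for i using elim(2,3) by (simp add: power2_eq_square)
      then show ?case using elim(1) by (simp add: sum_2 \<phi>(2) E_def scaleR_add_right)
    qed
    have "E 0 $ 1 * D E 0 $ 2 - E 0 $ 2 * D E 0 $ 1 =
      (pd 1 \<phi> 0 $ 1 * pd 2 \<phi> 0 $ 2 - pd 2 \<phi> 0 $ 1 * pd 1 \<phi> 0 $ 2) * (\<delta> 0 $ 1 * D \<delta> 0 $ 2 - \<delta> 0 $ 2 * D \<delta> 0 $ 1)"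
      unfolding E0 DE0 by (simp add: algebra_simps)
    then show "E 0 $ 1 * D E 0 $ 2 - E 0 $ 2 * D E 0 $ 1 \<noteq> 0" using det J0 by simp
  qed
qed

text \<open>The binormal is parallel to \<open>\<Psi>\<^sub>1 \<times> \<Psi>\<^sub>1\<^sub>1\<close>, whose inner product with \<open>\<Psi>\<^sub>2\<close> is up to sign the inflection
  determinant.\<close>

lemma regular_branch_height:
  assumes q: "inflection_det \<noteq> 0" and "regular_parabolic_branch f \<gamma>" and w: "w \<in> {unit_binormal \<gamma> 0, - unit_binormal \<gamma> 0}"
  shows "norm w = 1 \<and> A_singularity 1 (height f w)"
proof -
  obtain \<alpha> where \<alpha>: "smooth_germ \<alpha>" "\<alpha> 0 = 0" "curve_deriv 1 \<alpha> 0 \<noteq> 0"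
    and P: "\<forall>\<^sub>F t in nhds 0. parabolic_fun f (\<alpha> t) = 0" and \<gamma>: "\<forall>\<^sub>F t in nhds 0. \<gamma> t = f (\<alpha> t)"
    using assms(2) unfolding regular_parabolic_branch_def regular_curve_germ_def by blast
  define \<beta> where "\<beta> = (\<lambda>t. \<phi> (\<alpha> t))"
  have \<beta>: "smooth_germ \<beta>" "\<beta> 0 = 0"
    unfolding \<beta>_def using smooth_germ_compose[OF \<phi>(1) \<alpha>(1,2)] \<alpha>(2) \<phi>(2) by simp_all
  have D\<alpha>: "D \<alpha> 0 \<noteq> 0"
    using \<alpha>(3) eventually_nhds_x_imp_x[OF curve_deriv_eq_dir_deriv[OF \<alpha>(1), of \<alpha> 1]] by simp
  have "D \<beta> 0 \<noteq> 0"
  proof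
    assume "D \<beta> 0 = 0"
    then have z: "(D \<alpha> 0 $ 1) *\<^sub>R pd 1 \<phi> 0 + (D \<alpha> 0 $ 2) *\<^sub>R pd 2 \<phi> 0 = 0"
      using D_phi_comp[OF \<alpha>(1,2)] by (simp add: \<beta>_def)
    have "D \<alpha> 0 $ 1 * pd 1 \<phi> 0 $ i + D \<alpha> 0 $ 2 * pd 2 \<phi> 0 $ i = 0" for i
      using arg_cong[OF z, of "\<lambda>v. v $ i"] by simp
    from this[of 1] this[of 2]
    have "D \<alpha> 0 $ 1 * (pd 1 \<phi> 0 $ 1 * pd 2 \<phi> 0 $ 2 - pd 2 \<phi> 0 $ 1 * pd 1 \<phi> 0 $ 2) = 0"
      "D \<alpha> 0 $ 2 * (pd 1 \<phi> 0 $ 1 * pd 2 \<phi> 0 $ 2 - pd 2 \<phi> 0 $ 1 * pd 1 \<phi> 0 $ 2) = 0"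
      by algebra+
    then show False using J0 D\<alpha> by (simp add: vec_eq_iff forall_2)
  qed
  moreover have "\<forall>\<^sub>F t in at 0. parabolic_fun F (\<beta> t) = 0"
    unfolding \<beta>_def by (rule parabolic_fun_F_zero[OF \<alpha>(1,2) P])
  ultimately have t: "D \<beta> 0 $ 2 = 0" "D \<beta> 0 $ 1 \<noteq> 0"
    by (rule regular_branch_tangent[OF q \<beta>])+
  have "\<forall>\<^sub>F t in nhds 0. \<gamma> t = F (\<beta> t)"
    using \<gamma> eventually_nhds_0_compose[OF \<alpha>(1,2) f_eq_F] by eventually_elim (simp add: \<beta>_def)
  note b = regular_branch_binormal[OF \<beta> t(1) this]
  define n where "n = cross3 (pd 1 \<Psi> 0) (pd 1 (pd 1 \<Psi>) 0)"
  have nq: "pd 2 \<Psi> 0 \<bullet> n = - inflection_det" "pd 1 \<Psi> 0 \<bullet> n = 0" "pd 1 (pd 1 \<Psi>) 0 \<bullet> n = 0"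
    by (simp_all add: n_def dot_cross_self) (simp add: cross3_simps)
  then have n0: "n \<noteq> 0" using q by auto
  define N where "N = (D \<beta> 0 $ 1) ^ 3 *\<^sub>R n"
  have "N \<noteq> 0" using n0 t(2) by (simp add: N_def)
  then obtain r where r: "w = r *\<^sub>R n" "r \<noteq> 0"
    using w n0 t(2) unfolding b n_def[symmetric] sgn_div_norm
    by (auto intro: that[of "inverse (norm N) * (D \<beta> 0 $ 1) ^ 3"] that[of "- (inverse (norm N) * (D \<beta> 0 $ 1) ^ 3)"] simp: N_def)
  have "norm w = 1" using w \<open>N \<noteq> 0\<close> unfolding b n_def[symmetric] N_def[symmetric] by (auto simp: norm_sgn)
  moreover have "A_singularity 1 (height f w)"
    by (rule height_singularity(1)) (use nq r q in simp_all)
  ultimately show ?thesis ..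
qed

text \<open>The limiting binormal is parallel to \<open>\<Psi>\<^sub>1 \<times> \<Psi>\<^sub>2\<close>, whose inner products with \<open>\<Psi>\<^sub>1\<^sub>1\<close> and \<open>\<Psi>\<^sub>3\<close> are the inflection
  determinant and \<open>\<Delta>\<close>.\<close>

lemma singular_branch_height:
  assumes q: "inflection_det \<noteq> 0" and "singular_parabolic_branch f \<gamma>"
  shows "\<exists>b. (unit_binormal \<gamma> \<longlongrightarrow> b) (at_right 0) \<and>
            (\<forall>w\<in>{b, - b}. norm w = 1 \<and> A_singularity 2 (height f w))"
proof -
  obtain \<alpha> where \<alpha>: "cusp_curve_germ \<alpha>"
    and P: "\<forall>\<^sub>F t in nhds 0. parabolic_fun f (\<alpha> t) = 0" and \<gamma>: "\<forall>\<^sub>F t in nhds 0. \<gamma> t = f (\<alpha> t)"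
    using assms(2) unfolding singular_parabolic_branch_def by blast
  then have \<alpha>': "smooth_germ \<alpha>" "\<alpha> 0 = 0" by (auto simp: cusp_curve_germ_def)
  obtain E where E: "smooth_germ E" "\<forall>\<^sub>F t in nhds 0. \<phi> (\<alpha> t) = t\<^sup>2 *\<^sub>R E t"
    "E 0 $ 1 * D E 0 $ 2 - E 0 $ 2 * D E 0 $ 1 \<noteq> 0" by (rule cusp_in_chart[OF \<alpha>]) (rule that)
  obtain \<xi> \<eta> where \<xi>\<eta>: "smooth_germ \<xi>" "\<xi> 0 \<noteq> 0" "smooth_germ \<eta>" "\<eta> 0 \<noteq> 0"
    "\<forall>\<^sub>F t in nhds 0. \<phi> (\<alpha> t) $ 1 = t ^ 3 * \<xi> t" "\<forall>\<^sub>F t in nhds 0. \<phi> (\<alpha> t) $ 2 = t\<^sup>2 * \<eta> t"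
    by (rule singular_branch_form[OF q E parabolic_fun_F_zero[OF \<alpha>' P]]) (rule that)
  have "\<forall>\<^sub>F t in nhds 0. \<gamma> t = F (\<phi> (\<alpha> t))"
    using \<gamma> eventually_nhds_0_compose[OF \<alpha>' f_eq_F] by eventually_elim simp
  note lim = singular_branch_binormal[OF \<xi>\<eta> this]
  define n where "n = cross3 (pd 1 \<Psi> 0) (pd 2 \<Psi> 0)"
  define c where "c = 30 * (\<xi> 0)\<^sup>2 * \<eta> 0"
  define b where "b = sgn (c *\<^sub>R n)"
  have nq: "pd 1 \<Psi> 0 \<bullet> n = 0" "pd 2 \<Psi> 0 \<bullet> n = 0" "pd 1 (pd 1 \<Psi>) 0 \<bullet> n \<noteq> 0" "pd 3 \<Psi> 0 \<bullet> n \<noteq> 0"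
    using q \<Delta>0 by (simp_all add: n_def dot_cross_self inner_commute)
  then have n0: "c *\<^sub>R n \<noteq> 0" using \<xi>\<eta> by (auto simp: c_def)
  have "norm w = 1 \<and> A_singularity 2 (height f w)" if w: "w \<in> {b, - b}" for w
  proof
    show "norm w = 1" using w n0 by (auto simp: b_def norm_sgn)
    obtain r where r: "w = r *\<^sub>R n" "r \<noteq> 0"
      using w n0 unfolding b_def sgn_div_norm
      by (auto intro: that[of "inverse (norm (c *\<^sub>R n)) * c"] that[of "- (inverse (norm (c *\<^sub>R n)) * c)"])
    show "A_singularity 2 (height f w)"
      by (rule height_singularity(2)) (use nq r in simp_all)
  qed
  then show ?thesis using lim unfolding b_def n_def c_def by blast
qed

end

theorem theorem4p1:
  fixes f :: "real^2 \<Rightarrow> real^3" and \<gamma> \<gamma>h :: "real \<Rightarrow> real^3" and k :: nat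
  assumes "k \<ge> 2"
    and "smooth_germ f" and "f 0 = 0"
    and "A_equivalent f (H_germ k)"
    and "\<not> inflection_point f"
    and "regular_parabolic_branch f \<gamma>"
    and "singular_parabolic_branch f \<gamma>h"
  shows "(\<forall>w\<in>{unit_binormal \<gamma> 0, - unit_binormal \<gamma> 0}.
            norm w = 1 \<and> A_singularity 1 (height f w)) \<and>
         (\<exists>b. (unit_binormal \<gamma>h \<longlongrightarrow> b) (at_right 0) \<and>
            (\<forall>w\<in>{b, - b}. norm w = 1 \<and> A_singularity 2 (height f w)))"
proof -
  obtain \<phi> \<Psi> where "H_chart k \<phi> \<Psi> f"
    by (rule A_equivalent_H_chart[OF assms(1-4)]) (rule that)
  then interpret H_chart k \<phi> \<Psi> f .
  have "inflection_det \<noteq> 0" using inflection_point_if_inflection_det_0 assms(5) by blast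
  then show ?thesis
    using regular_branch_height[OF _ assms(6)] singular_branch_height[OF _ assms(7)] by blast
qed

end
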